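(* Let $V:\mathbb{R}\to\mathbb{R}$ be of class $C^{3}(\mathbb{R})$, symmetric, strictly convex, and satisfy $\liminf_{|x|\to\infty}\frac{V(x)}{\log|x|}>1$. Let $$\mathcal{E}[\rho]=-\frac{1}{2}\iint\log|x-y|\,\mathrm{d}\rho(x)\mathrm{d}\rho(y)+\int V\,\mathrm{d}\rho$$ for probability measures $\rho$ on $\mathbb{R}$. For $R>0$, $n\ge0$ put $c_n(R)=\frac{1}{h_n}\int_{-1}^1\frac{V(Rx)T_n(x)}{\sqrt{1-x^2}}\mathrm{d}x$ and $P_R(x)=1-\sum_{n\ge1}n c_n(R)T_n(x/R)$, and let $R_\star$ be the smallest positive solution of $\sum_{n\ge1}nc_n(R_\star)=1$ (so that the minimiser $\rho_{R_\star}$ of $\mathcal{E}$ over all probability measures on $\mathbb{R}$ is supported on $[-R_\star,R_\star]$). Define the excess free energy $$F(R)=\inf_{\rho\in\mathcal{P}([-R,R])}\mathcal{E}[\rho]-\mathcal{E}[\rho_{R_\star}],\qquad R>0.$$ Then $$F(R)=\frac{1}{2}\int_{\min\{R,R_\star\}}^{R_\star}\frac{P_r(r)^2}{r}\,\mathrm{d}r .$$ Moreover $F(R)>0$ for $R<R_\star$, $F(R)=0$ for $R\ge R_\star$, and there is a constant $C_\star>0$ such that $$F(R)\sim C_\star(R_\star-R)^3\,\mathbbm{1}_{R\le R_\star}\quad\text{as } R\to R_\star;$$ that is, $F(R_\star)=F'(R_\star)=F''(R_\star)=0$ but $\lim_{R\uparrow R_\star}F'''(R)=-3!\,C_\star<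0$.
   Context: $T_n$ is the Chebyshev polynomial of the first kind of degree $n$; $h_0=\pi$, $h_n=\pi/2$ for $n\ge1$. $\mathcal{P}([-R,R])$ is the set of probability measures supported in $[-R,R]$. $\mathbbm{1}_F$ is the indicator of the set defined by $F$. *)

theory Defs
  imports "HOL-Probability.Probability" "HOL-Library.Landau_Symbols"
begin

fun cheb_T :: "nat \<Rightarrow> real \<Rightarrow> real" where
  "cheb_T 0 x = 1"
| "cheb_T (Suc 0) x = x"
| "cheb_T (Suc (Suc n)) x = 2 * x * cheb_T (Suc n) x - cheb_T n x"

definition cheb_h :: "nat \<Rightarrow> real" where
  "cheb_h n = (if n = 0 then pi else pi / 2)"

definition cheb_c :: "(real \<Rightarrow> real) \<Rightarrow> nat \<Rightarrow> real \<Rightarrow> real" where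
  "cheb_c V n R = (1 / cheb_h n) *
     integral {-1..1} (\<lambda>x. V (R * x) * cheb_T n x / sqrt (1 - x\<^sup>2))"

definition P_fun :: "(real \<Rightarrow> real) \<Rightarrow> real \<Rightarrow> real \<Rightarrow> real" where
  "P_fun V R x = 1 - (\<Sum>n. real (Suc n) * cheb_c V (Suc n) R * cheb_T (Suc n) (x / R))"

definition strictly_convex :: "(real \<Rightarrow> real) \<Rightarrow> bool" where
  "strictly_convex V \<longleftrightarrow> (\<forall>x y t. x \<noteq> y \<and> 0 < t \<and> t < 1 \<longrightarrow>
      V ((1 - t) * x + t * y) < (1 - t) * V x + t * V y)"

definition energy_kernel :: "(real \<Rightarrow> real) \<Rightarrow> real \<times> real \<Rightarrow> ereal" where
  "energy_kernel V z = (if fst z = snd z then \<infinity>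
     else ereal (- ln \<bar>fst z - snd z\<bar> / 2 + (V (fst z) + V (snd z)) / 2))"

definition ereal_integral :: "'a measure \<Rightarrow> ('a \<Rightarrow> ereal) \<Rightarrow> ereal" where
  "ereal_integral M f = enn2ereal (\<integral>\<^sup>+ x. e2ennreal (max 0 (f x)) \<partial>M)
                      - enn2ereal (\<integral>\<^sup>+ x. e2ennreal (max 0 (- f x)) \<partial>M)"

definition energy :: "(real \<Rightarrow> real) \<Rightarrow> real measure \<Rightarrow> ereal" where
  "energy V \<rho> = ereal_integral (\<rho> \<Otimes>\<^sub>M \<rho>) (energy_kernel V)"

definition prob_measures_R :: "real measure set" where
  "prob_measures_R = {\<rho>. prob_space \<rho> \<and> sets \<rho> = sets borel}"

definition prob_measures_on :: "real \<Rightarrow> real measure set" where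
  "prob_measures_on R = {\<rho> \<in> prob_measures_R. emeasure \<rho> {-R..R} = 1}"

definition excess_free_energy :: "(real \<Rightarrow> real) \<Rightarrow> real \<Rightarrow> ereal" where
  "excess_free_energy V R =
     (INF \<rho>\<in>prob_measures_on R. energy V \<rho>) - (INF \<rho>\<in>prob_measures_R. energy V \<rho>)"

end

(* On [-R,R] the logarithmic kernel is diagonal in the Chebyshev basis, so completing squares bounds the
   energy of every measure from below by E R = ln (2/R) / 2 + c_0 - (sum of n c_n^2) / 4. With
   w = c_0' and g R = R w R = sum of n c_n, the recurrences between c_n and c_n' telescope to
   (sum of n c_n^2)' = 2 R (w R)^2, whence E' = -(1 - g)^2 / (2 R). For g R <= 1 the bound is attained by
   the superposition of arcsine laws of radius r < R with weights dg(r), plus the mass 1 - g R on the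
   arcsine law of radius R: two arcsine laws of radii r <= s have mutual energy ln (2/s). Beyond the
   critical radius (g Rs = 1) the energy is displacement convex and E' vanishes at Rs, so enlarging
   the support does not lower it. Near Rs, 1 - g vanishes linearly, since g' > 0, which gives the
   third order. *)
theory Submission
  imports Defs
begin

section \<open>The logarithmic kernel in the Chebyshev basis\<close>

text \<open>The Chebyshev series of the logarithm converges only conditionally and the kernel is
  singular on the diagonal, so the series is never integrated directly. It is damped by s^n with s <
  1 and cut at N, which gives kernels of finite rank. Up to an error uniform in both points they lie
  below the true kernel, which serves the lower bound, and above a constant, which permits Fatou's
  lemma for the arcsine laws. Energies may be infinite and their integrand has no sign. A constant
  \<open>B\<close>, available because a convex even potential grows linearly, makes the integrand
  nonnegative, and all estimates are made for nonnegative integrals. No minimiser is constructed: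
  finite mixtures come within any e of \<open>E R\<close>. Beyond the critical radius a measure is
  therefore compared with a near-minimiser on a slightly smaller interval [-r, r]. Interpolation
  then costs a factor 1 / (Rs - r), which is affordable because E r - E Rs is o(Rs - r).\<close>

lemma cheb_T_cos: "cheb_T n (cos t) = cos (real n * t)"
proof (induction n rule: less_induct)
  case (less n)
  consider "n = 0" | "n = 1" | m where "n = Suc (Suc m)"
    by (metis One_nat_def not0_implies_Suc)
  then show ?case
  proof cases
    case 3
    have "cos (real m * t + 2 * t) + cos (real m * t) = 2 * cos t * cos (real m * t + t)"
      using cos_add[of "real m * t + t" t] cos_diff[of "real m * t + t" t] by (simp add: algebra_simps)
    with 3 less show ?thesis by (simp add: algebra_simps)
  qed auto
qed

lemma continuous_cheb_T [continuous_intros]: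
  "continuous_on S f \<Longrightarrow> continuous_on S (\<lambda>x. cheb_T n (f x))"
proof (induction n rule: less_induct)
  case (less n)
  consider "n = 0" | "n = 1" | m where "n = Suc (Suc m)"
    by (metis One_nat_def not0_implies_Suc)
  then show ?case
    using less by cases (auto intro!: continuous_intros)
qed

lemma measurable_cheb_T [measurable]: "cheb_T n \<in> borel_measurable borel"
  by (intro borel_measurable_continuous_onI continuous_cheb_T continuous_on_id)

lemma abs_cheb_T_le_1:
  assumes "\<bar>x\<bar> \<le> 1" shows "\<bar>cheb_T n x\<bar> \<le> 1"
  using cheb_T_cos[of n "arccos x"] assms by (simp add: cos_arccos_abs)

text \<open>Real part of the power series of Ln (1 + z) at z = - s e^(it), where |1 + z|^2 = 1 - 2 s
  cos t + s^2. The term n = 0 is harmless because x / 0 = 0.\<close>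

lemma ln_cos_series:
  assumes "0 \<le> s" "s < 1"
  shows "(\<lambda>n. s ^ n / real n * cos (real n * t)) sums (- ln (1 - 2 * s * cos t + s\<^sup>2) / 2)"
proof -
  define z where "z = - (of_real s * cis t)"
  have nz: "norm z < 1" using assms by (simp add: z_def norm_mult)
  then have "1 + z \<noteq> 0"
    by (metis add.commute add_eq_0_iff norm_minus_cancel norm_one less_irrefl)
  have "(\<lambda>n. Re (- ((-z)^n) / of_nat n)) sums Re (Ln (1 + z))"
    by (intro sums_Re Ln_series' nz)
  also have "(\<lambda>n. Re (- ((-z)^n) / of_nat n)) = (\<lambda>n. - (s ^ n / real n * cos (real n * t)))"
  proof
    fix n
    have "(-z) ^ n = of_real (s ^ n) * cis (real n * t)"
      by (simp add: z_def power_mult_distrib Complex.DeMoivre)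
    then show "Re (- ((-z)^n) / of_nat n) = - (s ^ n / real n * cos (real n * t))"
      by simp
  qed
  also have "Re (Ln (1 + z)) = ln (cmod (1 + z))"
    using \<open>1 + z \<noteq> 0\<close> by simp
  also have "cmod (1 + z) = sqrt (1 - 2 * s * cos t + s\<^sup>2)"
  proof -
    have "(cmod (1 + z))\<^sup>2 = (1 - s * cos t)\<^sup>2 + (s * sin t)\<^sup>2"
      by (simp add: cmod_power2 z_def)
    also have "(1 - s * cos t)\<^sup>2 + (s * sin t)\<^sup>2 = 1 - 2 * s * cos t + s\<^sup>2"
      using sin_cos_squared_add[of t] by algebra
    finally show ?thesis
      by (simp add: real_sqrt_unique)
  qed
  also have "ln (sqrt (1 - 2 * s * cos t + s\<^sup>2)) = ln (1 - 2 * s * cos t + s\<^sup>2) / 2"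
  proof -
    have "1 - 2 * s * cos t + s\<^sup>2 \<ge> 1 - 2 * s * 1 + s\<^sup>2"
      using assms by (intro diff_mono add_mono mult_left_mono) auto
    moreover have "1 - 2 * s * 1 + s\<^sup>2 = (1 - s)\<^sup>2" by (simp add: power2_eq_square algebra_simps)
    ultimately have "1 - 2 * s * cos t + s\<^sup>2 > 0" using assms
      by (smt (verit) zero_less_power2)
    then show ?thesis by (simp add: ln_sqrt)
  qed
  finally have "(\<lambda>n. - (- (s ^ n / real n * cos (real n * t)))) sums (- (ln (1 - 2 * s * cos t + s\<^sup>2) / 2))"
    by (rule sums_minus)
  then show ?thesis by simp
qed

text \<open>Dropping the factors cos and 1/n leaves a geometric tail; the bound is uniform in t,
  which later makes the cutoff independent of the points.\<close>

lemma ln_cos_series_tail: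
  assumes "0 \<le> s" "s < 1"
  shows "\<bar>- ln (1 - 2 * s * cos t + s\<^sup>2) / 2 - (\<Sum>n=1..N. s ^ n / real n * cos (real n * t))\<bar>
           \<le> s ^ Suc N / (1 - s)"
proof -
  define f where "f = (\<lambda>n. s ^ n / real n * cos (real n * t))"
  have f: "f sums (- ln (1 - 2 * s * cos t + s\<^sup>2) / 2)"
    unfolding f_def by (rule ln_cos_series[OF assms])
  have "(\<Sum>n<Suc N. f n) = (\<Sum>n=1..N. f n)"
    by (rule sum.mono_neutral_right) (auto simp: f_def)
  then have 1: "(\<lambda>n. f (n + Suc N)) sums (- ln (1 - 2 * s * cos t + s\<^sup>2) / 2 - (\<Sum>n=1..N. f n))"
    using sums_split_initial_segment[OF f, of "Suc N"] by simp
  have g: "(\<lambda>n. s ^ Suc N * s ^ n) sums (s ^ Suc N * (1 / (1 - s)))"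
    using assms by (intro sums_mult geometric_sums) auto
  have le: "norm (f (n + Suc N)) \<le> s ^ Suc N * s ^ n" for n
  proof -
    have "\<bar>f (n + Suc N)\<bar> = s ^ (n + Suc N) * (\<bar>cos (real (n + Suc N) * t)\<bar> / real (n + Suc N))"
      using assms by (simp add: f_def abs_mult del: of_nat_Suc)
    also have "\<dots> \<le> s ^ (n + Suc N) * 1"
    proof (rule mult_left_mono)
      have "\<bar>cos (real (n + Suc N) * t)\<bar> \<le> real (n + Suc N)"
        by (rule order_trans[OF abs_cos_le_one]) simp
      then show "\<bar>cos (real (n + Suc N) * t)\<bar> / real (n + Suc N) \<le> 1"
        by (subst divide_le_eq_1) auto
    qed (use assms in simp)
    finally show ?thesis by (simp add: power_add mult.commute mult.left_commute)
  qed
  have "norm (suminf (\<lambda>n. f (n + Suc N))) \<le> suminf (\<lambda>n. s ^ Suc N * s ^ n)"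
    using le sums_summable[OF g] by (rule norm_suminf_le)
  then show ?thesis
    using 1 g unfolding f_def by (simp add: sums_iff)
qed

text \<open>Truncated and damped Chebyshev expansion of - ln (2 |x - y|) at x = cos a, y = cos b. In
  each summand the two variables separate, so its integrals reduce to Chebyshev moments.\<close>

definition trig_kernel :: "real \<Rightarrow> nat \<Rightarrow> real \<Rightarrow> real \<Rightarrow> real" where
  "trig_kernel s N a b = (\<Sum>n=1..N. 2 * s ^ n / real n * (cos (real n * a) * cos (real n * b)))"

text \<open>Both sides equal 4 sin^2 ((a + b)/2) sin^2 ((a - b)/2). This is how the two
  singularities a = b and a = - b combine into the single one cos a = cos b.\<close>

lemma cos_diff_eq: "(1 - cos (a + b)) * (1 - cos (a - b)) = (cos a - cos b :: real)\<^sup>2"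
proof -
  have "(sin a)\<^sup>2 + (cos a)\<^sup>2 = 1" "(sin b)\<^sup>2 + (cos b)\<^sup>2 = 1" by simp_all
  then show ?thesis unfolding cos_add cos_diff by algebra
qed

text \<open>Closed form of \<open>trig_kernel s N a b\<close> for N tending to infinity: minus the
  logarithms of |1 - s e^(i(a+b))| and |1 - s e^(i(a-b))|.\<close>

definition log_kernel :: "real \<Rightarrow> real \<Rightarrow> real \<Rightarrow> real" where
  "log_kernel s a b = - ln (1 - 2 * s * cos (a + b) + s\<^sup>2) / 2 - ln (1 - 2 * s * cos (a - b) + s\<^sup>2) / 2"

text \<open>Product-to-sum: 2 cos (na) cos (nb) = cos (n(a + b)) + cos (n(a - b)), so two copies of
  \<open>ln_cos_series_tail\<close> apply.\<close>

lemma log_kernel_approx: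
  assumes "0 \<le> s" "s < 1"
  shows "\<bar>log_kernel s a b - trig_kernel s N a b\<bar> \<le> 2 * (s ^ Suc N / (1 - s))"
proof -
  have "trig_kernel s N a b = (\<Sum>n=1..N. s ^ n / real n * cos (real n * (a + b)))
      + (\<Sum>n=1..N. s ^ n / real n * cos (real n * (a - b)))"
    unfolding trig_kernel_def sum.distrib[symmetric]
    by (intro sum.cong) (auto simp: cos_add cos_diff algebra_simps)
  then show ?thesis
    using ln_cos_series_tail[OF assms, of "a + b" N] ln_cos_series_tail[OF assms, of "a - b" N]
    unfolding log_kernel_def by linarith
qed

text \<open>Each of the two moduli is at most 2, independently of s.\<close>

lemma log_kernel_ge:
  assumes "0 < s" "s < 1"
  shows "- ln 4 \<le> log_kernel s a b"
proof -
  have *: "ln (1 - 2 * s * cos t + s\<^sup>2) \<le> ln 4" for t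
  proof (cases "1 - 2 * s * cos t + s\<^sup>2 > 0")
    case True
    have "s * (-1) \<le> s * cos t" using assms by (intro mult_left_mono) auto
    moreover have "s\<^sup>2 \<le> 1" using assms by (simp add: power_le_one)
    ultimately have "1 - 2 * s * cos t + s\<^sup>2 \<le> 4" using assms by linarith
    with True show ?thesis by simp
  next
    case False
    have "1 - 2 * s * cos t + s\<^sup>2 = (1 - s)\<^sup>2 + 2 * s * (1 - cos t)"
      by (simp add: power2_eq_square algebra_simps)
    moreover have "\<dots> > 0" using assms by (intro add_pos_nonneg) auto
    ultimately show ?thesis using False by simp
  qed
  show ?thesis using *[of "a + b"] *[of "a - b"] by (simp add: log_kernel_def)
qed

text \<open>Since 1 - 2 s cos t + s^2 exceeds 2 s (1 - cos t) by (1 - s)^2, damping raises the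
  kernel by at most - ln s, uniformly in a and b.\<close>

lemma log_kernel_le:
  assumes "0 < s" "s < 1" "cos a \<noteq> cos b"
  shows "log_kernel s a b \<le> - ln (2 * \<bar>cos a - cos b\<bar>) - ln s"
proof -
  have pos: "1 - cos (a + b) > 0" "1 - cos (a - b) > 0"
    using cos_diff_eq[of a b] assms(3) cos_le_one[of "a + b"] cos_le_one[of "a - b"]
    by (smt (verit) mult_eq_0_iff right_minus_eq zero_eq_power2)+
  have le: "s * (2 * (1 - cos t)) \<le> 1 - 2 * s * cos t + s\<^sup>2" for t
    using zero_le_power2[of "1 - s"] by (simp add: power2_eq_square algebra_simps)
  have "ln (s * (2 * (1 - cos (a + b)))) \<le> ln (1 - 2 * s * cos (a + b) + s\<^sup>2)"
       "ln (s * (2 * (1 - cos (a - b)))) \<le> ln (1 - 2 * s * cos (a - b) + s\<^sup>2)"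
    by (intro ln_mono le; use assms pos in simp)+
  moreover have "ln (s * (2 * (1 - cos (a + b)))) + ln (s * (2 * (1 - cos (a - b))))
      = ln ((s * (2 * \<bar>cos a - cos b\<bar>))\<^sup>2)"
  proof -
    have "(s * (2 * (1 - cos (a + b)))) * (s * (2 * (1 - cos (a - b)))) = (s * (2 * \<bar>cos a - cos b\<bar>))\<^sup>2"
      unfolding power_mult_distrib power2_abs cos_diff_eq[symmetric] by (simp add: power2_eq_square algebra_simps)
    then show ?thesis using pos assms by (subst ln_mult_pos[symmetric]) auto
  qed
  moreover have "ln ((s * (2 * \<bar>cos a - cos b\<bar>))\<^sup>2) = 2 * (ln s + ln (2 * \<bar>cos a - cos b\<bar>))"
    using assms by (subst ln_realpow) (auto simp: ln_mult_pos)
  ultimately show ?thesis unfolding log_kernel_def by argo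
qed

lemma log_kernel_tendsto:
  assumes "cos a \<noteq> cos b"
  shows "((\<lambda>s. log_kernel s a b) \<longlongrightarrow> - ln (2 * \<bar>cos a - cos b\<bar>)) (at 1)"
proof -
  have pos: "1 - cos (a + b) > 0" "1 - cos (a - b) > 0"
    using cos_diff_eq[of a b] assms cos_le_one[of "a + b"] cos_le_one[of "a - b"]
    by (smt (verit) mult_eq_0_iff right_minus_eq zero_eq_power2)+
  have "((\<lambda>s. log_kernel s a b) \<longlongrightarrow>
     - ln (1 - 2 * 1 * cos (a + b) + 1\<^sup>2) / 2 - ln (1 - 2 * 1 * cos (a - b) + 1\<^sup>2) / 2) (at 1)"
    unfolding log_kernel_def using pos by (intro tendsto_intros) auto
  also have "- ln (1 - 2 * 1 * cos (a + b) + 1\<^sup>2) / 2 - ln (1 - 2 * 1 * cos (a - b) + 1\<^sup>2) / 2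
     = - ln ((2 * \<bar>cos a - cos b\<bar>)\<^sup>2) / 2"
  proof -
    have "(2 * \<bar>cos a - cos b\<bar>)\<^sup>2 = (2 * (1 - cos (a + b))) * (2 * (1 - cos (a - b)))"
      unfolding power_mult_distrib power2_abs cos_diff_eq[symmetric] by (simp add: power2_eq_square algebra_simps)
    then have "ln ((2 * \<bar>cos a - cos b\<bar>)\<^sup>2) = ln (2 * (1 - cos (a + b))) + ln (2 * (1 - cos (a - b)))"
      using pos by (simp add: ln_mult_pos del: power_mult_distrib)
    then show ?thesis by simp
  qed
  also have "\<dots> = - ln (2 * \<bar>cos a - cos b\<bar>)"
    using assms by (subst ln_realpow) auto
  finally show ?thesis .
qed

text \<open>One sequence of kernels serves two purposes: the upper bound yields the lower bound on
  energies, while the constant lower bound and the pointwise limit feed Fatou's lemma in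
  \<open>arcsine_potential\<close>. The condition \<open>m \<le> N m\<close> ensures that every
  fixed order is eventually present.\<close>

lemma trig_kernel_limit:
  obtains s :: "nat \<Rightarrow> real" and N :: "nat \<Rightarrow> nat" and \<epsilon> :: "nat \<Rightarrow> real"
  where "\<And>m. 0 < s m" "\<And>m. s m < 1" "s \<longlonglongrightarrow> 1" "\<epsilon> \<longlonglongrightarrow> 0" "\<And>m. m \<le> N m"
    "\<And>m a b. cos a \<noteq> cos b \<Longrightarrow> trig_kernel (s m) (N m) a b \<le> - ln (2 * \<bar>cos a - cos b\<bar>) + \<epsilon> m"
    "\<And>m a b. - ln 4 - \<epsilon> m \<le> trig_kernel (s m) (N m) a b"
    "\<And>a b. cos a \<noteq> cos b \<Longrightarrow>
       (\<lambda>m. trig_kernel (s m) (N m) a b) \<longlonglongrightarrow> - ln (2 * \<bar>cos a - cos b\<bar>)"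
proof -
  \<comment> \<open>The offset 2 keeps \<open>s 0\<close> strictly positive, as
    \<open>ln (s m)\<close> requires.\<close>
  define s where "s = (\<lambda>m::nat. 1 - 1 / real (Suc (Suc m)))"
  have s: "0 < s m" "s m < 1" for m by (auto simp: s_def field_simps)
  have s1: "s \<longlonglongrightarrow> 1 - 0"
    unfolding s_def by (intro tendsto_diff tendsto_const LIMSEQ_Suc lim_1_over_n)
  have "\<exists>N\<ge>m. 2 * (s m ^ Suc N / (1 - s m)) \<le> 1 / real (Suc m)" for m
  proof -
    have "(\<lambda>N. 2 * (s m ^ Suc N / (1 - s m))) \<longlonglongrightarrow> 2 * (0 / (1 - s m))"
      using s[of m] by (intro tendsto_intros LIMSEQ_Suc LIMSEQ_realpow_zero) auto
    then have "\<forall>\<^sub>F N in sequentially. 2 * (s m ^ Suc N / (1 - s m)) < 1 / real (Suc m)"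
      by (intro order_tendstoD) auto
    from eventually_conj[OF this eventually_ge_at_top[of m]]
    show ?thesis by (auto simp: eventually_sequentially intro: less_imp_le)
  qed
  then obtain N where N: "\<And>m. m \<le> N m" "\<And>m. 2 * (s m ^ Suc (N m) / (1 - s m)) \<le> 1 / real (Suc m)"
    by metis
  have ap: "\<bar>log_kernel (s m) a b - trig_kernel (s m) (N m) a b\<bar> \<le> 1 / real (Suc m)" for m a b
    using log_kernel_approx[of "s m" a b "N m"] N(2)[of m] s[of m] by linarith
  \<comment> \<open>The sum of the two losses: the series tail and the damping.\<close>
  define \<epsilon> where "\<epsilon> = (\<lambda>m. 1 / real (Suc m) - ln (s m))"
  have lns: "ln (s m) \<le> 0" for m using s[of m] by simp
  have inv: "(\<lambda>m. 1 / real (Suc m)) \<longlonglongrightarrow> 0"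
    by (intro LIMSEQ_Suc lim_1_over_n)
  have e0: "\<epsilon> \<longlonglongrightarrow> 0 - ln 1"
    unfolding \<epsilon>_def using s1 by (intro tendsto_diff inv tendsto_ln) auto
  have lim: "(\<lambda>m. trig_kernel (s m) (N m) a b) \<longlonglongrightarrow> - ln (2 * \<bar>cos a - cos b\<bar>)"
    if "cos a \<noteq> cos b" for a b
  proof -
    have "filterlim s (at 1) sequentially"
      using s1 s by (auto simp: filterlim_at intro!: always_eventually) (metis less_irrefl)
    then have 1: "(\<lambda>m. log_kernel (s m) a b) \<longlonglongrightarrow> - ln (2 * \<bar>cos a - cos b\<bar>)"
      by (rule filterlim_compose[OF log_kernel_tendsto[OF that]])
    have "(\<lambda>m. log_kernel (s m) a b - trig_kernel (s m) (N m) a b) \<longlonglongrightarrow> 0"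
      by (rule Lim_null_comparison[OF _ inv]) (use ap in \<open>auto intro!: always_eventually\<close>)
    from tendsto_diff[OF 1 this] show ?thesis by simp
  qed
  show thesis
  proof (rule that[of s \<epsilon> N])
    show "trig_kernel (s m) (N m) a b \<le> - ln (2 * \<bar>cos a - cos b\<bar>) + \<epsilon> m"
      if "cos a \<noteq> cos b" for m a b
      using ap[of m a b] log_kernel_le[OF s that, of m] unfolding \<epsilon>_def by linarith
    show "- ln 4 - \<epsilon> m \<le> trig_kernel (s m) (N m) a b" for m a b
      using ap[of m a b] log_kernel_ge[OF s, of m a b] lns[of m] unfolding \<epsilon>_def by linarith
  qed (use s s1 e0 N lim in auto)
qed

section \<open>Cosine series\<close>

lemma has_integral_cos_multiple:
  "((\<lambda>t. cos (real n * t)) has_integral (if n = 0 then pi else 0)) {0..pi}"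
proof (cases "n = 0")
  case True
  then show ?thesis using has_integral_const_real[of "1::real" 0 pi] by simp
next
  case False
  have "((\<lambda>t. cos (real n * t)) has_integral (sin (real n * pi) / real n - sin (real n * 0) / real n)) {0..pi}"
    by (rule fundamental_theorem_of_calculus)
       (use False in \<open>auto intro!: derivative_eq_intros simp flip: has_real_derivative_iff_has_vector_derivative\<close>)
  with False show ?thesis by simp
qed

lemma has_integral_cos_cos:
  "((\<lambda>t. cos (real n * t) * cos (real k * t)) has_integral (if n = k then cheb_h n else 0)) {0..pi}"
proof -
  \<comment> \<open>This is |n - k| in nat, where subtraction is truncated.\<close>
  define m where "m = (if n \<le> k then k - n else n - k)"
  have eq: "cos (real n * t) * cos (real k * t) = (cos (real m * t) + cos (real (n + k) * t)) / 2" for t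
    unfolding cos_times_cos
    by (cases "n \<le> k") (auto simp: m_def of_nat_diff left_diff_distrib distrib_right cos_diff)
  have "((\<lambda>t. (cos (real m * t) + cos (real (n + k) * t)) / 2) has_integral
     ((if m = 0 then pi else 0) + (if n + k = 0 then pi else 0)) / 2) {0..pi}"
    by (intro has_integral_divide has_integral_add has_integral_cos_multiple)
  also have "((if m = 0 then pi else 0) + (if n + k = 0 then pi else 0)) / 2 = (if n = k then cheb_h n else 0)"
    by (auto simp: m_def cheb_h_def)
  finally show ?thesis unfolding eq .
qed

text \<open>Orthogonality to all cos (kt) gives orthogonality to all polynomials in cos t. By
  Stone-Weierstrass h is a uniform limit of such polynomials, hence orthogonal to itself.\<close>

lemma cos_orthogonal_imp_zero:
  fixes h :: "real \<Rightarrow> real"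
  assumes cont: "continuous_on {0..pi} h"
    and orth: "\<And>k. ((\<lambda>t. h t * cos (real k * t)) has_integral 0) {0..pi}"
    and t: "t \<in> {0..pi}"
  shows "h t = 0"
proof -
  \<comment> \<open>Multiplication by cos t replaces the frequency k by the mean of k + 1 and |k -
    1|, so the power of cos t can be raised by induction for all k at once.\<close>
  have mom: "((\<lambda>t. h t * cos t ^ j * cos (real k * t)) has_integral 0) {0..pi}" for j k
  proof (induction j arbitrary: k)
    case 0
    show ?case using orth[of k] by simp
  next
    case (Suc j)
    have *: "cos t * cos (real k * t) = (cos (real (k + 1) * t) + cos (real (if k = 0 then 1 else k - 1) * t)) / 2" for t
      by (auto simp: cos_add cos_diff of_nat_diff algebra_simps)
    have "((\<lambda>t. (h t * cos t ^ j * cos (real (k + 1) * t)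
        + h t * cos t ^ j * cos (real (if k = 0 then 1 else k - 1) * t)) / 2) has_integral (0 + 0) / 2) {0..pi}"
      by (intro has_integral_divide has_integral_add Suc.IH)
    also have "(\<lambda>t. (h t * cos t ^ j * cos (real (k + 1) * t)
        + h t * cos t ^ j * cos (real (if k = 0 then 1 else k - 1) * t)) / 2)
       = (\<lambda>t. h t * cos t ^ Suc j * cos (real k * t))"
    proof
      fix t
      have "h t * cos t ^ Suc j * cos (real k * t) = h t * cos t ^ j * (cos t * cos (real k * t))"
        by (simp add: algebra_simps)
      then show "(h t * cos t ^ j * cos (real (k + 1) * t)
        + h t * cos t ^ j * cos (real (if k = 0 then 1 else k - 1) * t)) / 2
        = h t * cos t ^ Suc j * cos (real k * t)"
        unfolding * by (simp add: algebra_simps)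
    qed
    finally show ?case by simp
  qed
  have hint: "(\<lambda>t. h t * h t) integrable_on {0..pi}" "h integrable_on {0..pi}"
    "(\<lambda>t. \<bar>h t\<bar>) integrable_on {0..pi}"
    using cont by (auto intro!: integrable_continuous_interval continuous_intros)
  \<comment> \<open>The approximation tolerance will be e / (K + 1); the added 1 covers K =
    0.\<close>
  define K where "K = integral {0..pi} (\<lambda>t. \<bar>h t\<bar>)"
  have K0: "K \<ge> 0" unfolding K_def by (rule integral_nonneg[OF hint(3)]) auto
  have "integral {0..pi} (\<lambda>t. h t * h t) \<le> 0 + e" if e: "e > 0" for e
  proof -
    have c: "continuous_on {-1..1} (\<lambda>x. h (arccos x))"
      by (rule continuous_on_compose2[OF cont]) (auto intro!: continuous_intros arccos_lbound arccos_ubound)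
    obtain p where p: "real_polynomial_function p" "\<And>x. x \<in> {-1..1} \<Longrightarrow> \<bar>h (arccos x) - p x\<bar> < e / (K + 1)"
      using Stone_Weierstrass_real_polynomial_function[of "{-1..1::real}" "\<lambda>x. h (arccos x)" "e / (K+1)"] c e K0
      by auto
    obtain a n where an: "p = (\<lambda>x. \<Sum>i\<le>n. a i * x ^ i)"
      using p(1) by (auto simp: real_polynomial_function_iff_sum)
    have "((\<lambda>t. \<Sum>i\<le>n. a i * (h t * cos t ^ i * cos (real 0 * t))) has_integral (\<Sum>i\<le>n. a i * 0)) {0..pi}"
      by (intro has_integral_sum has_integral_mult_right mom) auto
    also have "(\<lambda>t. \<Sum>i\<le>n. a i * (h t * cos t ^ i * cos (real 0 * t))) = (\<lambda>t. h t * p (cos t))"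
      by (auto simp: an sum_distrib_left algebra_simps)
    finally have hp: "((\<lambda>t. h t * p (cos t)) has_integral 0) {0..pi}" by simp
    have le: "h t * h t \<le> e / (K + 1) * \<bar>h t\<bar> + h t * p (cos t)" if "t \<in> {0..pi}" for t
    proof -
      have "\<bar>h t - p (cos t)\<bar> \<le> e / (K + 1)"
        using p(2)[of "cos t"] that by (auto simp: arccos_cos)
      then have "\<bar>h t\<bar> * \<bar>h t - p (cos t)\<bar> \<le> \<bar>h t\<bar> * (e / (K+1))"
        by (intro mult_left_mono) auto
      then have "h t * (h t - p (cos t)) \<le> \<bar>h t\<bar> * (e / (K+1))"
        using abs_ge_self[of "h t * (h t - p (cos t))"] by (simp add: abs_mult)
      then show ?thesis by (simp add: algebra_simps)
    qed
    have "((\<lambda>t. e / (K + 1) * \<bar>h t\<bar> + h t * p (cos t)) has_integral (e / (K + 1) * K + 0)) {0..pi}"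
      unfolding K_def
      by (intro has_integral_add has_integral_mult_right hp integrable_integral hint)
    from has_integral_le[OF integrable_integral[OF hint(1)] this le]
    have "integral {0..pi} (\<lambda>t. h t * h t) \<le> e / (K + 1) * K" by simp
    also have "\<dots> \<le> e" using e K0 by (simp add: field_simps)
    finally show ?thesis by simp
  qed
  then have "integral {0..pi} (\<lambda>t. h t * h t) \<le> 0"
    by (rule field_le_epsilon)
  moreover have "integral {0..pi} (\<lambda>t. h t * h t) \<ge> 0"
    by (rule integral_nonneg[OF hint(1)]) auto
  ultimately have "integral {0..pi} (\<lambda>t. h t * h t) = 0" by simp
  moreover have "continuous_on {0..pi} (\<lambda>t. h t * h t)" using cont by (intro continuous_intros)
  ultimately have "\<forall>t\<in>{0..pi}. h t * h t = 0"
    by (subst (asm) integral_eq_0_iff) auto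
  with t show ?thesis by auto
qed

text \<open>Absolute summability makes the series converge uniformly to a continuous T by the
  M-test. Uniform convergence lets the cosine coefficients of T be read off termwise, so f - T is
  orthogonal to every cosine.\<close>

lemma cosine_series_uniform_limit:
  fixes f :: "real \<Rightarrow> real" and c :: "nat \<Rightarrow> real"
  assumes cont: "continuous_on {0..pi} f"
    and c: "\<And>n. ((\<lambda>t. f t * cos (real n * t)) has_integral cheb_h n * c n) {0..pi}"
    and summ: "summable (\<lambda>n. \<bar>c n\<bar>)"
  shows "uniform_limit {0..pi} (\<lambda>M t. \<Sum>n<M. c n * cos (real n * t)) f sequentially"
proof -
  define T where "T = (\<lambda>t. \<Sum>n. c n * cos (real n * t))"
  have ul: "uniform_limit {0..pi} (\<lambda>M t. \<Sum>n<M. c n * cos (real n * t)) T sequentially"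
    unfolding T_def
    by (rule Weierstrass_m_test[OF _ summ]) (auto simp: abs_mult intro!: mult_left_le)
  have contT: "continuous_on {0..pi} T"
    by (rule uniform_limit_theorem[OF _ ul]) (auto intro!: always_eventually continuous_intros)
  have "f t - T t = 0" if "t \<in> {0..pi}" for t
  proof (rule cos_orthogonal_imp_zero[where h = "\<lambda>t. f t - T t", OF _ _ that])
    show "continuous_on {0..pi} (\<lambda>t. f t - T t)"
      by (intro continuous_intros cont contT)
    fix k
    have "uniform_limit {0..pi} (\<lambda>M t. (\<Sum>n<M. c n * cos (real n * t)) * cos (real k * t))
        (\<lambda>t. T t * cos (real k * t)) sequentially"
    proof (rule uniform_lim_mult[OF ul])
      show "uniform_limit {0..pi} (\<lambda>M t. cos (real k * t)) (\<lambda>t. cos (real k * t)) sequentially"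
        by (rule uniform_limit_const)
      show "bounded (T ` {0..pi})"
        by (intro compact_imp_bounded compact_continuous_image contT) auto
      show "bounded ((\<lambda>t. cos (real k * t)) ` {0..pi})"
        by (intro compact_imp_bounded compact_continuous_image continuous_intros) auto
    qed
    then obtain I J where I: "\<And>M. ((\<lambda>t. (\<Sum>n<M. c n * cos (real n * t)) * cos (real k * t)) has_integral I M) {0..pi}"
      and J: "((\<lambda>t. T t * cos (real k * t)) has_integral J) {0..pi}" and IJ: "I \<longlonglongrightarrow> J"
      by (rule uniform_limit_integral) (auto intro!: continuous_intros)
    have "I M = (if k < M then cheb_h k * c k else 0)" for M
    proof -
      have "((\<lambda>t. \<Sum>n<M. c n * (cos (real n * t) * cos (real k * t))) has_integral
          (\<Sum>n<M. c n * (if n = k then cheb_h n else 0))) {0..pi}"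
        by (intro has_integral_sum has_integral_mult_right has_integral_cos_cos) auto
      moreover have "(\<lambda>t. \<Sum>n<M. c n * (cos (real n * t) * cos (real k * t)))
         = (\<lambda>t. (\<Sum>n<M. c n * cos (real n * t)) * cos (real k * t))"
        by (simp add: sum_distrib_right mult.assoc)
      ultimately have "I M = (\<Sum>n<M. c n * (if n = k then cheb_h n else 0))"
        by (intro has_integral_unique[OF I[of M]]) simp
      also have "\<dots> = (\<Sum>n<M. if n = k then cheb_h k * c k else 0)"
        by (intro sum.cong) auto
      finally show ?thesis by (simp add: sum.delta)
    qed
    then have "I \<longlonglongrightarrow> cheb_h k * c k"
      by (intro tendsto_eventually) (auto simp: eventually_sequentially intro!: exI[of _ "Suc k"])
    with IJ have "J = cheb_h k * c k" using LIMSEQ_unique by blast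
    with J have "((\<lambda>t. f t * cos (real k * t) - T t * cos (real k * t)) has_integral
        (cheb_h k * c k - cheb_h k * c k)) {0..pi}"
      by (intro has_integral_diff c) simp
    then show "((\<lambda>t. (f t - T t) * cos (real k * t)) has_integral 0) {0..pi}"
      by (simp add: left_diff_distrib)
  qed
  then show ?thesis
    using ul by (subst uniform_limit_cong'[where g = "\<lambda>M t. \<Sum>n<M. c n * cos (real n * t)" and i = T]) auto
qed

section \<open>Dependence on the radius R of integrals of functions of R cos t\<close>

lemma has_real_derivative_integral_cos:
  fixes \<phi> \<phi>' h :: "real \<Rightarrow> real"
  assumes d: "\<And>x. (\<phi> has_real_derivative \<phi>' x) (at x)"
    and c: "continuous_on UNIV \<phi>'" and h: "continuous_on UNIV h"
  shows "((\<lambda>R. integral {0..pi} (\<lambda>t. h t * \<phi> (R * cos t))) has_real_derivative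
           integral {0..pi} (\<lambda>t. h t * (cos t * \<phi>' (R * cos t)))) (at R)"
proof -
  have c\<phi>: "continuous_on S (\<lambda>t. \<phi> (u t))" if "continuous_on S u" for S :: "real set" and u
    by (rule continuous_on_compose2[OF _ that]) (auto intro!: continuous_at_imp_continuous_on DERIV_isCont[OF d])
  have c\<phi>': "continuous_on S (\<lambda>t. \<phi>' (u t))" if "continuous_on S u" for S :: "(real \<times> real) set" and u
    by (rule continuous_on_compose2[OF c that]) auto
  have ch: "continuous_on S (\<lambda>t. h (u t))" if "continuous_on S u" for S :: "(real \<times> real) set" and u
    by (rule continuous_on_compose2[OF h that]) auto
  have ch1: "continuous_on S h" for S
    using h continuous_on_subset by blast
  have "((\<lambda>R. integral (cbox 0 pi) (\<lambda>t. h t * \<phi> (R * cos t))) has_field_derivative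
           integral (cbox 0 pi) (\<lambda>t. h t * (cos t * \<phi>' (R * cos t)))) (at R within UNIV)"
  proof (rule leibniz_rule_field_derivative)
    fix x t :: real
    show "((\<lambda>x. h t * \<phi> (x * cos t)) has_field_derivative h t * (cos t * \<phi>' (x * cos t))) (at x within UNIV)"
      by (rule DERIV_cmult, rule DERIV_cong, rule DERIV_chain2[OF d])
         (auto intro!: derivative_eq_intros)
    show "(\<lambda>t. h t * \<phi> (x * cos t)) integrable_on cbox 0 pi"
      by (intro integrable_continuous continuous_intros c\<phi> ch1)
    show "continuous_on (UNIV \<times> cbox 0 pi) (\<lambda>(x, t). h t * (cos t * \<phi>' (x * cos t)))"
      unfolding split_def by (intro continuous_intros c\<phi>' ch)
  qed auto
  then show ?thesis by simp
qed

lemma continuous_on_integral_cos: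
  fixes \<phi> h :: "real \<Rightarrow> real"
  assumes c: "continuous_on UNIV \<phi>" and h: "continuous_on UNIV h"
  shows "continuous_on UNIV (\<lambda>R. integral {0..pi} (\<lambda>t. h t * \<phi> (R * cos t)))"
proof -
  have c\<phi>: "continuous_on S (\<lambda>t. \<phi> (u t))" if "continuous_on S u" for S :: "(real \<times> real) set" and u
    by (rule continuous_on_compose2[OF c that]) auto
  have ch: "continuous_on S (\<lambda>t. h (u t))" if "continuous_on S u" for S :: "(real \<times> real) set" and u
    by (rule continuous_on_compose2[OF h that]) auto
  have "continuous_on UNIV (\<lambda>R. integral (cbox 0 pi) (\<lambda>t. h t * \<phi> (R * cos t)))"
    by (rule integral_continuous_on_param) (auto simp: split_def intro!: continuous_intros c\<phi> ch)
  then show ?thesis by simp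
qed

section \<open>Chebyshev coefficients of the potential\<close>

text \<open>The substitution x = cos t. The integrand on [-1, 1] is singular at both ends, so the
  fundamental theorem is applied to - F (arccos x), which is continuous up to the ends and
  differentiable in the interior.\<close>

lemma has_integral_cheb_c:
  assumes "continuous_on UNIV V"
  shows "((\<lambda>t. V (R * cos t) * cos (real n * t)) has_integral cheb_h n * cheb_c V n R) {0..pi}"
proof -
  define f where "f = (\<lambda>t. V (R * cos t) * cos (real n * t))"
  have cf: "continuous_on S f" for S
    unfolding f_def by (intro continuous_intros continuous_on_compose2[OF assms]) auto
  define F where "F = (\<lambda>t. integral {0..t} f)"
  have cF: "continuous_on {0..pi} F"
    unfolding F_def by (intro indefinite_integral_continuous_1 integrable_continuous_interval cf)
  have dF: "(F has_real_derivative f t) (at t)" if "t \<in> {0<..<pi}" for t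
  proof -
    have "(F has_vector_derivative f t) (at t within {0..pi})"
      unfolding F_def using that by (intro integral_has_vector_derivative cf) auto
    moreover have "at t within {0..pi} = at t"
      using that by (intro at_within_interior) (auto simp: interior_atLeastAtMost_real)
    ultimately show ?thesis by (simp add: has_real_derivative_iff_has_vector_derivative)
  qed
  have "((\<lambda>x. V (R * x) * cheb_T n x / sqrt (1 - x\<^sup>2)) has_integral
      (- F (arccos 1)) - (- F (arccos (-1)))) {-1..1}"
  proof (rule fundamental_theorem_of_calculus_interior)
    show "continuous_on {-1..1} (\<lambda>x. - F (arccos x))"
      by (intro continuous_on_minus continuous_on_compose2[OF cF])
         (auto intro!: continuous_intros arccos_lbound arccos_ubound)
    fix x :: real assume x: "x \<in> {-1<..<1}"
    then have a: "arccos x \<in> {0<..<pi}" by (auto intro!: arccos_lt_bounded)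
    have "((\<lambda>x. - F (arccos x)) has_real_derivative - (f (arccos x) * inverse (- sqrt (1 - x\<^sup>2)))) (at x)"
      by (intro DERIV_minus DERIV_chain2[where f = F and g = arccos, OF dF[OF a]] DERIV_arccos) (use x in auto)
    also have "- (f (arccos x) * inverse (- sqrt (1 - x\<^sup>2))) = V (R * x) * cheb_T n x / sqrt (1 - x\<^sup>2)"
      using x cheb_T_cos[of n "arccos x"] by (simp add: f_def field_simps)
    finally show "((\<lambda>x. - F (arccos x)) has_vector_derivative V (R * x) * cheb_T n x / sqrt (1 - x\<^sup>2)) (at x)"
      by (simp add: has_real_derivative_iff_has_vector_derivative)
  qed simp
  then have "integral {-1..1} (\<lambda>x. V (R * x) * cheb_T n x / sqrt (1 - x\<^sup>2)) = F pi"
    by (auto simp: F_def dest!: integral_unique)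
  then have "cheb_h n * cheb_c V n R = integral {0..pi} f"
    by (simp add: cheb_c_def F_def cheb_h_def)
  then show ?thesis
    using integrable_integral[OF integrable_continuous_interval[OF cf, of 0 pi]] by (simp add: f_def)
qed

text \<open>The derivatives are parameters, so that calculus rules apply to them directly instead of
  to iterated \<open>deriv\<close>.\<close>

locale even_convex_potential =
  fixes V V1 V2 V3 :: "real \<Rightarrow> real"
  assumes V_deriv: "\<And>x. (V has_real_derivative V1 x) (at x)"
    and V1_deriv: "\<And>x. (V1 has_real_derivative V2 x) (at x)"
    and V2_deriv: "\<And>x. (V2 has_real_derivative V3 x) (at x)"
    and V3_cont: "continuous_on UNIV V3"
    and V_even: "\<And>x. V (- x) = V x"
    and V_conv: "strictly_convex V"
begin

lemma V_cont: "continuous_on UNIV V" and V1_cont: "continuous_on UNIV V1" and V2_cont: "continuous_on UNIV V2"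
  by (auto intro!: continuous_at_imp_continuous_on DERIV_isCont[OF V_deriv] DERIV_isCont[OF V1_deriv]
      DERIV_isCont[OF V2_deriv])

lemmas V_continuous_on [continuous_intros] =
  continuous_on_compose2[OF V_cont _ subset_UNIV] continuous_on_compose2[OF V1_cont _ subset_UNIV]
  continuous_on_compose2[OF V2_cont _ subset_UNIV]

section \<open>Signs and monotonicity of the derivatives of V\<close>

lemma V_convex_on: "convex_on UNIV V"
proof (rule convex_onI)
  fix t x y :: real assume "0 < t" "t < 1"
  then show "V ((1 - t) *\<^sub>R x + t *\<^sub>R y) \<le> (1 - t) * V x + t * V y"
    using V_conv[unfolded strictly_convex_def, rule_format, of x y t]
    by (cases "x = y") (simp_all add: algebra_simps)
qed simp

lemma V_above_tangent: "V1 c * (x - c) \<le> V x - V c"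
  by (rule convex_on_imp_above_tangent[OF V_convex_on]) (auto simp: V_deriv)

lemma V1_mono: assumes "x \<le> y" shows "V1 x \<le> V1 y"
proof (cases "x = y")
  case False
  have "V1 x * (y - x) \<le> V1 y * (y - x)"
    using V_above_tangent[of x y] V_above_tangent[of y x] by (simp add: algebra_simps)
  with False assms show ?thesis by simp
qed simp

lemma V2_nonneg: "V2 x \<ge> 0"
proof (rule ccontr)
  assume "\<not> V2 x \<ge> 0"
  then obtain d where "d > 0" "\<And>h. 0 < h \<Longrightarrow> h < d \<Longrightarrow> V1 (x + h) < V1 x"
    using DERIV_neg_dec_right[OF V1_deriv[of x]] by auto
  from this(2)[of "d / 2"] this(1) V1_mono[of x "x + d / 2"] show False by simp
qed

lemma V1_odd: "V1 (- x) = - V1 x"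
proof -
  have "((\<lambda>x. V (- x)) has_real_derivative V1 (- x) * (- 1)) (at x)"
    by (rule DERIV_chain2[OF V_deriv]) (auto intro!: derivative_eq_intros)
  then have "(V has_real_derivative - V1 (- x)) (at x)" by (simp add: V_even)
  with V_deriv have "- V1 (- x) = V1 x" by (rule DERIV_unique[symmetric])
  then show ?thesis by simp
qed

text \<open>The midpoint of x and - x gives V 0 < V x strictly; the tangent at x, evaluated at 0,
  then has positive slope.\<close>

lemma V1_pos: assumes "0 < x" shows "0 < V1 x"
proof -
  have "V ((1 - 1/2) * x + 1/2 * (- x)) < (1 - 1/2) * V x + 1/2 * V (- x)"
    using V_conv assms unfolding strictly_convex_def
    by (metis (no_types, lifting) divide_less_eq_1_pos half_gt_zero_iff less_numeral_extra(1)
        neg_equal_zero less_irrefl one_less_numeral_iff semiring_norm(76) zero_less_numeral)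
  then have "V 0 < V x" by (simp add: V_even)
  with V_above_tangent[of x 0] have "0 < V1 x * x" by simp
  with assms show ?thesis by (simp add: zero_less_mult_iff)
qed

text \<open>The mean of V under the arcsine law of radius R, that is \<open>cheb_c V 0 R\<close>;
  \<open>w\<close>, \<open>w'\<close> and \<open>w''\<close> are its successive derivatives in
  R.\<close>

definition W :: "real \<Rightarrow> real" where "W R = integral {0..pi} (\<lambda>t. V (R * cos t)) / pi"
definition w :: "real \<Rightarrow> real" where "w R = integral {0..pi} (\<lambda>t. cos t * V1 (R * cos t)) / pi"
definition w' :: "real \<Rightarrow> real" where "w' R = integral {0..pi} (\<lambda>t. cos t * (cos t * V2 (R * cos t))) / pi"
definition w'' :: "real \<Rightarrow> real" where
  "w'' R = integral {0..pi} (\<lambda>t. (cos t * cos t) * (cos t * V3 (R * cos t))) / pi"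
text \<open>Chebyshev coefficients of V' on [-R, R]. The factor 2 / pi is also used for k = 0, which
  does no harm since that coefficient vanishes.\<close>

definition v :: "nat \<Rightarrow> real \<Rightarrow> real" where
  "v k R = 2 / pi * integral {0..pi} (\<lambda>t. cos (real k * t) * V1 (R * cos t))"

lemma W_deriv: "(W has_real_derivative w R) (at R)"
proof -
  have "((\<lambda>R. integral {0..pi} (\<lambda>t. 1 * V (R * cos t)) / pi) has_real_derivative
     integral {0..pi} (\<lambda>t. 1 * (cos t * V1 (R * cos t))) / pi) (at R)"
    by (intro DERIV_cdivide has_real_derivative_integral_cos V_deriv V1_cont continuous_intros)
  then show ?thesis by (simp add: W_def[abs_def] w_def)
qed

lemma w_deriv: "(w has_real_derivative w' R) (at R)"
  unfolding w_def w'_def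
  by (intro DERIV_cdivide has_real_derivative_integral_cos V1_deriv V2_cont continuous_intros)

lemma w'_deriv: "(w' has_real_derivative w'' R) (at R)"
proof -
  have "((\<lambda>R. integral {0..pi} (\<lambda>t. (cos t * cos t) * V2 (R * cos t)) / pi) has_real_derivative w'' R) (at R)"
    unfolding w''_def
    by (intro DERIV_cdivide has_real_derivative_integral_cos V2_deriv V3_cont continuous_intros)
  then show ?thesis by (simp add: w'_def[abs_def] mult.assoc)
qed

lemma w_cont: "continuous_on S w" and w'_cont: "continuous_on S w'"
  by (auto intro!: continuous_at_imp_continuous_on DERIV_isCont[OF w_deriv]
      DERIV_isCont[OF w'_deriv])

lemma w''_cont: "continuous_on UNIV w''"
proof -
  have "continuous_on UNIV (\<lambda>R. integral {0..pi} (\<lambda>t. (cos t * cos t * cos t) * V3 (R * cos t)) / pi)"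
    by (intro continuous_on_divide continuous_on_integral_cos V3_cont continuous_intros) auto
  then show ?thesis by (simp add: w''_def[abs_def] mult.assoc)
qed

lemma w'_nonneg: "0 \<le> w' R"
proof -
  have "0 \<le> integral {0..pi} (\<lambda>t. cos t * (cos t * V2 (R * cos t)))"
    by (intro integral_nonneg integrable_continuous_interval continuous_intros)
       (auto simp: V2_nonneg simp flip: mult.assoc)
  then show ?thesis by (simp add: w'_def)
qed

text \<open>The integrand is nonnegative because V1 is odd and positive on the right, and it does
  not vanish at t = 0.\<close>

lemma w_pos: assumes "0 < R" shows "0 < w R"
proof -
  have nn: "0 \<le> cos t * V1 (R * cos t)" for t
  proof (cases "cos t" "0::real" rule: linorder_cases)
    case less
    then have "0 < V1 (R * - cos t)" using assms by (intro V1_pos mult_pos_pos) auto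
    with less show ?thesis by (simp add: V1_odd mult_nonpos_nonpos)
  next
    case greater
    then show ?thesis using assms V1_pos[of "R * cos t"] by simp
  qed simp
  have c: "continuous_on {0..pi} (\<lambda>t. cos t * V1 (R * cos t))" by (intro continuous_intros)
  have "integral {0..pi} (\<lambda>t. cos t * V1 (R * cos t)) \<noteq> 0"
  proof
    assume "integral {0..pi} (\<lambda>t. cos t * V1 (R * cos t)) = 0"
    then have "cos 0 * V1 (R * cos 0) = 0"
      using integral_eq_0_iff[OF c] nn by (metis atLeastAtMost_iff order_refl pi_ge_zero pi_gt_zero)
    with V1_pos[OF assms] show False by simp
  qed
  moreover have "0 \<le> integral {0..pi} (\<lambda>t. cos t * V1 (R * cos t))"
    by (intro integral_nonneg integrable_continuous_interval c nn)
  ultimately show ?thesis by (simp add: w_def)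
qed

definition g :: "real \<Rightarrow> real" where "g R = R * w R"
definition g' :: "real \<Rightarrow> real" where "g' R = w R + R * w' R"
definition g'' :: "real \<Rightarrow> real" where "g'' R = 2 * w' R + R * w'' R"

lemma g_deriv: "(g has_real_derivative g' R) (at R)"
  unfolding g_def g'_def by (auto intro!: derivative_eq_intros w_deriv)

lemma g'_deriv: "(g' has_real_derivative g'' R) (at R)"
  unfolding g''_def g'_def by (auto intro!: derivative_eq_intros w_deriv w'_deriv)

lemma g_cont: "continuous_on S g" and g'_cont: "continuous_on S g'"
  by (auto intro!: continuous_at_imp_continuous_on DERIV_isCont[OF g_deriv] DERIV_isCont[OF g'_deriv])

lemma g''_cont: "continuous_on S g''"
  unfolding g''_def using continuous_on_subset[OF w''_cont] by (intro continuous_intros w'_cont) auto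

lemma g'_pos: "0 < R \<Longrightarrow> 0 < g' R"
  unfolding g'_def using w_pos w'_nonneg by (intro add_pos_nonneg mult_nonneg_nonneg) auto

lemma g_pos: "0 < R \<Longrightarrow> 0 < g R"
  unfolding g_def using w_pos by simp

lemma g_strict_mono: assumes "0 < r" "r < R" shows "g r < g R"
  by (rule DERIV_pos_imp_increasing[OF assms(2)]) (use assms g_deriv g'_pos in \<open>force\<close>)

section \<open>Coefficients of V' and the recurrences linking them to those of V\<close>

lemma v_0: "v 0 R = 0"
proof -
  have "integral {0..pi} (\<lambda>t. V1 (R * cos t)) = integral {-pi..0} (\<lambda>t. V1 (R * cos t))"
    using Henstock_Kurzweil_Integration.integral_reflect_real[of pi 0 "\<lambda>t. V1 (R * cos t)"] by simp
  \<comment> \<open>Shifting by pi changes the sign of cos t, hence of V1 (R cos t), so the integral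
    equals its own negative.\<close>
  also have "\<dots> = integral {0..pi} ((\<lambda>t. V1 (R * cos t)) \<circ> (\<lambda>t. t + (-pi)))"
    using integral_shift[of 0 "-pi" pi "\<lambda>t. V1 (R * cos t)"] by (simp add: continuous_intros)
  also have "\<dots> = integral {0..pi} (\<lambda>t. - V1 (R * cos t))"
    by (simp add: o_def V1_odd)
  finally have "integral {0..pi} (\<lambda>t. V1 (R * cos t)) = 0" by simp
  then show ?thesis by (simp add: v_def)
qed

lemma v_1: "v 1 R = 2 * w R" "v (Suc 0) R = 2 * w R"
  by (simp_all add: v_def w_def)

text \<open>One integration by parts: the boundary terms contain sin 0 and sin (k pi), and V2 is
  bounded on the compact range of R cos t.\<close>

lemma v_bound: "\<exists>C. \<forall>k\<ge>1. \<bar>v k R\<bar> \<le> C / real k"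
proof -
  have "compact ((\<lambda>t. V2 (R * cos t)) ` {0..pi})"
    by (intro compact_continuous_image continuous_intros) auto
  then obtain B where B: "\<And>t. t \<in> {0..pi} \<Longrightarrow> \<bar>V2 (R * cos t)\<bar> \<le> B"
    by (fastforce dest!: compact_imp_bounded simp: bounded_iff)
  have B0: "B \<ge> 0" using B[of 0] by auto
  have "\<bar>v k R\<bar> \<le> (2 * \<bar>R\<bar> * B) / real k" if "k \<ge> 1" for k
  proof -
    have "((\<lambda>t. cos (real k * t) * V1 (R * cos t) - sin (real k * t) / real k * (R * sin t * V2 (R * cos t)))
       has_integral (sin (real k * pi) / real k * V1 (R * cos pi) - sin (real k * 0) / real k * V1 (R * cos 0))) {0..pi}"
    proof (rule fundamental_theorem_of_calculus)
      fix t
      have 1: "((\<lambda>t. sin (real k * t) / real k) has_real_derivative cos (real k * t)) (at t within {0..pi})"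
        using that by (auto intro!: derivative_eq_intros)
      have 2: "((\<lambda>t. V1 (R * cos t)) has_real_derivative V2 (R * cos t) * (R * (- sin t))) (at t within {0..pi})"
        by (rule DERIV_chain2[OF V1_deriv]) (auto intro!: derivative_eq_intros)
      show "((\<lambda>t. sin (real k * t) / real k * V1 (R * cos t)) has_vector_derivative
          cos (real k * t) * V1 (R * cos t) - sin (real k * t) / real k * (R * sin t * V2 (R * cos t))) (at t within {0..pi})"
        unfolding has_real_derivative_iff_has_vector_derivative[symmetric]
        by (rule DERIV_cong[OF DERIV_mult[OF 1 2]]) (simp add: algebra_simps)
    qed simp
    then have "integral {0..pi} (\<lambda>t. cos (real k * t) * V1 (R * cos t) - sin (real k * t) / real k * (R * sin t * V2 (R * cos t))) = 0"
      by (simp add: integral_unique)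
    moreover have "integral {0..pi} (\<lambda>t. cos (real k * t) * V1 (R * cos t) - sin (real k * t) / real k * (R * sin t * V2 (R * cos t)))
      = integral {0..pi} (\<lambda>t. cos (real k * t) * V1 (R * cos t)) - integral {0..pi} (\<lambda>t. sin (real k * t) / real k * (R * sin t * V2 (R * cos t)))"
      using that by (intro integral_diff integrable_continuous_interval continuous_intros) auto
    ultimately have eq: "integral {0..pi} (\<lambda>t. cos (real k * t) * V1 (R * cos t)) = integral {0..pi} (\<lambda>t. sin (real k * t) / real k * (R * sin t * V2 (R * cos t)))"
      by simp
    have "norm (integral {0..pi} (\<lambda>t. sin (real k * t) / real k * (R * sin t * V2 (R * cos t)))) \<le> \<bar>R\<bar> * B / real k * (pi - 0)"
    proof (rule integral_bound)
      fix t assume t: "t \<in> {0..pi}"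
      have "\<bar>sin (real k * t)\<bar> * (\<bar>R\<bar> * \<bar>sin t\<bar> * \<bar>V2 (R * cos t)\<bar>) \<le> 1 * (\<bar>R\<bar> * 1 * B)"
        using B[OF t] B0 by (intro mult_mono) auto
      then show "norm (sin (real k * t) / real k * (R * sin t * V2 (R * cos t))) \<le> \<bar>R\<bar> * B / real k"
        using that by (simp add: abs_mult divide_right_mono)
    qed (use that in \<open>auto intro!: continuous_intros\<close>)
    then have "2 / pi * \<bar>integral {0..pi} (\<lambda>t. cos (real k * t) * V1 (R * cos t))\<bar> \<le> 2 / pi * (\<bar>R\<bar> * B / real k * pi)"
      unfolding eq by (intro mult_left_mono) auto
    then show ?thesis unfolding v_def by (simp add: abs_mult)
  qed
  then show ?thesis by blast
qed

lemma v_tendsto_0: "(\<lambda>k. v k R) \<longlonglongrightarrow> 0"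
proof -
  obtain C where C: "\<And>k. k \<ge> 1 \<Longrightarrow> \<bar>v k R\<bar> \<le> C / real k" using v_bound by blast
  have "(\<lambda>k. C * (1 / real k)) \<longlonglongrightarrow> C * 0" by (intro tendsto_intros lim_1_over_n)
  then have "(\<lambda>k. C / real k) \<longlonglongrightarrow> 0" by simp
  then show ?thesis
    by (rule Lim_null_comparison[rotated]) (use C in \<open>auto simp: eventually_sequentially intro!: exI[of _ 1]\<close>)
qed

lemma cheb_c_0: "cheb_c V 0 R = W R"
  using has_integral_cheb_c[OF V_cont, of R 0] by (auto simp: W_def cheb_h_def dest!: integral_unique)

lemma cheb_c_eq: "cheb_c V (Suc n) R = 2 / pi * integral {0..pi} (\<lambda>t. cos (real (Suc n) * t) * V (R * cos t))"
  using has_integral_cheb_c[OF V_cont, of R "Suc n"]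
  by (auto simp: cheb_h_def mult.commute dest!: integral_unique)

text \<open>From 2 cos ((n+1)t) cos t = cos (nt) + cos ((n+2)t). The sum obtained here is the
  partner of the difference in \<open>cheb_c_Suc\<close>; their product is a difference of
  squares.\<close>

lemma cheb_c_deriv:
  "((\<lambda>R. cheb_c V (Suc n) R) has_real_derivative (v n R + v (Suc (Suc n)) R) / 2) (at R)"
proof -
  have "((\<lambda>R. 2 / pi * integral {0..pi} (\<lambda>t. cos (real (Suc n) * t) * V (R * cos t))) has_real_derivative
      2 / pi * integral {0..pi} (\<lambda>t. cos (real (Suc n) * t) * (cos t * V1 (R * cos t)))) (at R)"
    by (intro DERIV_cmult has_real_derivative_integral_cos V_deriv V1_cont continuous_intros)
  also have "(\<lambda>t. cos (real (Suc n) * t) * (cos t * V1 (R * cos t)))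
      = (\<lambda>t. (cos (real n * t) * V1 (R * cos t) + cos (real (Suc (Suc n)) * t) * V1 (R * cos t)) / 2)"
    (is "?l = ?r")
  proof
    fix t
    have "2 * (cos (real (Suc n) * t) * cos t) = cos (real n * t) + cos (real (Suc (Suc n)) * t)"
      using cos_add[of "real (Suc n) * t" t] cos_diff[of "real (Suc n) * t" t] by (simp add: algebra_simps)
    then have "cos (real n * t) * V1 (R * cos t) + cos (real (Suc (Suc n)) * t) * V1 (R * cos t)
        = 2 * (cos (real (Suc n) * t) * cos t) * V1 (R * cos t)"
      by (simp only: distrib_right)
    then show "?l t = ?r t" by simp
  qed
  also have "integral {0..pi} \<dots> = (integral {0..pi} (\<lambda>t. cos (real n * t) * V1 (R * cos t))
      + integral {0..pi} (\<lambda>t. cos (real (Suc (Suc n)) * t) * V1 (R * cos t))) / 2"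
    by (subst integral_add[symmetric])
       (auto intro!: integrable_continuous_interval continuous_intros simp del: of_nat_Suc)
  finally show ?thesis unfolding cheb_c_eq v_def by (simp add: algebra_simps add_divide_distrib)
qed

text \<open>Integration by parts in t with 2 sin ((n+1)t) sin t = cos (nt) - cos ((n+2)t); the
  boundary terms vanish because n + 1 is an integer.\<close>

lemma cheb_c_Suc: "real (Suc n) * cheb_c V (Suc n) R = R * (v n R - v (Suc (Suc n)) R) / 2"
proof -
  define k where "k = real (Suc n)"
  have k: "k > 0" by (simp add: k_def)
  have "((\<lambda>t. k * (cos (k * t) * V (R * cos t)) - R / 2 * (cos (real n * t) * V1 (R * cos t) - cos (real (Suc (Suc n)) * t) * V1 (R * cos t)))
     has_integral (sin (k * pi) * V (R * cos pi) - sin (k * 0) * V (R * cos 0))) {0..pi}"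
  proof (rule fundamental_theorem_of_calculus)
    fix t
    have 1: "((\<lambda>t. sin (k * t)) has_real_derivative k * cos (k * t)) (at t within {0..pi})"
      by (auto intro!: derivative_eq_intros)
    have 2: "((\<lambda>t. V (R * cos t)) has_real_derivative V1 (R * cos t) * (R * (- sin t))) (at t within {0..pi})"
      by (rule DERIV_chain2[OF V_deriv]) (auto intro!: derivative_eq_intros)
    have *: "2 * (sin (k * t) * sin t) = cos (real n * t) - cos (real (Suc (Suc n)) * t)"
      using cos_add[of "k * t" t] cos_diff[of "k * t" t] by (simp add: k_def algebra_simps)
    have "V1 (R * cos t) * (R * (- sin t)) * sin (k * t) = - (R / 2 * (2 * (sin (k * t) * sin t) * V1 (R * cos t)))"
      by simp
    also have "\<dots> = - (R / 2 * (cos (real n * t) * V1 (R * cos t) - cos (real (Suc (Suc n)) * t) * V1 (R * cos t)))"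
      unfolding * by (simp only: left_diff_distrib)
    finally have **: "V1 (R * cos t) * (R * (- sin t)) * sin (k * t) = \<dots>" .
    show "((\<lambda>t. sin (k * t) * V (R * cos t)) has_vector_derivative
       k * (cos (k * t) * V (R * cos t)) - R / 2 * (cos (real n * t) * V1 (R * cos t) - cos (real (Suc (Suc n)) * t) * V1 (R * cos t))) (at t within {0..pi})"
      unfolding has_real_derivative_iff_has_vector_derivative[symmetric]
      by (rule DERIV_cong[OF DERIV_mult[OF 1 2]]) (simp only: ** mult.assoc[of k])
  qed simp
  also have "sin (k * pi) = 0" unfolding k_def by (rule sin_npi)
  finally have "((\<lambda>t. k * (cos (k * t) * V (R * cos t)) - R / 2 * (cos (real n * t) * V1 (R * cos t) - cos (real (Suc (Suc n)) * t) * V1 (R * cos t))) has_integral 0) {0..pi}"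
    by simp
  moreover have "((\<lambda>t. k * (cos (k * t) * V (R * cos t)) - R / 2 * (cos (real n * t) * V1 (R * cos t) - cos (real (Suc (Suc n)) * t) * V1 (R * cos t)))
     has_integral (k * integral {0..pi} (\<lambda>t. cos (k * t) * V (R * cos t)) - R / 2 * (integral {0..pi} (\<lambda>t. cos (real n * t) * V1 (R * cos t))
          - integral {0..pi} (\<lambda>t. cos (real (Suc (Suc n)) * t) * V1 (R * cos t))))) {0..pi}"
    by (intro has_integral_diff has_integral_mult_right integrable_integral integrable_continuous_interval continuous_intros)
  ultimately have "0 = k * integral {0..pi} (\<lambda>t. cos (k * t) * V (R * cos t)) - R / 2 * (integral {0..pi} (\<lambda>t. cos (real n * t) * V1 (R * cos t))
          - integral {0..pi} (\<lambda>t. cos (real (Suc (Suc n)) * t) * V1 (R * cos t)))"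
    by (rule has_integral_unique)
  then have "k * integral {0..pi} (\<lambda>t. cos (k * t) * V (R * cos t)) = R / 2 * (integral {0..pi} (\<lambda>t. cos (real n * t) * V1 (R * cos t))
          - integral {0..pi} (\<lambda>t. cos (real (Suc (Suc n)) * t) * V1 (R * cos t)))" by simp
  moreover have "k * (p * a) = R * (p * b - p * c) / 2" if "k * a = R / 2 * (b - c)" for a b c p
  proof -
    have "k * (p * a) = p * (k * a)" by simp
    also have "\<dots> = R * (p * b - p * c) / 2" unfolding that by (simp add: algebra_simps)
    finally show ?thesis .
  qed
  ultimately show ?thesis unfolding cheb_c_eq v_def k_def[symmetric] by blast
qed

text \<open>The sum telescopes with step two, so two terms survive at each end: \<open>v 0\<close>
  and \<open>v 1\<close> at the start, and two coefficients tending to 0 at the finish.\<close>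

lemma sums_n_cheb_c: "(\<lambda>n. real (Suc n) * cheb_c V (Suc n) R) sums g R"
proof -
  have "(\<Sum>n<M. real (Suc n) * cheb_c V (Suc n) R) = R * (v 0 R + v 1 R - v M R - v (Suc M) R) / 2" for M
    by (induction M) (simp_all add: cheb_c_Suc algebra_simps add_divide_distrib diff_divide_distrib del: of_nat_Suc)
  moreover have "(\<lambda>M. R * (v 0 R + v 1 R - v M R - v (Suc M) R) / 2) \<longlonglongrightarrow> R * (v 0 R + v 1 R - 0 - 0) / 2"
    by (intro tendsto_intros v_tendsto_0 LIMSEQ_Suc) auto
  ultimately have "(\<lambda>n. real (Suc n) * cheb_c V (Suc n) R) sums (R * (v 0 R + v 1 R - 0 - 0) / 2)"
    by (simp only: sums_def)
  then show ?thesis by (simp add: v_0 v_1 g_def)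
qed

text \<open>At x = r every Chebyshev polynomial is evaluated at 1 = cos 0, where its value is
  1.\<close>

lemma P_fun_diag: "r > 0 \<Longrightarrow> P_fun V r r = 1 - g r"
  using sums_n_cheb_c[of r] cheb_T_cos[of _ 0] by (simp add: P_fun_def sums_iff)

text \<open>By \<open>cheb_c_Suc\<close>, n c_n is a multiple of a difference of coefficients of
  order 1/n, so c_n is of order 1/n^2.\<close>

lemma summable_cheb_c: "summable (\<lambda>n. \<bar>cheb_c V n R\<bar>)"
proof -
  obtain C where C: "\<And>k. k \<ge> 1 \<Longrightarrow> \<bar>v k R\<bar> \<le> C / real k" using v_bound by blast
  have C0: "C \<ge> 0" using C[of 1] by auto
  have "summable (\<lambda>n. \<bar>R\<bar> * C * (1 / real n ^ 2))"
    by (intro summable_mult) (use inverse_power_summable[of 2, where ?'a = real] in \<open>simp add: inverse_eq_divide\<close>)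
  then have s: "summable (\<lambda>n. \<bar>R\<bar> * C * (1 / real (Suc n) ^ 2))"
    by (subst summable_Suc_iff)
  \<comment> \<open>The shift by two keeps the index \<open>Suc n\<close> of v at least 1, where
    \<open>v_bound\<close> applies.\<close>
  have "summable (\<lambda>n. \<bar>cheb_c V (Suc (Suc n)) R\<bar>)"
  proof (rule summable_comparison_test'[OF s, of 0])
    fix n
    have "real (Suc (Suc n)) * \<bar>cheb_c V (Suc (Suc n)) R\<bar> = \<bar>R\<bar> * \<bar>v (Suc n) R - v (Suc (Suc (Suc n))) R\<bar> / 2"
      using arg_cong[OF cheb_c_Suc[of "Suc n" R], of abs] by (simp add: abs_mult del: of_nat_Suc)
    also have "\<dots> \<le> \<bar>R\<bar> * (C / real (Suc n) + C / real (Suc n)) / 2"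
    proof (intro divide_right_mono mult_left_mono)
      have "C / real (Suc (Suc (Suc n))) \<le> C / real (Suc n)" using C0 by (intro divide_left_mono) auto
      then show "\<bar>v (Suc n) R - v (Suc (Suc (Suc n))) R\<bar> \<le> C / real (Suc n) + C / real (Suc n)"
        using C[of "Suc n"] C[of "Suc (Suc (Suc n))"] by linarith
    qed auto
    also have "\<dots> = \<bar>R\<bar> * C / real (Suc n)"
      using field_sum_of_halves[of "\<bar>R\<bar> * (C / real (Suc n))"]
      by (simp only: distrib_left add_divide_distrib times_divide_eq_right)
    finally have "real (Suc (Suc n)) * \<bar>cheb_c V (Suc (Suc n)) R\<bar> \<le> \<bar>R\<bar> * C / real (Suc n)" .
    moreover have "real (Suc n) * \<bar>cheb_c V (Suc (Suc n)) R\<bar> \<le> real (Suc (Suc n)) * \<bar>cheb_c V (Suc (Suc n)) R\<bar>"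
      by (intro mult_right_mono) auto
    ultimately have "real (Suc n) * \<bar>cheb_c V (Suc (Suc n)) R\<bar> \<le> \<bar>R\<bar> * C / real (Suc n)" by linarith
    then show "norm \<bar>cheb_c V (Suc (Suc n)) R\<bar> \<le> \<bar>R\<bar> * C * (1 / real (Suc n) ^ 2)"
      by (simp add: field_simps power2_eq_square del: of_nat_Suc)
  qed
  then show ?thesis
    using summable_Suc_iff[of "\<lambda>n. \<bar>cheb_c V (Suc n) R\<bar>"] summable_Suc_iff[of "\<lambda>n. \<bar>cheb_c V n R\<bar>"]
    by simp
qed

lemma V_cheb_expansion:
  "uniform_limit {-1..1} (\<lambda>M x. \<Sum>n<M. cheb_c V n R * cheb_T n x) (\<lambda>x. V (R * x)) sequentially"
proof -
  have ul: "uniform_limit {0..pi} (\<lambda>M t. \<Sum>n<M. cheb_c V n R * cos (real n * t)) (\<lambda>t. V (R * cos t)) sequentially"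
    by (rule cosine_series_uniform_limit)
       (auto intro!: continuous_intros has_integral_cheb_c V_cont summable_cheb_c)
  show ?thesis
  proof (rule uniform_limitI)
    fix e :: real assume "e > 0"
    from uniform_limitD[OF ul this]
    show "\<forall>\<^sub>F M in sequentially. \<forall>x\<in>{-1..1}. dist (\<Sum>n<M. cheb_c V n R * cheb_T n x) (V (R * x)) < e"
    proof eventually_elim
      case (elim M)
      show ?case
      proof
        fix x :: real assume x: "x \<in> {-1..1}"
        then have "arccos x \<in> {0..pi}" by (simp add: arccos_lbound arccos_ubound)
        from elim[rule_format, OF this] x show "dist (\<Sum>n<M. cheb_c V n R * cheb_T n x) (V (R * x)) < e"
          by (simp add: cheb_T_cos[symmetric])
      qed
    qed
  qed
qed

lemma sum_cheb_c_sq_le: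
  assumes "0 \<le> R"
  shows "(\<Sum>n<M. real (Suc n) * (cheb_c V (Suc n) R)\<^sup>2) \<le> 2 * integral {0..R} (\<lambda>s. s * (w s)\<^sup>2)"
proof -
  define S where "S = (\<lambda>R. \<Sum>n<M. real (Suc n) * (cheb_c V (Suc n) R)\<^sup>2)"
  define S' where "S' = (\<lambda>R. R * ((v 0 R)\<^sup>2 + (v 1 R)\<^sup>2 - (v M R)\<^sup>2 - (v (Suc M) R)\<^sup>2) / 2)"
  have dS: "(S has_real_derivative S' x) (at x)" for x
  proof -
    have "(S has_real_derivative (\<Sum>n<M. real (Suc n) * (2 * cheb_c V (Suc n) x * ((v n x + v (Suc (Suc n)) x) / 2)))) (at x)"
      unfolding S_def by (auto intro!: derivative_eq_intros cheb_c_deriv sum.cong simp del: of_nat_Suc)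
    also have "(\<Sum>n<M. real (Suc n) * (2 * cheb_c V (Suc n) x * ((v n x + v (Suc (Suc n)) x) / 2)))
      = (\<Sum>n<M. x * ((v n x)\<^sup>2 - (v (Suc (Suc n)) x)\<^sup>2) / 2)"
    proof (intro sum.cong refl)
      fix n
      have "real (Suc n) * (2 * cheb_c V (Suc n) x * ((v n x + v (Suc (Suc n)) x) / 2))
        = (real (Suc n) * cheb_c V (Suc n) x) * (v n x + v (Suc (Suc n)) x)" by (simp del: of_nat_Suc)
      also have "\<dots> = x * ((v n x)\<^sup>2 - (v (Suc (Suc n)) x)\<^sup>2) / 2"
        unfolding cheb_c_Suc by (simp add: power2_eq_square algebra_simps)
      finally show "real (Suc n) * (2 * cheb_c V (Suc n) x * ((v n x + v (Suc (Suc n)) x) / 2))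
        = x * ((v n x)\<^sup>2 - (v (Suc (Suc n)) x)\<^sup>2) / 2" .
    qed
    also have "\<dots> = S' x"
      unfolding S'_def by (induction M) (simp_all add: algebra_simps add_divide_distrib diff_divide_distrib)
    finally show ?thesis .
  qed
  have "(S' has_integral (S R - S 0)) {0..R}"
    by (rule fundamental_theorem_of_calculus[OF assms])
       (auto simp flip: has_real_derivative_iff_has_vector_derivative intro: has_field_derivative_at_within dS)
  moreover have "((\<lambda>s. 2 * (s * (w s)\<^sup>2)) has_integral 2 * integral {0..R} (\<lambda>s. s * (w s)\<^sup>2)) {0..R}"
    by (intro has_integral_mult_right integrable_integral integrable_continuous_interval continuous_intros w_cont)
  moreover have "S' s \<le> 2 * (s * (w s)\<^sup>2)" if "s \<in> {0..R}" for s
  proof -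
    have "s * ((v 0 s)\<^sup>2 + (v 1 s)\<^sup>2 - (v M s)\<^sup>2 - (v (Suc M) s)\<^sup>2) \<le> s * (4 * (w s)\<^sup>2)"
      using that by (intro mult_left_mono) (auto simp: v_0 v_1 power2_eq_square)
    then show ?thesis by (simp add: S'_def)
  qed
  ultimately have "S R - S 0 \<le> 2 * integral {0..R} (\<lambda>s. s * (w s)\<^sup>2)"
    by (rule has_integral_le)
  moreover have "cheb_c V (Suc n) 0 = 0" for n using cheb_c_Suc[of n 0] by simp
  ultimately show ?thesis by (simp add: S_def)
qed

text \<open>The integral takes the place of half the sum of n c_n^2. Through
  \<open>sum_cheb_c_sq_le\<close> it bounds all partial sums, and it is differentiable in R at
  once.\<close>

definition E :: "real \<Rightarrow> real" where
  "E R = ln (2 / R) / 2 + W R - integral {0..R} (\<lambda>s. s * (w s)\<^sup>2) / 2"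

text \<open>With g s = s w s the integrand expands to 1/s - 2 w + s w^2, the derivative of - 2
  E.\<close>

lemma E_diff:
  assumes "0 < r" "r \<le> R"
  shows "((\<lambda>s. (1 - g s)\<^sup>2 / s) has_integral 2 * (E r - E R)) {r..R}"
proof -
  have int: "(\<lambda>s. s * (w s)\<^sup>2) integrable_on {a..b}" for a b
    by (intro integrable_continuous_interval continuous_intros w_cont)
  have "((\<lambda>s. 1 / s - 2 * w s) has_integral ((ln R - 2 * W R) - (ln r - 2 * W r))) {r..R}"
    by (rule fundamental_theorem_of_calculus)
       (use assms in \<open>auto simp flip: has_real_derivative_iff_has_vector_derivative
         intro!: derivative_eq_intros has_field_derivative_at_within[OF W_deriv]\<close>)
  then have "((\<lambda>s. (1 / s - 2 * w s) + s * (w s)\<^sup>2) has_integral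
      ((ln R - 2 * W R) - (ln r - 2 * W r)) + integral {r..R} (\<lambda>s. s * (w s)\<^sup>2)) {r..R}"
    by (intro has_integral_add integrable_integral int)
  also have "((ln R - 2 * W R) - (ln r - 2 * W r)) + integral {r..R} (\<lambda>s. s * (w s)\<^sup>2) = 2 * (E r - E R)"
    using assms Henstock_Kurzweil_Integration.integral_combine[of 0 r R "\<lambda>s. s * (w s)\<^sup>2", OF _ _ int]
    by (simp add: E_def ln_div field_simps)
  finally show ?thesis
    by (rule has_integral_eq[rotated]) (use assms in \<open>auto simp: g_def field_simps power2_eq_square\<close>)
qed

text \<open>The tangent at 1 evaluated at |x|. Its slope is positive, so V dominates the logarithm
  in the kernel.\<close>

lemma V_linear_lower_bound: "V1 1 * \<bar>x\<bar> - (V1 1 - V 1) \<le> V x"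
  using V_above_tangent[of 1 "\<bar>x\<bar>"] V_even[of x] by (auto simp: algebra_simps abs_if split: if_splits)

end

section \<open>Lower bound on the energy\<close>

text \<open>The coercion \<open>ennreal\<close> sends negative reals to 0, so the right side
  integrates the positive part. This lets real minorants without a sign be used below nonnegative
  kernels.\<close>

lemma ennreal_integral_le_nn_integral:
  fixes f :: "'a \<Rightarrow> real"
  assumes "integrable M f"
  shows "ennreal (\<integral>x. f x \<partial>M) \<le> (\<integral>\<^sup>+x. ennreal (f x) \<partial>M)"
proof -
  have "(\<integral>x. f x \<partial>M) \<le> (\<integral>x. max 0 (f x) \<partial>M)"
    by (intro integral_mono integrable_max assms) auto
  then have "ennreal (\<integral>x. f x \<partial>M) \<le> ennreal (\<integral>x. max 0 (f x) \<partial>M)" by (rule ennreal_leI)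
  also have "\<dots> = (\<integral>\<^sup>+x. ennreal (max 0 (f x)) \<partial>M)"
    by (intro nn_integral_eq_integral[symmetric] integrable_max assms) auto
  also have "\<dots> = (\<integral>\<^sup>+x. ennreal (f x) \<partial>M)"
    by (intro nn_integral_cong) (auto simp: max_def ennreal_neg)
  finally show ?thesis .
qed

text \<open>Energy kernel plus a constant. Under \<open>kernel_bound V B\<close> nothing is
  truncated, and the energy becomes an iterated nonnegative integral, to which Tonelli and
  monotonicity apply without integrability conditions.\<close>

definition shifted_kernel :: "(real \<Rightarrow> real) \<Rightarrow> real \<Rightarrow> real \<Rightarrow> real \<Rightarrow> ennreal" where
  "shifted_kernel V B x y =
     (if x = y then \<top> else ennreal (B + (- ln \<bar>x - y\<bar> / 2 + (V x + V y) / 2)))"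

definition shifted_energy :: "(real \<Rightarrow> real) \<Rightarrow> real \<Rightarrow> real measure \<Rightarrow> ennreal" where
  "shifted_energy V B \<rho> = (\<integral>\<^sup>+x. \<integral>\<^sup>+y. shifted_kernel V B x y \<partial>\<rho> \<partial>\<rho>)"

definition kernel_bound :: "(real \<Rightarrow> real) \<Rightarrow> real \<Rightarrow> bool" where
  "kernel_bound V B \<longleftrightarrow> 0 \<le> B \<and> (\<forall>x y. x \<noteq> y \<longrightarrow> 0 \<le> B + (- ln \<bar>x - y\<bar> / 2 + (V x + V y) / 2))"

lemma shifted_kernel_commute: "shifted_kernel V B x y = shifted_kernel V B y x"
  by (simp add: shifted_kernel_def abs_minus_commute add.commute)

lemma measurable_shifted_kernel [measurable]:
  assumes [measurable]: "V \<in> borel_measurable borel"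
  shows "(\<lambda>z. shifted_kernel V B (fst z) (snd z)) \<in> borel_measurable (borel \<Otimes>\<^sub>M borel)"
  unfolding shifted_kernel_def by measurable

text \<open>The identity (B + k) + k^- = k^+ + B, written without subtraction so that it survives in
  \<open>ennreal\<close>; on the diagonal both sides are infinite.\<close>

lemma shifted_kernel_eq:
  assumes "kernel_bound V B"
  shows "shifted_kernel V B x y + e2ennreal (max 0 (- energy_kernel V (x, y)))
     = e2ennreal (max 0 (energy_kernel V (x, y))) + ennreal B"
proof (cases "x = y")
  case True
  then show ?thesis by (simp add: shifted_kernel_def energy_kernel_def max_def top_ennreal_def)
next
  case False
  define k where "k = - ln \<bar>x - y\<bar> / 2 + (V x + V y) / 2"
  have B: "0 \<le> B" "0 \<le> B + k" using assms False unfolding kernel_bound_def k_def by blast+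
  have "ennreal (B + k) + ennreal (max 0 (- k)) = ennreal (max 0 k) + ennreal B"
  proof -
    have "ennreal (B + k) + ennreal (max 0 (- k)) = ennreal (B + k + max 0 (- k))"
      using B by (intro ennreal_plus[symmetric]) auto
    also have "B + k + max 0 (- k) = max 0 k + B" by (simp add: max_def)
    also have "ennreal (max 0 k + B) = ennreal (max 0 k) + ennreal B"
      using B by (intro ennreal_plus) auto
    finally show ?thesis .
  qed
  moreover have "e2ennreal (max 0 (ereal t)) = ennreal (max 0 t)" for t
    by (cases "0 \<le> t") (simp_all add: max_def e2ennreal_ereal)
  moreover have "energy_kernel V (x, y) = ereal k" "shifted_kernel V B x y = ennreal (B + k)"
    using False by (simp_all add: energy_kernel_def shifted_kernel_def k_def)
  ultimately show ?thesis by (simp only: uminus_ereal.simps)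
qed

lemma energy_eq_shifted_energy:
  assumes V [measurable]: "V \<in> borel_measurable borel" and B: "kernel_bound V B"
    and \<rho>: "\<rho> \<in> prob_measures_R"
  shows "energy V \<rho> = enn2ereal (shifted_energy V B \<rho>) - ereal B"
proof -
  interpret prob_space \<rho> using \<rho> by (simp add: prob_measures_R_def)
  have [measurable_cong, simp]: "sets \<rho> = sets borel" using \<rho> by (simp add: prob_measures_R_def)
  interpret P: pair_prob_space \<rho> \<rho> ..
  define p where "p = (\<integral>\<^sup>+ x. e2ennreal (max 0 (energy_kernel V x)) \<partial>(\<rho> \<Otimes>\<^sub>M \<rho>))"
  define n where "n = (\<integral>\<^sup>+ x. e2ennreal (max 0 (- energy_kernel V x)) \<partial>(\<rho> \<Otimes>\<^sub>M \<rho>))"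
  have k [measurable]: "energy_kernel V \<in> borel_measurable (\<rho> \<Otimes>\<^sub>M \<rho>)"
    unfolding energy_kernel_def[abs_def] by measurable
  have s [measurable]: "(\<lambda>z. shifted_kernel V B (fst z) (snd z)) \<in> borel_measurable (\<rho> \<Otimes>\<^sub>M \<rho>)"
    using measurable_shifted_kernel[OF V] by (simp cong: measurable_cong_sets sets_pair_measure_cong)
  have S: "shifted_energy V B \<rho> = (\<integral>\<^sup>+ z. shifted_kernel V B (fst z) (snd z) \<partial>(\<rho> \<Otimes>\<^sub>M \<rho>))"
    unfolding shifted_energy_def by (subst nn_integral_fst[OF s, symmetric]) simp
  have e: "shifted_energy V B \<rho> + n = p + ennreal B"
  proof -
    have "shifted_energy V B \<rho> + n = (\<integral>\<^sup>+ z. shifted_kernel V B (fst z) (snd z) + e2ennreal (max 0 (- energy_kernel V z)) \<partial>(\<rho> \<Otimes>\<^sub>M \<rho>))"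
      unfolding S n_def by (intro nn_integral_add[symmetric]) measurable
    also have "\<dots> = (\<integral>\<^sup>+ z. e2ennreal (max 0 (energy_kernel V z)) + ennreal B \<partial>(\<rho> \<Otimes>\<^sub>M \<rho>))"
      using shifted_kernel_eq[OF B] by (intro nn_integral_cong) (auto simp: split_beta)
    also have "\<dots> = p + ennreal B"
      unfolding p_def by (subst nn_integral_add) (auto simp: P.emeasure_space_1)
    finally show ?thesis .
  qed
  \<comment> \<open>Finiteness of the negative part rules out infinity minus infinity and lets n be
    cancelled.\<close>
  have "n \<le> (\<integral>\<^sup>+ z. ennreal B \<partial>(\<rho> \<Otimes>\<^sub>M \<rho>))"
    unfolding n_def
  proof (intro nn_integral_mono)
    fix z
    show "e2ennreal (max 0 (- energy_kernel V z)) \<le> ennreal B"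
    proof (cases "fst z = snd z")
      case True
      then show ?thesis by (simp add: energy_kernel_def max_def)
    next
      case False
      define k where "k = - ln \<bar>fst z - snd z\<bar> / 2 + (V (fst z) + V (snd z)) / 2"
      have "0 \<le> B" "0 \<le> B + k" using B False unfolding kernel_bound_def k_def by blast+
      then have "max 0 (- energy_kernel V z) \<le> ereal B"
        using False unfolding energy_kernel_def k_def[symmetric] by simp
      from e2ennreal_mono[OF this] show ?thesis by (simp add: ennreal.abs_eq)
    qed
  qed
  then have nB: "n \<le> ennreal B" by (simp add: P.emeasure_space_1)
  then obtain n' where n': "n = ennreal n'" "0 \<le> n'"
    by (metis ennreal_cases ennreal_neq_top neq_top_trans top.not_eq_extremum top.extremum_unique)
  have B0: "0 \<le> B" using B by (simp add: kernel_bound_def)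
  have "energy V \<rho> = enn2ereal p - enn2ereal n"
    by (simp add: energy_def ereal_integral_def p_def n_def)
  also have "\<dots> = enn2ereal (shifted_energy V B \<rho>) - ereal B"
  proof (cases p)
    case (real q)
    then have "shifted_energy V B \<rho> + n = ennreal (q + B)" using e B0 by simp
    then have "shifted_energy V B \<rho> \<noteq> \<top>" by auto
    then obtain q' where q': "shifted_energy V B \<rho> = ennreal q'" "0 \<le> q'" by (cases "shifted_energy V B \<rho>") auto
    then have "ennreal (q' + n') = ennreal (q + B)" using e real n' B0 by simp
    then have "q' + n' = q + B" using q' n' real B0 by (subst (asm) ennreal_inj) auto
    then show ?thesis using q' real n' by (simp add: enn2ereal_ennreal)
  next
    case top
    then have "shifted_energy V B \<rho> = \<top>" using e n' by (cases "shifted_energy V B \<rho>") auto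
    then show ?thesis using top n' by (simp add: enn2ereal_ennreal)
  qed
  finally show ?thesis .
qed

text \<open>The left side is the minimum over a, attained at a = - n c / (2 s). In the application a
  is a Chebyshev moment and s is the damping factor of order n.\<close>

lemma completed_square:
  fixes a c s :: real assumes "0 < s" "0 < n"
  shows "- (n * c\<^sup>2 / s) / 4 \<le> s / n * a\<^sup>2 + c * a"
proof -
  have "0 \<le> (s / n) * (a + n * c / (2 * s))\<^sup>2" using assms by simp
  also have "\<dots> = s / n * a\<^sup>2 + c * a + (n * c\<^sup>2 / s) / 4"
    using assms by (simp add: power2_eq_square field_simps)
  finally show ?thesis by simp
qed

lemma AE_prob_measures_on:
  assumes "\<rho> \<in> prob_measures_on R"
  shows "AE x in \<rho>. x \<in> {-R..R}"
proof -
  interpret prob_space \<rho> using assms by (simp add: prob_measures_on_def prob_measures_R_def)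
  show ?thesis
    using assms by (intro AE_prob_1) (simp add: prob_measures_on_def measure_def)
qed

lemma prob_measures_on_mono:
  assumes r: "r \<le> R" and \<rho>: "\<rho> \<in> prob_measures_on r"
  shows "\<rho> \<in> prob_measures_on R"
proof -
  interpret prob_space \<rho> using \<rho> by (simp add: prob_measures_on_def prob_measures_R_def)
  have "emeasure \<rho> {-R..R} = 1"
    using \<rho> r by (intro emeasure_eq_1_AE) (auto simp: prob_measures_on_def prob_measures_R_def intro: eventually_mono[OF AE_prob_measures_on[OF \<rho>]])
  then show ?thesis using \<rho> by (simp add: prob_measures_on_def)
qed

context even_convex_potential
begin

lemma V_measurable [measurable]: "V \<in> borel_measurable borel"
  by (rule borel_measurable_continuous_onI[OF V_cont])

section \<open>Choice of the shift for the given potential\<close>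

lemma kernel_bound_exists: "\<exists>B. kernel_bound V B"
proof -
  \<comment> \<open>The bound ln (a u) <= a u - 1 with this slope makes the linear terms cancel
    exactly against \<open>V_linear_lower_bound\<close>.\<close>
  define a where "a = V1 1"
  have a: "a > 0" using V1_pos[of 1] by (simp add: a_def)
  define B where "B = \<bar>1 + ln a\<bar> + \<bar>a - V 1\<bar>"
  have "0 \<le> B + (- ln \<bar>x - y\<bar> / 2 + (V x + V y) / 2)" if "x \<noteq> y" for x y
  proof -
    have "ln (a * \<bar>x - y\<bar>) \<le> a * \<bar>x - y\<bar> - 1"
      using that a by (intro ln_le_minus_one) auto
    moreover have "ln (a * \<bar>x - y\<bar>) = ln a + ln \<bar>x - y\<bar>" using that a by (simp add: ln_mult_pos)
    moreover have "a * \<bar>x - y\<bar> \<le> a * (\<bar>x\<bar> + \<bar>y\<bar>)" using a by (intro mult_left_mono) auto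
    moreover have "a * (\<bar>x\<bar> + \<bar>y\<bar>) = a * \<bar>x\<bar> + a * \<bar>y\<bar>" by (simp add: distrib_left)
    moreover have "a * \<bar>x\<bar> - (a - V 1) \<le> V x" "a * \<bar>y\<bar> - (a - V 1) \<le> V y"
      unfolding a_def by (rule V_linear_lower_bound)+
    moreover have "- (1 + ln a) \<le> \<bar>1 + ln a\<bar>" "a - V 1 \<le> \<bar>a - V 1\<bar>" "0 \<le> \<bar>a - V 1\<bar>" "0 \<le> \<bar>1 + ln a\<bar>" by auto
    ultimately show ?thesis unfolding B_def by argo
  qed
  then show ?thesis by (auto simp: kernel_bound_def B_def intro!: exI[of _ B])
qed

text \<open>The summand 1 makes every shifted energy at least 1, so bounds of the form \<open>SE \<rho> \<le> ennreal (e + B)\<close>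
  are never affected by the truncation of negative reals in \<open>ennreal\<close>.\<close>

definition B :: real where "B = (SOME b. kernel_bound V b) + 1"

lemma B_kernel_ge_1: "x \<noteq> y \<Longrightarrow> 1 \<le> B + (- ln \<bar>x - y\<bar> / 2 + (V x + V y) / 2)"
  and kernel_bound_B: "kernel_bound V B"
proof -
  have *: "kernel_bound V (B - 1)"
    using someI_ex[OF kernel_bound_exists] by (simp add: B_def)
  show 1: "1 \<le> B + (- ln \<bar>x - y\<bar> / 2 + (V x + V y) / 2)" if "x \<noteq> y" for x y
  proof -
    have "0 \<le> B - 1 + (- ln \<bar>x - y\<bar> / 2 + (V x + V y) / 2)"
      using * that unfolding kernel_bound_def by blast
    then show ?thesis by linarith
  qed
  show "kernel_bound V B"
    unfolding kernel_bound_def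
  proof (intro conjI allI impI)
    show "0 \<le> B" using * by (simp add: kernel_bound_def)
    show "0 \<le> B + (- ln \<bar>x - y\<bar> / 2 + (V x + V y) / 2)" if "x \<noteq> y" for x y
      using 1[OF that] by linarith
  qed
qed

lemma B_kernel: "x \<noteq> y \<Longrightarrow> 0 \<le> B + (- ln \<bar>x - y\<bar> / 2 + (V x + V y) / 2)"
  using kernel_bound_B unfolding kernel_bound_def by blast

definition SE :: "real measure \<Rightarrow> ennreal" where "SE = shifted_energy V B"

lemma energy_eq_SE: "\<rho> \<in> prob_measures_R \<Longrightarrow> energy V \<rho> = enn2ereal (SE \<rho>) - ereal B"
  unfolding SE_def by (rule energy_eq_shifted_energy[OF V_measurable kernel_bound_B])

lemma le_energy_iff:
  assumes "\<rho> \<in> prob_measures_R"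
  shows "ereal e \<le> energy V \<rho> \<longleftrightarrow> ennreal (e + B) \<le> SE \<rho>"
  unfolding energy_eq_SE[OF assms]
  by (cases "SE \<rho>") (auto simp: enn2ereal_ennreal algebra_simps ennreal_le_iff2)

lemma energy_le:
  assumes "\<rho> \<in> prob_measures_R" "SE \<rho> \<le> ennreal (e + B)" "0 \<le> e + B"
  shows "energy V \<rho> \<le> ereal e"
  unfolding energy_eq_SE[OF assms(1)]
  using assms by (cases "SE \<rho>") (auto simp: enn2ereal_ennreal top_unique)

text \<open>The kernel is minorised by a damped one and V by a partial Chebyshev sum minus \<delta>.
  What remains is a finite quadratic form in the Chebyshev moments of the measure, and each order is
  minimised separately. The damping is removed with the number of orders fixed, and only then does
  \<delta> tend to 0.\<close>

lemma shifted_energy_lower_bound: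
  assumes R: "0 < R" and \<rho>: "\<rho> \<in> prob_measures_on R"
  shows "ennreal (E R + B) \<le> SE \<rho>"
proof -
  interpret prob_space \<rho> using \<rho> by (simp add: prob_measures_on_def prob_measures_R_def)
  have [measurable_cong, simp]: "sets \<rho> = sets borel" using \<rho> by (simp add: prob_measures_on_def prob_measures_R_def)
  have AER: "AE x in \<rho>. x \<in> {-R..R}" by (rule AE_prob_measures_on[OF \<rho>])
  define T where "T = (\<lambda>n x. cheb_T n (x / R))"
  have [measurable]: "T n \<in> borel_measurable borel" for n unfolding T_def by measurable
  have T_le: "\<bar>T n x\<bar> \<le> 1" if "x \<in> {-R..R}" for n x
    unfolding T_def using that R by (intro abs_cheb_T_le_1) (auto simp: field_simps abs_le_iff)
  have intT: "integrable \<rho> (T n)" for n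
  proof (rule integrable_const_bound[where B = 1])
    show "AE x in \<rho>. norm (T n x) \<le> 1" by (rule eventually_mono[OF AER]) (use T_le in auto)
  qed measurable
  \<comment> \<open>Chebyshev moments of the measure; only \<open>a 0 = 1\<close> and the existence
    of the others are used.\<close>
  define a where "a = (\<lambda>n. \<integral>x. T n x \<partial>\<rho>)"
  have a0: "a 0 = 1" by (simp add: a_def T_def prob_space)
  define c where "c = (\<lambda>n. cheb_c V n R)"
  obtain s N \<epsilon> where tk: "\<And>m::nat. 0 < s m" "\<And>m. s m < (1::real)" "s \<longlonglongrightarrow> 1" "\<epsilon> \<longlonglongrightarrow> (0::real)" "\<And>m. m \<le> N m"
    "\<And>m a b. cos a \<noteq> cos b \<Longrightarrow> trig_kernel (s m) (N m) a b \<le> - ln (2 * \<bar>cos a - cos b\<bar>) + \<epsilon> m"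
    by (rule trig_kernel_limit) blast
  have main: "ennreal (B + (ln (2 / R) / 2 - \<epsilon> m / 2 - \<delta> + (\<Sum>n=1..N m. s m ^ n / real n * (a n)\<^sup>2) + (\<Sum>n<M. c n * a n))) \<le> SE \<rho>"
    if \<delta>: "\<And>x. x \<in> {-1..1} \<Longrightarrow> \<bar>(\<Sum>n<M. c n * cheb_T n x) - V (R * x)\<bar> \<le> \<delta>" for m M \<delta>
  proof -
    define p where "p = (\<lambda>x. \<Sum>n<M. c n * T n x)"
    define K where "K = (\<lambda>x y. \<Sum>n=1..N m. 2 * s m ^ n / real n * (T n x * T n y))"
    \<comment> \<open>Pointwise minorant of the shifted kernel on the support; \<open>\<psi>\<close>
      below is its integral in y.\<close>
    define \<phi> where "\<phi> = (\<lambda>x y. B + (ln (2 / R) / 2 - \<epsilon> m / 2 - \<delta> + K x y / 2 + p x / 2 + p y / 2))"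
    have le: "ennreal (\<phi> x y) \<le> shifted_kernel V B x y" if xy: "x \<in> {-R..R}" "y \<in> {-R..R}" for x y
    proof (cases "x = y")
      case False
      \<comment> \<open>In angles |x - y| = (R/2) * (2 |cos al - cos be|), which is where the term
        ln (2 / R) comes from.\<close>
      define al be where "al = arccos (x / R)" and "be = arccos (y / R)"
      have b: "x / R \<in> {-1..1}" "y / R \<in> {-1..1}" using xy R by (auto simp: field_simps)
      then have cs: "cos al = x / R" "cos be = y / R" by (auto simp: al_def be_def)
      have "K x y = trig_kernel (s m) (N m) al be"
        unfolding K_def trig_kernel_def T_def cs[symmetric] cheb_T_cos ..
      also have "\<dots> \<le> - ln (2 * \<bar>cos al - cos be\<bar>) + \<epsilon> m"
        using False R by (intro tk(6)) (simp add: cs)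
      also have "2 * \<bar>cos al - cos be\<bar> = (2 / R) * \<bar>x - y\<bar>"
        using R by (simp add: cs abs_divide flip: diff_divide_distrib)
      also have "ln ((2 / R) * \<bar>x - y\<bar>) = ln (2 / R) + ln \<bar>x - y\<bar>"
        using R False by (intro ln_mult_pos) auto
      finally have 1: "K x y \<le> - (ln (2 / R) + ln \<bar>x - y\<bar>) + \<epsilon> m" .
      have "p x - \<delta> \<le> V x" "p y - \<delta> \<le> V y"
        using \<delta>[OF b(1)] \<delta>[OF b(2)] R unfolding p_def T_def by auto
      with 1 have "\<phi> x y \<le> B + (- ln \<bar>x - y\<bar> / 2 + (V x + V y) / 2)"
        unfolding \<phi>_def by argo
      with False show ?thesis by (simp add: shifted_kernel_def ennreal_leI)
    qed (simp add: shifted_kernel_def)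
    have [measurable]: "p \<in> borel_measurable borel" unfolding p_def by measurable
    define \<psi> where "\<psi> = (\<lambda>x. B + (ln (2 / R) / 2 - \<epsilon> m / 2 - \<delta> + (\<Sum>n=1..N m. s m ^ n / real n * a n * T n x) + p x / 2 + (\<Sum>n<M. c n * a n) / 2))"
    have ip: "integrable \<rho> p" "(\<integral>x. p x \<partial>\<rho>) = (\<Sum>n<M. c n * a n)"
      unfolding p_def a_def by (auto intro!: integrable_sum integrable_mult_right intT simp: Bochner_Integration.integral_sum intT)
    have iK: "integrable \<rho> (K x)" "(\<integral>y. K x y \<partial>\<rho>) = (\<Sum>n=1..N m. 2 * s m ^ n / real n * (T n x * a n))" for x
      unfolding K_def a_def by (auto intro!: Bochner_Integration.integrable_sum integrable_mult_right intT simp: Bochner_Integration.integral_sum intT)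
    have i\<phi>: "integrable \<rho> (\<phi> x)" "(\<integral>y. \<phi> x y \<partial>\<rho>) = \<psi> x" for x
    proof -
      show "integrable \<rho> (\<phi> x)"
        unfolding \<phi>_def using iK ip by (auto intro!: Bochner_Integration.integrable_add integrable_const)
      have "(\<integral>y. \<phi> x y \<partial>\<rho>) = B + (ln (2 / R) / 2 - \<epsilon> m / 2 - \<delta> + (\<Sum>n=1..N m. 2 * s m ^ n / real n * (T n x * a n)) / 2 + p x / 2 + (\<Sum>n<M. c n * a n) / 2)"
        unfolding \<phi>_def using iK ip by (simp add: prob_space)
      also have "(\<Sum>n=1..N m. 2 * s m ^ n / real n * (T n x * a n)) / 2 = (\<Sum>n=1..N m. s m ^ n / real n * a n * T n x)"
        unfolding sum_divide_distrib by (intro sum.cong) auto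
      finally show "(\<integral>y. \<phi> x y \<partial>\<rho>) = \<psi> x" unfolding \<psi>_def .
    qed
    have i\<psi>: "integrable \<rho> \<psi>"
      unfolding \<psi>_def using ip intT
      by (auto intro!: Bochner_Integration.integrable_add Bochner_Integration.integrable_sum integrable_mult_right integrable_const)
    have "(\<integral>x. \<psi> x \<partial>\<rho>) = B + (ln (2 / R) / 2 - \<epsilon> m / 2 - \<delta> + (\<Sum>n=1..N m. s m ^ n / real n * a n * a n) + (\<Sum>n<M. c n * a n) / 2 + (\<Sum>n<M. c n * a n) / 2)"
      unfolding \<psi>_def a_def[symmetric] using ip intT
      by (simp add: prob_space Bochner_Integration.integral_sum a_def)
    then have eq: "(\<integral>x. \<psi> x \<partial>\<rho>) = B + (ln (2 / R) / 2 - \<epsilon> m / 2 - \<delta> + (\<Sum>n=1..N m. s m ^ n / real n * (a n)\<^sup>2) + (\<Sum>n<M. c n * a n))"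
      by (simp add: power2_eq_square mult.assoc)
    have "ennreal (\<integral>x. \<psi> x \<partial>\<rho>) \<le> (\<integral>\<^sup>+x. ennreal (\<psi> x) \<partial>\<rho>)"
      by (rule ennreal_integral_le_nn_integral[OF i\<psi>])
    also have "\<dots> \<le> (\<integral>\<^sup>+x. \<integral>\<^sup>+y. shifted_kernel V B x y \<partial>\<rho> \<partial>\<rho>)"
    proof (rule nn_integral_mono_AE)
      show "AE x in \<rho>. ennreal (\<psi> x) \<le> (\<integral>\<^sup>+y. shifted_kernel V B x y \<partial>\<rho>)"
        using AER
      proof eventually_elim
        case (elim x)
        have "ennreal (\<psi> x) \<le> (\<integral>\<^sup>+y. ennreal (\<phi> x y) \<partial>\<rho>)"
          using ennreal_integral_le_nn_integral[OF i\<phi>(1)[of x]] by (simp add: i\<phi>(2))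
        also have "\<dots> \<le> (\<integral>\<^sup>+y. shifted_kernel V B x y \<partial>\<rho>)"
          by (intro nn_integral_mono_AE eventually_mono[OF AER] le elim)
        finally show ?case .
      qed
    qed
    finally show ?thesis unfolding eq SE_def shifted_energy_def .
  qed
  show ?thesis
  proof (cases "SE \<rho>")
    case (real S)
    have bound: "E R + B - \<delta> \<le> S" if \<delta>0: "\<delta> > 0" for \<delta>
    proof -
      have "\<forall>\<^sub>F M0 in sequentially. (\<forall>x\<in>{-1..1}. dist (\<Sum>n<M0. cheb_c V n R * cheb_T n x) (V (R * x)) < \<delta>) \<and> 1 \<le> M0"
        by (intro eventually_conj uniform_limitD[OF V_cheb_expansion \<delta>0] eventually_ge_at_top)
      then obtain M0 where M0': "\<forall>x\<in>{-1..1}. dist (\<Sum>n<M0. cheb_c V n R * cheb_T n x) (V (R * x)) < \<delta>" "1 \<le> M0"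
        by (auto simp: eventually_sequentially)
      have M0: "\<bar>(\<Sum>n<M0. c n * cheb_T n x) - V (R * x)\<bar> < \<delta>" if "x \<in> {-1..1}" for x
        using M0'(1) that unfolding c_def dist_real_def by blast
      \<comment> \<open>Order 0 is split off: it has no quadratic term and contributes exactly
        \<open>c 0\<close>.\<close>
      obtain M where M: "M0 = Suc M" using M0'(2) by (cases M0) auto
      define l where "l = (\<lambda>m. B + (ln (2 / R) / 2 - \<epsilon> m / 2 - \<delta> + c 0 - (\<Sum>n<M. real (Suc n) * (c (Suc n))\<^sup>2 / s m ^ Suc n) / 4))"
      have "l m \<le> S" if "M \<le> m" for m
      proof -
        have "ennreal (B + (ln (2 / R) / 2 - \<epsilon> m / 2 - \<delta> + (\<Sum>n=1..N m. s m ^ n / real n * (a n)\<^sup>2) + (\<Sum>n<M0. c n * a n))) \<le> ennreal S"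
          using main[of M0 \<delta> m] M0 real by (auto intro: less_imp_le)
        then have "B + (ln (2 / R) / 2 - \<epsilon> m / 2 - \<delta> + (\<Sum>n=1..N m. s m ^ n / real n * (a n)\<^sup>2) + (\<Sum>n<M0. c n * a n)) \<le> S"
          using real by (simp add: ennreal_le_iff)
        \<comment> \<open>The discarded orders are nonnegative, and M <= m <= N m keeps the first M
          orders within the cutoff.\<close>
        moreover have "(\<Sum>n<M. s m ^ Suc n / real (Suc n) * (a (Suc n))\<^sup>2) \<le> (\<Sum>n=1..N m. s m ^ n / real n * (a n)\<^sup>2)"
        proof -
          have "(\<Sum>n<M. s m ^ Suc n / real (Suc n) * (a (Suc n))\<^sup>2) = (\<Sum>n\<in>Suc ` {..<M}. s m ^ n / real n * (a n)\<^sup>2)"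
            by (subst sum.reindex) auto
          also have "\<dots> \<le> (\<Sum>n=1..N m. s m ^ n / real n * (a n)\<^sup>2)"
            using that tk(5)[of m] tk(1)[of m] by (intro sum_mono2) (auto intro!: mult_nonneg_nonneg divide_nonneg_nonneg)
          finally show ?thesis .
        qed
        moreover have "(\<Sum>n<M0. c n * a n) = c 0 + (\<Sum>n<M. c (Suc n) * a (Suc n))"
          unfolding M by (subst sum.lessThan_Suc_shift) (simp add: a0)
        moreover have "- (\<Sum>n<M. real (Suc n) * (c (Suc n))\<^sup>2 / s m ^ Suc n) / 4 \<le>
            (\<Sum>n<M. s m ^ Suc n / real (Suc n) * (a (Suc n))\<^sup>2) + (\<Sum>n<M. c (Suc n) * a (Suc n))"
          unfolding sum.distrib[symmetric] sum_negf[symmetric] sum_divide_distrib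
          using tk(1)[of m] by (intro sum_mono completed_square) auto
        ultimately show ?thesis unfolding l_def by linarith
      qed
      \<comment> \<open>M is fixed, so the damping factors tend to 1 term by term.\<close>
      moreover have "l \<longlonglongrightarrow> B + (ln (2 / R) / 2 - 0 / 2 - \<delta> + c 0 - (\<Sum>n<M. real (Suc n) * (c (Suc n))\<^sup>2 / 1 ^ Suc n) / 4)"
        unfolding l_def by (intro tendsto_intros tk) auto
      ultimately have "B + (ln (2 / R) / 2 - 0 / 2 - \<delta> + c 0 - (\<Sum>n<M. real (Suc n) * (c (Suc n))\<^sup>2 / 1 ^ Suc n) / 4) \<le> S"
        using LIMSEQ_le_const2[of l] by blast
      moreover have "(\<Sum>n<M. real (Suc n) * (c (Suc n))\<^sup>2 / 1 ^ Suc n) \<le> 2 * integral {0..R} (\<lambda>s. s * (w s)\<^sup>2)"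
        using sum_cheb_c_sq_le[of R M] R by (simp add: c_def)
      moreover have "c 0 = W R" by (simp add: c_def cheb_c_0)
      ultimately show ?thesis unfolding E_def by linarith
    qed
    have "E R + B \<le> S"
      by (rule field_le_epsilon) (use bound in force)
    then show ?thesis using real by (simp add: ennreal_leI)
  qed simp
qed

end

section \<open>Mixtures of arcsine laws\<close>

lemma nn_integral_has_bochner_integral:
  fixes f :: "'a \<Rightarrow> real"
  assumes "has_bochner_integral M f c" "\<And>x. 0 \<le> f x"
  shows "(\<integral>\<^sup>+x. ennreal (f x) \<partial>M) = ennreal c"
  using nn_integral_eq_integral[of M f] assms by (auto simp: has_bochner_integral_iff)

text \<open>Uniform law on [0, pi]. Its image under t -> r cos t is the arcsine law of radius r, so
  no density with endpoint singularities is needed.\<close>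

definition angle_measure :: "real measure" where
  "angle_measure = density lborel (\<lambda>t. ennreal (indicator {0..pi} t / pi))"

lemma sets_angle_measure [simp, measurable_cong]: "sets angle_measure = sets borel"
  and space_angle_measure [simp]: "space angle_measure = UNIV"
  by (simp_all add: angle_measure_def)

lemma AE_angle_measure: "AE t in angle_measure. t \<in> {0..pi}"
  unfolding angle_measure_def by (subst AE_density) (auto simp: indicator_def)

lemma AE_angle_measure_lborel: "AE t in lborel. P t \<Longrightarrow> AE t in angle_measure. P t"
  unfolding angle_measure_def by (subst AE_density) auto

lemma has_bochner_integral_angle_measure:
  fixes f :: "real \<Rightarrow> real"
  assumes "continuous_on UNIV f"
  shows "has_bochner_integral angle_measure f (integral {0..pi} f / pi)"
proof -
  have [measurable]: "f \<in> borel_measurable borel" by (rule borel_measurable_continuous_onI[OF assms])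
  have s: "set_integrable lborel {0..pi} f"
    by (rule borel_integrable_atLeastAtMost') (rule continuous_on_subset[OF assms subset_UNIV])
  then have "integrable lborel (\<lambda>t. indicator {0..pi} t *\<^sub>R f t)" by (simp add: set_integrable_def)
  then have i: "integrable lborel (\<lambda>t. (indicator {0..pi} t / pi) *\<^sub>R f t)"
    by (auto intro!: Bochner_Integration.integrable_divide)
  have "(\<integral>t. (indicator {0..pi} t / pi) *\<^sub>R f t \<partial>lborel) = (\<integral>t. (indicator {0..pi} t *\<^sub>R f t) / pi \<partial>lborel)"
    by (simp add: field_simps)
  also have "\<dots> = (\<integral>t. indicator {0..pi} t *\<^sub>R f t \<partial>lborel) / pi" by (rule Bochner_Integration.integral_divide_zero)
  also have "(\<integral>t. indicator {0..pi} t *\<^sub>R f t \<partial>lborel) = integral {0..pi} f"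
    using set_borel_integral_eq_integral(2)[OF s] by (simp add: set_lebesgue_integral_def)
  finally have e: "(\<integral>t. (indicator {0..pi} t / pi) *\<^sub>R f t \<partial>lborel) = integral {0..pi} f / pi" .
  show ?thesis unfolding angle_measure_def
    by (rule has_bochner_integral_density) (use i e in \<open>auto simp: has_bochner_integral_iff\<close>)
qed

lemma prob_space_angle_measure: "prob_space angle_measure"
proof
  have "(\<integral>\<^sup>+ t. ennreal 1 \<partial>angle_measure) = ennreal (integral {0..pi} (\<lambda>_. 1) / pi)"
    using has_bochner_integral_angle_measure[of "\<lambda>_. 1"] by (intro nn_integral_has_bochner_integral) auto
  then show "emeasure angle_measure (space angle_measure) = 1" by simp
qed

text \<open>Every damped kernel averages to 0 in t, having no term of order 0. Adding ln 4 +
  \<open>\<epsilon> m\<close> makes it nonnegative, and Fatou's lemma carries the mean over to the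
  limit - ln (2 |x - cos t|) + ln 4. An upper bound on the potential is all that trial measures
  require.\<close>

lemma arcsine_potential:
  assumes x: "\<bar>x\<bar> \<le> 1"
  shows "integrable angle_measure (\<lambda>t. - ln (\<bar>x - cos t\<bar> / 2))"
    and "(\<integral>t. - ln (\<bar>x - cos t\<bar> / 2) \<partial>angle_measure) \<le> ln 4"
    and "AE t in angle_measure. x \<noteq> cos t"
proof -
  interpret prob_space angle_measure by (rule prob_space_angle_measure)
  define a where "a = arccos x"
  have xa: "x = cos a" using x by (simp add: a_def cos_arccos_abs)
  obtain s N \<epsilon> where tk: "\<And>m::nat. 0 < s m" "\<And>m. s m < (1::real)" "s \<longlonglongrightarrow> 1" "\<epsilon> \<longlonglongrightarrow> (0::real)" "\<And>m. m \<le> N m"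
    "\<And>m b. - ln 4 - \<epsilon> m \<le> trig_kernel (s m) (N m) a b"
    "\<And>b. cos a \<noteq> cos b \<Longrightarrow> (\<lambda>m. trig_kernel (s m) (N m) a b) \<longlonglongrightarrow> - ln (2 * \<bar>cos a - cos b\<bar>)"
    by (rule trig_kernel_limit) blast
  define u where "u = (\<lambda>m t. trig_kernel (s m) (N m) a t + ln 4 + \<epsilon> m)"
  have u0: "0 \<le> u m t" for m t using tk(6)[of m t] by (simp add: u_def)
  have [measurable]: "u m \<in> borel_measurable borel" for m
    unfolding u_def trig_kernel_def by measurable
  have ui: "has_bochner_integral angle_measure (u m) (ln 4 + \<epsilon> m)" for m
  proof -
    have "((\<lambda>t. (\<Sum>n=1..N m. 2 * s m ^ n / real n * (cos (real n * a) * cos (real n * t))) + (ln 4 + \<epsilon> m))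
       has_integral ((\<Sum>n=1..N m. 2 * s m ^ n / real n * (cos (real n * a) * (if n = 0 then pi else 0))) + pi * (ln 4 + \<epsilon> m))) {0..pi}"
      using has_integral_const_real[of "ln 4 + \<epsilon> m" 0 pi]
      by (intro has_integral_add has_integral_sum has_integral_mult_right has_integral_cos_multiple) auto
    then have "integral {0..pi} (u m) = pi * (ln 4 + \<epsilon> m)"
      by (subst (asm) sum.neutral) (auto simp: u_def[abs_def] trig_kernel_def add.assoc dest: integral_unique)
    moreover have "continuous_on UNIV (u m)"
      unfolding u_def trig_kernel_def by (intro continuous_intros)
    ultimately show ?thesis using has_bochner_integral_angle_measure[of "u m"] by simp
  qed
  \<comment> \<open>On [0, pi] the cosine takes the value x only at t = a.\<close>
  have "AE t in lborel. t \<noteq> a" by (rule AE_lborel_singleton)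
  then have "AE t in angle_measure. t \<noteq> a" by (rule AE_angle_measure_lborel)
  with AE_angle_measure show ne: "AE t in angle_measure. x \<noteq> cos t"
  proof eventually_elim
    case (elim t)
    then show ?case unfolding a_def by (auto simp: arccos_cos)
  qed
  have L0: "0 \<le> - ln (\<bar>x - cos t\<bar> / 2)" for t
  proof (cases "x = cos t")
    case False
    have "\<bar>x - cos t\<bar> \<le> 2" using x abs_cos_le_one[of t] by linarith
    with False have "ln (\<bar>x - cos t\<bar> / 2) \<le> 0" by (subst ln_le_zero_iff) auto
    then show ?thesis by simp
  qed simp
  have "(\<integral>\<^sup>+t. ennreal (- ln (\<bar>x - cos t\<bar> / 2)) \<partial>angle_measure)
      = (\<integral>\<^sup>+t. liminf (\<lambda>m. ennreal (u m t)) \<partial>angle_measure)"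
  proof (rule nn_integral_cong_AE, use ne in eventually_elim)
    case (elim t)
    have "(\<lambda>m. u m t) \<longlonglongrightarrow> - ln (2 * \<bar>cos a - cos t\<bar>) + ln 4 + 0"
      unfolding u_def using elim xa by (intro tendsto_intros tk) auto
    also have "- ln (2 * \<bar>cos a - cos t\<bar>) + ln 4 + 0 = - ln (\<bar>x - cos t\<bar> / 2)"
      using elim ln_mult_pos[of 4 "\<bar>x - cos t\<bar> / 2"] by (simp add: xa)
    finally have "(\<lambda>m. ennreal (u m t)) \<longlonglongrightarrow> ennreal (- ln (\<bar>x - cos t\<bar> / 2))"
      by (rule tendsto_ennrealI)
    then show ?case by (simp add: lim_imp_Liminf)
  qed
  also have "\<dots> \<le> liminf (\<lambda>m. \<integral>\<^sup>+t. ennreal (u m t) \<partial>angle_measure)"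
    by (rule nn_integral_liminf) measurable
  also have "(\<lambda>m. \<integral>\<^sup>+t. ennreal (u m t) \<partial>angle_measure) = (\<lambda>m. ennreal (ln 4 + \<epsilon> m))"
    using ui u0 by (intro ext nn_integral_has_bochner_integral) auto
  also have "liminf (\<lambda>m. ennreal (ln 4 + \<epsilon> m)) = ennreal (ln 4 + 0)"
    by (intro lim_imp_Liminf tendsto_ennrealI tendsto_intros tk) auto
  finally have le: "(\<integral>\<^sup>+t. ennreal (- ln (\<bar>x - cos t\<bar> / 2)) \<partial>angle_measure) \<le> ennreal (ln 4)" by simp
  show int: "integrable angle_measure (\<lambda>t. - ln (\<bar>x - cos t\<bar> / 2))"
    by (rule integrableI_nonneg) (use L0 le in \<open>auto simp: le_less_trans\<close>)
  show "(\<integral>t. - ln (\<bar>x - cos t\<bar> / 2) \<partial>angle_measure) \<le> ln 4"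
    using le nn_integral_eq_integral[OF int] L0 by (simp add: ennreal_le_iff)
qed

context even_convex_potential
begin

lemma W_bochner: "has_bochner_integral angle_measure (\<lambda>t. V (r * cos t)) (W r)"
  unfolding W_def by (rule has_bochner_integral_angle_measure) (intro continuous_intros)

text \<open>Inside its support the potential of the arcsine law of radius b is at most - ln (2b) +
  ln 4 = ln (2/b), whatever the position of y. The nonnegativity is recorded for later arithmetic in
  \<open>ennreal\<close>.\<close>

lemma arcsine_inner:
  assumes b: "0 < b" and y: "\<bar>y\<bar> \<le> b"
  shows "0 \<le> B + ln (2 / b) / 2 + V y / 2 + W b / 2"
    and "(\<integral>\<^sup>+t. shifted_kernel V B y (b * cos t) \<partial>angle_measure) \<le> ennreal (B + ln (2 / b) / 2 + V y / 2 + W b / 2)"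
proof -
  interpret prob_space angle_measure by (rule prob_space_angle_measure)
  define L where "L = (\<lambda>t. - ln (\<bar>y / b - cos t\<bar> / 2))"
  \<comment> \<open>What is left of the kernel after ln |y - b cos t| = ln (2b) + ln (|y/b - cos t|
    / 2).\<close>
  define q where "q = (\<lambda>t. B - ln (2 * b) / 2 + (V y + V (b * cos t)) / 2)"
  have yb: "\<bar>y / b\<bar> \<le> 1" using b y by simp
  have L: "integrable angle_measure L" "(\<integral>t. L t \<partial>angle_measure) \<le> ln 4"
    unfolding L_def by (rule arcsine_potential[OF yb])+
  have q: "has_bochner_integral angle_measure q (B - ln (2 * b) / 2 + (V y + W b) / 2)"
    unfolding q_def using W_bochner[of b]
    by (auto simp: has_bochner_integral_iff prob_space[simplified])
  have i: "integrable angle_measure (\<lambda>t. L t / 2 + q t)" using L q by (auto simp: has_bochner_integral_iff)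
  have "(\<integral>t. L t / 2 + q t \<partial>angle_measure) = (\<integral>t. L t \<partial>angle_measure) / 2 + (B - ln (2 * b) / 2 + (V y + W b) / 2)"
    using L q by (simp add: has_bochner_integral_iff)
  also have "\<dots> \<le> ln 4 / 2 + (B - ln (2 * b) / 2 + (V y + W b) / 2)" using L(2) by simp
  also have "\<dots> = B + ln (2 / b) / 2 + V y / 2 + W b / 2"
  proof -
    have "ln 4 = 2 * ln (2::real)" using ln_realpow[of 2 2] by simp
    then show ?thesis using b by (simp add: ln_div ln_mult_pos field_simps)
  qed
  finally have le: "(\<integral>t. L t / 2 + q t \<partial>angle_measure) \<le> B + ln (2 / b) / 2 + V y / 2 + W b / 2" .
  have ae: "AE t in angle_measure. shifted_kernel V B y (b * cos t) = ennreal (L t / 2 + q t) \<and> 0 \<le> L t / 2 + q t"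
    using arcsine_potential(3)[OF yb]
  proof eventually_elim
    case (elim t)
    then have ne: "y \<noteq> b * cos t" using b by (auto simp: field_simps)
    have "\<bar>y - b * cos t\<bar> = (2 * b) * (\<bar>y / b - cos t\<bar> / 2)"
      using b by (simp add: abs_mult[symmetric, of b, simplified] field_simps abs_if split: if_splits)
    then have "ln \<bar>y - b * cos t\<bar> = ln (2 * b) + ln (\<bar>y / b - cos t\<bar> / 2)"
      by (simp only:) (rule ln_mult_pos, use elim b in auto)
    then have "L t / 2 + q t = B + (- ln \<bar>y - b * cos t\<bar> / 2 + (V y + V (b * cos t)) / 2)"
      unfolding L_def q_def by (simp add: field_simps)
    then show ?case using ne B_kernel[OF ne] by (simp add: shifted_kernel_def)
  qed
  have "0 \<le> (\<integral>t. L t / 2 + q t \<partial>angle_measure)"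
    by (rule integral_nonneg_AE) (rule eventually_mono[OF ae], simp)
  with le show "0 \<le> B + ln (2 / b) / 2 + V y / 2 + W b / 2" by linarith
  have "(\<integral>\<^sup>+t. shifted_kernel V B y (b * cos t) \<partial>angle_measure) = (\<integral>\<^sup>+t. ennreal (L t / 2 + q t) \<partial>angle_measure)"
    by (rule nn_integral_cong_AE) (rule eventually_mono[OF ae], simp)
  also have "\<dots> = ennreal (\<integral>t. L t / 2 + q t \<partial>angle_measure)"
    by (rule nn_integral_eq_integral[OF i]) (rule eventually_mono[OF ae], simp)
  also have "\<dots> \<le> ennreal (B + ln (2 / b) / 2 + V y / 2 + W b / 2)" by (rule ennreal_leI[OF le])
  finally show "(\<integral>\<^sup>+t. shifted_kernel V B y (b * cos t) \<partial>angle_measure) \<le> ennreal (B + ln (2 / b) / 2 + V y / 2 + W b / 2)" .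
qed

lemma measurable_shifted_kernel_comp [measurable]:
  assumes [measurable]: "f \<in> borel_measurable M" "h \<in> borel_measurable M"
  shows "(\<lambda>z. shifted_kernel V B (f z) (h z)) \<in> borel_measurable M"
  using measurable_compose[OF _ measurable_shifted_kernel[OF V_measurable], of "\<lambda>z. (f z, h z)" M] by simp

text \<open>The law of radius a lives where the potential of the larger law has the bound of
  \<open>arcsine_inner\<close>, so only the larger radius enters the logarithm.\<close>

lemma arcsine_mutual_le:
  assumes a: "0 < a" "a \<le> b"
  shows "0 \<le> B + ln (2 / b) / 2 + (W a + W b) / 2"
    and "(\<integral>\<^sup>+s. \<integral>\<^sup>+t. shifted_kernel V B (a * cos s) (b * cos t) \<partial>angle_measure \<partial>angle_measure)
      \<le> ennreal (B + ln (2 / b) / 2 + (W a + W b) / 2)"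
proof -
  interpret prob_space angle_measure by (rule prob_space_angle_measure)
  define f where "f = (\<lambda>s. B + ln (2 / b) / 2 + V (a * cos s) / 2 + W b / 2)"
  have y: "\<bar>a * cos s\<bar> \<le> b" for s
    using mult_mono[of a b "\<bar>cos s\<bar>" 1] a by (simp add: abs_mult)
  have b: "0 < b" using a by simp
  have f0: "0 \<le> f s" for s unfolding f_def by (rule arcsine_inner(1)[OF b y])
  have fi: "has_bochner_integral angle_measure f (B + ln (2 / b) / 2 + W a / 2 + W b / 2)"
    unfolding f_def using W_bochner[of a] by (auto simp: has_bochner_integral_iff prob_space[simplified])
  have eq: "B + ln (2 / b) / 2 + W a / 2 + W b / 2 = B + ln (2 / b) / 2 + (W a + W b) / 2" by (simp add: field_simps)
  have "0 \<le> (\<integral>s. f s \<partial>angle_measure)" by (intro integral_nonneg_AE AE_I2 f0)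
  then show "0 \<le> B + ln (2 / b) / 2 + (W a + W b) / 2" using fi eq by (simp add: has_bochner_integral_iff)
  have "(\<integral>\<^sup>+s. \<integral>\<^sup>+t. shifted_kernel V B (a * cos s) (b * cos t) \<partial>angle_measure \<partial>angle_measure)
     \<le> (\<integral>\<^sup>+s. ennreal (f s) \<partial>angle_measure)"
    unfolding f_def by (intro nn_integral_mono arcsine_inner(2) b y)
  also have "\<dots> = ennreal (B + ln (2 / b) / 2 + (W a + W b) / 2)"
    using fi f0 eq by (intro nn_integral_has_bochner_integral) auto
  finally show "(\<integral>\<^sup>+s. \<integral>\<^sup>+t. shifted_kernel V B (a * cos s) (b * cos t) \<partial>angle_measure \<partial>angle_measure)
      \<le> ennreal (B + ln (2 / b) / 2 + (W a + W b) / 2)" .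
qed

lemma arcsine_mutual:
  assumes a: "0 < a" "0 < b"
  shows "0 \<le> B + ln (2 / max a b) / 2 + (W a + W b) / 2"
    and "(\<integral>\<^sup>+s. \<integral>\<^sup>+t. shifted_kernel V B (a * cos s) (b * cos t) \<partial>angle_measure \<partial>angle_measure)
      \<le> ennreal (B + ln (2 / max a b) / 2 + (W a + W b) / 2)"
proof -
  interpret prob_space angle_measure by (rule prob_space_angle_measure)
  interpret P: pair_sigma_finite angle_measure angle_measure ..
  show "0 \<le> B + ln (2 / max a b) / 2 + (W a + W b) / 2"
    using arcsine_mutual_le(1)[of a b] arcsine_mutual_le(1)[of b a] a
    by (cases "a \<le> b") (auto simp: max_def add.commute)
  show "(\<integral>\<^sup>+s. \<integral>\<^sup>+t. shifted_kernel V B (a * cos s) (b * cos t) \<partial>angle_measure \<partial>angle_measure)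
      \<le> ennreal (B + ln (2 / max a b) / 2 + (W a + W b) / 2)"
  proof (cases "a \<le> b")
    case True
    then show ?thesis using arcsine_mutual_le(2)[of a b] a by (simp add: max_def)
  next
    case False
    have "(\<integral>\<^sup>+s. \<integral>\<^sup>+t. shifted_kernel V B (a * cos s) (b * cos t) \<partial>angle_measure \<partial>angle_measure)
       = (\<integral>\<^sup>+t. \<integral>\<^sup>+s. shifted_kernel V B (a * cos s) (b * cos t) \<partial>angle_measure \<partial>angle_measure)"
      by (intro P.Fubini'[symmetric]) measurable
    also have "\<dots> = (\<integral>\<^sup>+t. \<integral>\<^sup>+s. shifted_kernel V B (b * cos t) (a * cos s) \<partial>angle_measure \<partial>angle_measure)"
      by (subst shifted_kernel_commute) simp
    finally show ?thesis using arcsine_mutual_le(2)[of b a] a False by (simp add: max_def add.commute)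
  qed
qed

text \<open>The measure is the law of \<open>r i * cos t\<close> with i drawn with weights
  \<open>\<omega>\<close> and t uniform on [0, pi]. Its energy expands into mutual energies, and
  since the weights sum to 1, \<open>B\<close> factors out.\<close>

lemma arcsine_mixture:
  fixes \<omega> :: "nat \<Rightarrow> real" and r :: "nat \<Rightarrow> real"
  assumes \<omega>: "\<And>i. i \<le> k \<Longrightarrow> 0 \<le> \<omega> i" "(\<Sum>i\<le>k. \<omega> i) = 1"
    and r: "\<And>i. i \<le> k \<Longrightarrow> 0 < r i" "\<And>i. i \<le> k \<Longrightarrow> r i \<le> R"
  shows "\<exists>\<rho>\<in>prob_measures_on R. SE \<rho> \<le> ennreal (B +
    ((\<Sum>i\<le>k. \<Sum>j\<le>k. \<omega> i * \<omega> j * ln (2 / max (r i) (r j))) / 2 + (\<Sum>i\<le>k. \<omega> i * W (r i))))"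
proof -
  interpret A: prob_space angle_measure by (rule prob_space_angle_measure)
  define I where "I = point_measure {..k} (\<lambda>i. ennreal (\<omega> i))"
  have nnI: "(\<integral>\<^sup>+i. f i \<partial>I) = (\<Sum>i\<le>k. ennreal (\<omega> i) * f i)" for f
    unfolding I_def by (rule nn_integral_point_measure_finite) simp
  have sI: "sets I = Pow {..k}" "space I = {..k}" by (simp_all add: I_def sets_point_measure space_point_measure)
  have "prob_space I"
  proof
    have "emeasure I (space I) = (\<integral>\<^sup>+i. 1 \<partial>I)" by simp
    also have "\<dots> = ennreal (\<Sum>i\<le>k. \<omega> i)" unfolding nnI mult_1_right by (rule sum_ennreal) (use \<omega> in auto)
    finally show "emeasure I (space I) = 1" using \<omega>(2) by simp
  qed
  then interpret I: prob_space I .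
  interpret P: pair_prob_space I angle_measure ..
  have rI: "r \<in> borel_measurable I" by (auto simp: measurable_def sI)
  define X where "X = (\<lambda>(i, t). r i * cos t)"
  have X [measurable]: "X \<in> borel_measurable (I \<Otimes>\<^sub>M angle_measure)"
    unfolding X_def split_beta' using rI by measurable
  define \<rho> where "\<rho> = distr (I \<Otimes>\<^sub>M angle_measure) borel X"
  have nn\<rho>: "(\<integral>\<^sup>+x. f x \<partial>\<rho>) = (\<Sum>i\<le>k. ennreal (\<omega> i) * (\<integral>\<^sup>+t. f (r i * cos t) \<partial>angle_measure))"
    if [measurable]: "f \<in> borel_measurable borel" for f :: "real \<Rightarrow> ennreal"
  proof -
    have "(\<integral>\<^sup>+x. f x \<partial>\<rho>) = (\<integral>\<^sup>+z. f (X z) \<partial>(I \<Otimes>\<^sub>M angle_measure))"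
      unfolding \<rho>_def by (rule nn_integral_distr) measurable
    also have "\<dots> = (\<integral>\<^sup>+i. \<integral>\<^sup>+t. f (X (i, t)) \<partial>angle_measure \<partial>I)"
      by (rule A.nn_integral_fst[symmetric]) measurable
    finally show ?thesis by (simp add: nnI X_def)
  qed
  have "prob_space \<rho>" unfolding \<rho>_def by (rule P.prob_space_distr) measurable
  then interpret \<rho>: prob_space \<rho> .
  have sets\<rho> [measurable_cong]: "sets \<rho> = sets borel" by (simp add: \<rho>_def)
  have "emeasure \<rho> {-R..R} = (\<integral>\<^sup>+x. indicator {-R..R} x \<partial>\<rho>)" by (simp add: sets\<rho>)
  also have "\<dots> = (\<Sum>i\<le>k. ennreal (\<omega> i) * (\<integral>\<^sup>+t. indicator {-R..R} (r i * cos t) \<partial>angle_measure))"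
    by (rule nn\<rho>) measurable
  also have "\<dots> = (\<Sum>i\<le>k. ennreal (\<omega> i) * (\<integral>\<^sup>+t. 1 \<partial>angle_measure))"
  proof (intro sum.cong refl arg_cong2[where f = "(*)"] nn_integral_cong)
    fix i t assume "i \<in> {..k}"
    then have "\<bar>r i * cos t\<bar> \<le> R"
      using mult_mono[of "r i" R "\<bar>cos t\<bar>" 1] r[of i] by (simp add: abs_mult)
    then show "indicator {-R..R} (r i * cos t) = (1::ennreal)" by (auto simp: abs_le_iff)
  qed
  also have "\<dots> = ennreal (\<Sum>i\<le>k. \<omega> i)" using A.emeasure_space_1 by (simp, intro sum_ennreal) (use \<omega>(1) in auto)
  finally have "emeasure \<rho> {-R..R} = 1" using \<omega>(2) by simp
  then have \<rho>P: "\<rho> \<in> prob_measures_on R"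
    using sets\<rho> \<rho>.prob_space_axioms by (simp add: prob_measures_on_def prob_measures_R_def)
  \<comment> \<open>Needed to move \<open>ennreal\<close> past the finite sums.\<close>
  have t0: "0 \<le> \<omega> i * (\<omega> j * (B + ln (2 / max (r i) (r j)) / 2 + (W (r i) + W (r j)) / 2))" if "i \<le> k" "j \<le> k" for i j
    using that by (intro mult_nonneg_nonneg \<omega> arcsine_mutual(1) r)
  have "SE \<rho> = (\<Sum>i\<le>k. ennreal (\<omega> i) * (\<integral>\<^sup>+s. \<integral>\<^sup>+y. shifted_kernel V B (r i * cos s) y \<partial>\<rho> \<partial>angle_measure))"
    unfolding SE_def shifted_energy_def by (rule nn\<rho>) measurable
  also have "\<dots> = (\<Sum>i\<le>k. ennreal (\<omega> i) * (\<integral>\<^sup>+s. (\<Sum>j\<le>k. ennreal (\<omega> j) *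
      (\<integral>\<^sup>+t. shifted_kernel V B (r i * cos s) (r j * cos t) \<partial>angle_measure)) \<partial>angle_measure))"
    by (intro sum.cong refl arg_cong2[where f = "(*)"] nn_integral_cong nn\<rho>) measurable
  also have "\<dots> = (\<Sum>i\<le>k. \<Sum>j\<le>k. ennreal (\<omega> i) * (ennreal (\<omega> j) *
      (\<integral>\<^sup>+s. \<integral>\<^sup>+t. shifted_kernel V B (r i * cos s) (r j * cos t) \<partial>angle_measure \<partial>angle_measure)))"
    by (simp add: nn_integral_sum nn_integral_cmult sum_distrib_left)
  also have "\<dots> \<le> (\<Sum>i\<le>k. \<Sum>j\<le>k. ennreal (\<omega> i) * (ennreal (\<omega> j) * ennreal (B + ln (2 / max (r i) (r j)) / 2 + (W (r i) + W (r j)) / 2)))"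
    by (intro sum_mono mult_left_mono arcsine_mutual(2) r) auto
  also have "\<dots> = (\<Sum>i\<le>k. \<Sum>j\<le>k. ennreal (\<omega> i * (\<omega> j * (B + ln (2 / max (r i) (r j)) / 2 + (W (r i) + W (r j)) / 2))))"
    using \<omega>(1) r(1) arcsine_mutual(1) by (intro sum.cong refl) (simp add: ennreal_mult'')
  also have "\<dots> = (\<Sum>i\<le>k. ennreal (\<Sum>j\<le>k. \<omega> i * (\<omega> j * (B + ln (2 / max (r i) (r j)) / 2 + (W (r i) + W (r j)) / 2))))"
    by (intro sum.cong refl sum_ennreal t0) auto
  also have "\<dots> = ennreal (\<Sum>i\<le>k. \<Sum>j\<le>k. \<omega> i * (\<omega> j * (B + ln (2 / max (r i) (r j)) / 2 + (W (r i) + W (r j)) / 2)))"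
    by (intro sum_ennreal sum_nonneg t0) auto
  also have "(\<Sum>i\<le>k. \<Sum>j\<le>k. \<omega> i * (\<omega> j * (B + ln (2 / max (r i) (r j)) / 2 + (W (r i) + W (r j)) / 2)))
     = (\<Sum>i\<le>k. \<Sum>j\<le>k. \<omega> i * \<omega> j * ln (2 / max (r i) (r j)) / 2 + (B * \<omega> i * \<omega> j + \<omega> i * W (r i) * \<omega> j / 2 + \<omega> i * (\<omega> j * W (r j)) / 2))"
    by (intro sum.cong refl) (simp add: algebra_simps add_divide_distrib)
  also have "\<dots> = (\<Sum>i\<le>k. \<Sum>j\<le>k. \<omega> i * \<omega> j * ln (2 / max (r i) (r j))) / 2 +
      ((\<Sum>i\<le>k. \<Sum>j\<le>k. B * \<omega> i * \<omega> j) + (\<Sum>i\<le>k. \<Sum>j\<le>k. \<omega> i * W (r i) * \<omega> j) / 2 + (\<Sum>i\<le>k. \<Sum>j\<le>k. \<omega> i * (\<omega> j * W (r j))) / 2)"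
    by (simp only: sum.distrib sum_divide_distrib)
  also have "\<dots> = B + ((\<Sum>i\<le>k. \<Sum>j\<le>k. \<omega> i * \<omega> j * ln (2 / max (r i) (r j))) / 2 + (\<Sum>i\<le>k. \<omega> i * W (r i)))"
    by (simp only: sum_distrib_left[symmetric] sum_distrib_right[symmetric] \<omega>(2))
  finally show ?thesis using \<rho>P by blast
qed

end

text \<open>Summation by parts with cumulative weights S: the pairs with max (i, j) = n carry total
  weight (S n)^2 - (S (n-1))^2, so the differences pass to L and Wr. With S = g this is the discrete
  form of the integral in \<open>E\<close>.\<close>

lemma abel_mixture:
  fixes S L Wr :: "nat \<Rightarrow> real"
  defines "\<omega> \<equiv> (\<lambda>j. S j - (if j = 0 then 0 else S (j - 1)))"
  shows "(\<Sum>i\<le>n. \<Sum>j\<le>n. \<omega> i * \<omega> j * L (max i j)) / 2 + (\<Sum>i\<le>n. \<omega> i * Wr i)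
    = (S n)\<^sup>2 * L n / 2 + S n * Wr n
      - (\<Sum>j<n. S j * (Wr (Suc j) - Wr j) - (S j)\<^sup>2 * (L j - L (Suc j)) / 2)"
    and "(\<Sum>i\<le>n. \<omega> i) = S n"
proof -
  have sum: "(\<Sum>i\<le>n. \<omega> i) = S n" for n by (induction n) (auto simp: \<omega>_def)
  then show "(\<Sum>i\<le>n. \<omega> i) = S n" .
  show "(\<Sum>i\<le>n. \<Sum>j\<le>n. \<omega> i * \<omega> j * L (max i j)) / 2 + (\<Sum>i\<le>n. \<omega> i * Wr i)
    = (S n)\<^sup>2 * L n / 2 + S n * Wr n
      - (\<Sum>j<n. S j * (Wr (Suc j) - Wr j) - (S j)\<^sup>2 * (L j - L (Suc j)) / 2)"
  proof (induction n)
    case 0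
    show ?case by (simp add: \<omega>_def power2_eq_square)
  next
    case (Suc n)
    have "(\<Sum>i\<le>Suc n. \<Sum>j\<le>Suc n. \<omega> i * \<omega> j * L (max i j))
       = (\<Sum>i\<le>n. \<Sum>j\<le>n. \<omega> i * \<omega> j * L (max i j)) + (\<Sum>i\<le>n. \<omega> i * \<omega> (Suc n) * L (Suc n))
        + ((\<Sum>j\<le>n. \<omega> (Suc n) * \<omega> j * L (Suc n)) + \<omega> (Suc n) * \<omega> (Suc n) * L (Suc n))"
      by (simp add: sum.distrib max_def)
    also have "(\<Sum>i\<le>n. \<omega> i * \<omega> (Suc n) * L (Suc n)) = S n * \<omega> (Suc n) * L (Suc n)"
      by (simp add: sum_distrib_right[symmetric] sum)
    also have "(\<Sum>j\<le>n. \<omega> (Suc n) * \<omega> j * L (Suc n)) = \<omega> (Suc n) * S n * L (Suc n)"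
      by (simp add: sum_distrib_right[symmetric] sum_distrib_left[symmetric] sum)
    finally have A: "(\<Sum>i\<le>Suc n. \<Sum>j\<le>Suc n. \<omega> i * \<omega> j * L (max i j))
      = (\<Sum>i\<le>n. \<Sum>j\<le>n. \<omega> i * \<omega> j * L (max i j)) + S n * \<omega> (Suc n) * L (Suc n)
        + (\<omega> (Suc n) * S n * L (Suc n) + \<omega> (Suc n) * \<omega> (Suc n) * L (Suc n))" .
    have "(\<Sum>i\<le>Suc n. \<Sum>j\<le>Suc n. \<omega> i * \<omega> j * L (max i j)) / 2 + (\<Sum>i\<le>Suc n. \<omega> i * Wr i)
      = ((\<Sum>i\<le>n. \<Sum>j\<le>n. \<omega> i * \<omega> j * L (max i j)) / 2 + (\<Sum>i\<le>n. \<omega> i * Wr i))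
        + (S n * \<omega> (Suc n) * L (Suc n) + (\<omega> (Suc n))\<^sup>2 * L (Suc n) / 2 + \<omega> (Suc n) * Wr (Suc n))"
      unfolding A sum.atMost_Suc[of "\<lambda>i. \<omega> i * Wr i"] by (simp add: power2_eq_square add_divide_distrib)
    also have "\<omega> (Suc n) = S (Suc n) - S n" by (simp add: \<omega>_def)
    finally show ?case unfolding Suc.IH by (simp add: power2_eq_square field_simps)
  qed
qed

context even_convex_potential
begin

section \<open>Mixtures with nearly minimal energy\<close>

lemma w_mono: assumes "0 \<le> s" "s \<le> t" shows "w s \<le> w t"
  by (rule DERIV_nonneg_imp_nondecreasing[OF assms(2)]) (use w_deriv w'_nonneg in blast)

lemma g_mono: assumes "0 < s" "s \<le> t" shows "g s \<le> g t"
  using g_strict_mono[of s t] assms by (cases "s = t") auto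

text \<open>In the logarithmic radius u the derivative of W (r e^u) is g (r e^u), which is
  nondecreasing, so the mean value theorem suffices.\<close>

lemma W_increment_ge:
  assumes "0 < r" "0 < d"
  shows "g r * d \<le> W (r * exp d) - W r"
proof -
  have "((\<lambda>u. W (r * exp u)) has_real_derivative g (r * exp u)) (at u)" for u
    by (rule DERIV_cong, rule DERIV_chain2[OF W_deriv])
       (auto intro!: derivative_eq_intros simp: g_def)
  from MVT2[OF assms(2), of "\<lambda>u. W (r * exp u)" "\<lambda>u. g (r * exp u)"] this
  obtain z where z: "0 < z" "z < d" "W (r * exp d) - W (r * exp 0) = (d - 0) * g (r * exp z)" by auto
  have "g r \<le> g (r * exp z)" using assms z by (intro g_mono) auto
  with z assms show ?thesis by (simp add: mult.commute)
qed

text \<open>The integrand is g^2 / s; g is bounded by its value at the right end, and ds/s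
  integrates to d.\<close>

lemma integral_sw2_increment_le:
  assumes "0 < r" "0 < d"
  shows "integral {r..r * exp d} (\<lambda>s. s * (w s)\<^sup>2) \<le> (g (r * exp d))\<^sup>2 * d"
proof -
  have le: "r \<le> r * exp d" using assms by simp
  have "((\<lambda>s. (g (r * exp d))\<^sup>2 * (1 / s)) has_integral (g (r * exp d))\<^sup>2 * (ln (r * exp d) - ln r)) {r..r * exp d}"
    by (intro has_integral_mult_right fundamental_theorem_of_calculus le)
       (use assms in \<open>auto simp flip: has_real_derivative_iff_has_vector_derivative intro!: derivative_eq_intros\<close>)
  also have "ln (r * exp d) - ln r = d" using assms by (simp add: ln_mult_pos)
  finally have 1: "((\<lambda>s. (g (r * exp d))\<^sup>2 * (1 / s)) has_integral (g (r * exp d))\<^sup>2 * d) {r..r * exp d}" .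
  have 2: "((\<lambda>s. s * (w s)\<^sup>2) has_integral integral {r..r * exp d} (\<lambda>s. s * (w s)\<^sup>2)) {r..r * exp d}"
    by (intro integrable_integral integrable_continuous_interval continuous_intros w_cont)
  show ?thesis
  proof (rule has_integral_le[OF 2 1])
    fix s assume s: "s \<in> {r..r * exp d}"
    then have s0: "0 < s" using assms by auto
    have "(g s)\<^sup>2 \<le> (g (r * exp d))\<^sup>2"
      using s s0 g_pos[OF s0] by (intro power_mono g_mono) auto
    then have "(g s)\<^sup>2 / s \<le> (g (r * exp d))\<^sup>2 / s" using s0 by (intro divide_right_mono) auto
    moreover have "(g s)\<^sup>2 / s = s * (w s)\<^sup>2" using s0 by (simp add: g_def power2_eq_square)
    ultimately show "s * (w s)\<^sup>2 \<le> (g (r * exp d))\<^sup>2 * (1 / s)" by simp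
  qed
qed

text \<open>Geometrically spaced radii make \<open>L j - L (Suc j)\<close> constant, so the discretisation error telescopes.\<close>

lemma near_minimiser:
  assumes R: "0 < R" and gR: "g R \<le> 1" and e: "0 < e"
  shows "\<exists>\<rho>\<in>prob_measures_on R. SE \<rho> \<le> ennreal (E R + e + B)"
proof -
  have int: "(\<lambda>s. s * (w s)\<^sup>2) integrable_on {a..b}" for a b
    by (intro integrable_continuous_interval continuous_intros w_cont)
  \<comment> \<open>Bounds the integrand s w^2 on [0, R]. The number k of steps is then chosen so
    that the interval [0, \<open>r 0\<close>], which the grid misses, contributes less than
    e.\<close>
  define K where "K = R * (w R)\<^sup>2"
  have K0: "0 \<le> K" using R by (simp add: K_def)
  have "(\<lambda>k. K * (R * exp (- e) ^ k)) \<longlonglongrightarrow> K * (R * 0)"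
    using e by (intro tendsto_intros LIMSEQ_realpow_zero) auto
  then have "\<forall>\<^sub>F k in sequentially. K * (R * exp (- e) ^ k) < e"
    using e by (intro order_tendstoD) auto
  then obtain k where k: "K * (R * exp (- e) ^ k) < e" by (auto simp: eventually_sequentially)
  define r where "r = (\<lambda>j. R * exp (- (real k - real j) * e))"
  have r0: "0 < r j" for j using R by (simp add: r_def)
  have rSuc: "r (Suc j) = r j * exp e" for j
    by (simp add: r_def mult.assoc algebra_simps flip: exp_add)
  have rk: "r k = R" by (simp add: r_def)
  have r_mono: "r i \<le> r j" if "i \<le> j" for i j
    using that e R by (simp add: r_def mult_right_mono)
  have r0': "r 0 = R * exp (- e) ^ k"
    by (simp add: r_def exp_of_nat_mult[symmetric])
  \<comment> \<open>Cumulative weights follow g and jump to 1 at the last radius, which places the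
    remaining mass on the outermost arcsine law.\<close>
  define S where "S = (\<lambda>j. if j < k then g (r j) else 1)"
  define \<omega> where "\<omega> = (\<lambda>j. S j - (if j = 0 then 0 else S (j - 1)))"
  define L where "L = (\<lambda>j. ln (2 / r j))"
  have \<omega>0: "0 \<le> \<omega> i" if "i \<le> k" for i
  proof -
    have "g (r j) \<le> 1" if "j \<le> k" for j
      using g_mono[OF r0 r_mono[OF that]] gR rk by simp
    then show ?thesis
      using that g_pos[OF r0, of i] g_mono[OF r0 r_mono, of "i - 1" i] unfolding \<omega>_def S_def by auto
  qed
  have \<omega>1: "(\<Sum>i\<le>k. \<omega> i) = 1"
    using abel_mixture(2)[of S k] by (simp add: \<omega>_def S_def)
  have Lmax: "ln (2 / max (r i) (r j)) = L (max i j)" for i j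
    using r_mono[of i j] r_mono[of j i] by (cases "i \<le> j") (auto simp: L_def max_def)
  have Ld: "L j - L (Suc j) = e" for j
    unfolding L_def rSuc using r0[of j] by (simp add: ln_div ln_mult_pos)
  have "(\<Sum>i\<le>k. \<Sum>j\<le>k. \<omega> i * \<omega> j * L (max i j)) / 2 + (\<Sum>i\<le>k. \<omega> i * W (r i))
    = (S k)\<^sup>2 * L k / 2 + S k * W (r k) - (\<Sum>j<k. S j * (W (r (Suc j)) - W (r j)) - (S j)\<^sup>2 * (L j - L (Suc j)) / 2)"
    unfolding \<omega>_def by (rule abel_mixture(1)[where Wr = "\<lambda>j. W (r j)"])
  also have "(S k)\<^sup>2 * L k / 2 + S k * W (r k) = ln (2 / R) / 2 + W R"
    by (simp add: S_def L_def rk)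
  also have "ln (2 / R) / 2 + W R - (\<Sum>j<k. S j * (W (r (Suc j)) - W (r j)) - (S j)\<^sup>2 * (L j - L (Suc j)) / 2)
      \<le> ln (2 / R) / 2 + W R - (\<Sum>j<k. (g (r j))\<^sup>2 * e / 2)"
  \<comment> \<open>By \<open>W_increment_ge\<close> each summand is at least g^2 e - g^2 e / 2 =
    g^2 e / 2.\<close>
  proof (intro diff_left_mono sum_mono)
    fix j assume "j \<in> {..<k}"
    then have Sj: "S j = g (r j)" by (simp add: S_def)
    have "g (r j) * (g (r j) * e) \<le> g (r j) * (W (r (Suc j)) - W (r j))"
      unfolding rSuc using g_pos[OF r0, of j] by (intro mult_left_mono W_increment_ge r0 e) auto
    then show "(g (r j))\<^sup>2 * e / 2 \<le> S j * (W (r (Suc j)) - W (r j)) - (S j)\<^sup>2 * (L j - L (Suc j)) / 2"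
      unfolding Sj Ld power2_eq_square mult.assoc by linarith
  qed
  also have "\<dots> \<le> E R + e"
  proof -
    \<comment> \<open>Right-end sums bound the integral; replacing them by left-end sums costs only
      the first and last terms. Together with the piece near 0 the integral exceeds the sum by at
      most 2 e, and the factor 1/2 in \<open>E\<close> turns this into e.\<close>
    have "integral {r 0..r n} (\<lambda>s. s * (w s)\<^sup>2) \<le> (\<Sum>j<n. (g (r j))\<^sup>2 * e) + (g (r n))\<^sup>2 * e - (g (r 0))\<^sup>2 * e" for n
    proof (induction n)
      case (Suc n)
      have "integral {r 0..r (Suc n)} (\<lambda>s. s * (w s)\<^sup>2) = integral {r 0..r n} (\<lambda>s. s * (w s)\<^sup>2) + integral {r n..r (Suc n)} (\<lambda>s. s * (w s)\<^sup>2)"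
        by (intro Henstock_Kurzweil_Integration.integral_combine[symmetric] int r_mono) auto
      also have "\<dots> \<le> ((\<Sum>j<n. (g (r j))\<^sup>2 * e) + (g (r n))\<^sup>2 * e - (g (r 0))\<^sup>2 * e) + (g (r (Suc n)))\<^sup>2 * e"
        unfolding rSuc by (intro add_mono Suc.IH integral_sw2_increment_le r0 e)
      finally show ?case by simp
    qed simp
    from this[of k] have 1: "integral {r 0..R} (\<lambda>s. s * (w s)\<^sup>2) \<le> (\<Sum>j<k. (g (r j))\<^sup>2 * e) + (g R)\<^sup>2 * e - (g (r 0))\<^sup>2 * e"
      by (simp add: rk)
    have "(g R)\<^sup>2 * e \<le> 1 * e"
      using gR g_pos[OF R] e by (intro mult_right_mono) (auto simp: power_le_one)
    moreover have "0 \<le> (g (r 0))\<^sup>2 * e" using e by simp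
    moreover have "integral {0..r 0} (\<lambda>s. s * (w s)\<^sup>2) \<le> integral {0..r 0} (\<lambda>_. K)"
    proof (rule integral_le[OF int])
      fix s assume "s \<in> {0..r 0}"
      then have s: "0 \<le> s" "s \<le> R" using r_mono[of 0 k] rk by auto
      have "w 0 = 0" by (simp add: w_def V1_odd[of 0, simplified])
      then have "0 \<le> w s" using w_mono[of 0 s] s by simp
      then show "s * (w s)\<^sup>2 \<le> K" unfolding K_def using s by (intro mult_mono power_mono w_mono) auto
    qed auto
    moreover have "integral {0..r 0} (\<lambda>_. K) \<le> e"
      using k r0[of 0] by (simp add: r0' mult.commute)
    moreover have "integral {0..R} (\<lambda>s. s * (w s)\<^sup>2) = integral {0..r 0} (\<lambda>s. s * (w s)\<^sup>2) + integral {r 0..R} (\<lambda>s. s * (w s)\<^sup>2)"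
      using r_mono[of 0 k] r0[of 0] rk by (intro Henstock_Kurzweil_Integration.integral_combine[symmetric] int) auto
    ultimately have "integral {0..R} (\<lambda>s. s * (w s)\<^sup>2) \<le> (\<Sum>j<k. (g (r j))\<^sup>2 * e) + 2 * e"
      using 1 by linarith
    then show ?thesis unfolding E_def sum_divide_distrib[symmetric] by argo
  qed
  finally have le: "(\<Sum>i\<le>k. \<Sum>j\<le>k. \<omega> i * \<omega> j * L (max i j)) / 2 + (\<Sum>i\<le>k. \<omega> i * W (r i)) \<le> E R + e" .
  obtain \<rho> where \<rho>: "\<rho> \<in> prob_measures_on R" "SE \<rho> \<le> ennreal (B +
      ((\<Sum>i\<le>k. \<Sum>j\<le>k. \<omega> i * \<omega> j * ln (2 / max (r i) (r j))) / 2 + (\<Sum>i\<le>k. \<omega> i * W (r i))))"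
  proof -
    have "r i \<le> R" if "i \<le> k" for i using r_mono[OF that] rk by simp
    from arcsine_mixture[of k \<omega> r R, OF \<omega>0 \<omega>1 r0 this] that show ?thesis by blast
  qed
  note \<rho>(2)
  also have "ennreal (B + ((\<Sum>i\<le>k. \<Sum>j\<le>k. \<omega> i * \<omega> j * ln (2 / max (r i) (r j))) / 2 + (\<Sum>i\<le>k. \<omega> i * W (r i)))) \<le> ennreal (E R + e + B)"
    unfolding Lmax using le by (intro ennreal_leI) simp
  finally show ?thesis using \<rho>(1) by blast
qed

end

section \<open>Displacement convexity\<close>

context even_convex_potential
begin

lemma SE_ge_1:
  assumes "\<rho> \<in> prob_measures_R"
  shows "1 \<le> SE \<rho>"
proof -
  interpret prob_space \<rho> using assms by (simp add: prob_measures_R_def)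
  have le: "1 \<le> shifted_kernel V B x y" for x y
    using ennreal_leI[OF B_kernel_ge_1[of x y]] by (simp add: shifted_kernel_def)
  have "1 = (\<integral>\<^sup>+x. \<integral>\<^sup>+y. 1 \<partial>\<rho> \<partial>\<rho>)" by (simp add: emeasure_space_1)
  also have "\<dots> \<le> SE \<rho>"
    unfolding SE_def shifted_energy_def by (intro nn_integral_mono le)
  finally show ?thesis .
qed

text \<open>Both pairs are ordered the same way, so the gap y - x interpolates linearly without
  crossing 0, and - ln is convex on positive gaps. If one of the pairs coincides, the right side is
  infinite because t lies strictly between 0 and 1.\<close>

lemma shifted_kernel_convex:
  assumes t: "0 < t" "t < 1" and xy: "x0 \<le> y0" "x1 \<le> y1"
  shows "shifted_kernel V B ((1 - t) * x0 + t * x1) ((1 - t) * y0 + t * y1)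
     \<le> ennreal (1 - t) * shifted_kernel V B x0 y0 + ennreal t * shifted_kernel V B x1 y1"
proof (cases "x0 = y0 \<or> x1 = y1")
  case True
  then show ?thesis using t by (auto simp: shifted_kernel_def ennreal_mult_top ennreal_top_mult)
next
  case False
  then have a: "0 < y0 - x0" "0 < y1 - x1" using xy by auto
  have d: "((1 - t) * y0 + t * y1) - ((1 - t) * x0 + t * x1) = (1 - t) * (y0 - x0) + t * (y1 - x1)"
    by (simp add: algebra_simps)
  have dp: "0 < (1 - t) * (y0 - x0) + t * (y1 - x1)" using a t by (intro add_pos_pos mult_pos_pos) auto
  define k where "k = (\<lambda>x y. B + (- ln \<bar>x - y\<bar> / 2 + (V x + V y) / 2))"
  have l: "(1 - t) * ln (y0 - x0) + t * ln (y1 - x1) \<le> ln ((1 - t) * (y0 - x0) + t * (y1 - x1))"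
    using concave_onD[OF ln_concave, of t "y0 - x0" "y1 - x1"] t a by simp
  have v: "V ((1 - t) * x + t * y) \<le> (1 - t) * V x + t * V y" for x y
    using convex_onD[OF V_convex_on, of t x y] t by simp
  have "k ((1 - t) * x0 + t * x1) ((1 - t) * y0 + t * y1)
     = B + (- ln ((1 - t) * (y0 - x0) + t * (y1 - x1)) / 2 + (V ((1 - t) * x0 + t * x1) + V ((1 - t) * y0 + t * y1)) / 2)"
    unfolding k_def using d dp by (simp add: abs_minus_commute[of "(1 - t) * x0 + t * x1"])
  also have "\<dots> \<le> B + (- ((1 - t) * ln (y0 - x0) + t * ln (y1 - x1)) / 2
      + (((1 - t) * V x0 + t * V x1) + ((1 - t) * V y0 + t * V y1)) / 2)"
    by (intro add_left_mono add_mono divide_right_mono le_imp_neg_le l v) auto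
  also have "\<dots> = (1 - t) * k x0 y0 + t * k x1 y1"
    unfolding k_def using a by (simp add: abs_minus_commute[of x0] abs_minus_commute[of x1] field_simps)
  finally have le: "k ((1 - t) * x0 + t * x1) ((1 - t) * y0 + t * y1) \<le> (1 - t) * k x0 y0 + t * k x1 y1" .
  have k0: "0 \<le> k x y" if "x \<noteq> y" for x y unfolding k_def by (rule B_kernel[OF that])
  have sk: "shifted_kernel V B x y = ennreal (k x y)" if "x \<noteq> y" for x y
    using that by (simp add: shifted_kernel_def k_def)
  have "ennreal (k ((1 - t) * x0 + t * x1) ((1 - t) * y0 + t * y1)) \<le> ennreal ((1 - t) * k x0 y0 + t * k x1 y1)"
    by (rule ennreal_leI[OF le])
  also have "\<dots> = ennreal (1 - t) * ennreal (k x0 y0) + ennreal t * ennreal (k x1 y1)"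
    using t k0 False by (subst ennreal_plus) (auto simp: ennreal_mult)
  finally show ?thesis using False d dp by (subst (1 2 3) sk) auto
qed

text \<open>Both measures are represented by their quantile functions on the same space (0, 1).
  These are nondecreasing, so any two points are ordered alike under both, which is what
  \<open>shifted_kernel_convex\<close> demands.\<close>

lemma displacement_convexity:
  assumes \<rho>0: "\<rho>0 \<in> prob_measures_on a" and \<rho>1: "\<rho>1 \<in> prob_measures_on b" and t: "0 < t" "t < 1"
  shows "\<exists>\<rho>\<in>prob_measures_on ((1 - t) * a + t * b). SE \<rho> \<le> ennreal (1 - t) * SE \<rho>0 + ennreal t * SE \<rho>1"
proof -
  have P: "real_distribution \<rho>0" "real_distribution \<rho>1"
    using \<rho>0 \<rho>1 by (auto simp: prob_measures_on_def prob_measures_R_def real_distribution_def real_distribution_axioms_def)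
  interpret M0: cdf_distribution \<rho>0 unfolding cdf_distribution_def by (rule P)
  interpret M1: cdf_distribution \<rho>1 unfolding cdf_distribution_def by (rule P)
  define \<Omega> where "\<Omega> = (restrict_space lborel {0<..<1} :: real measure)"
  have sp: "space \<Omega> = {0<..<1}" by (simp add: \<Omega>_def space_restrict_space)
  have "prob_space \<Omega>"
    by (auto simp: \<Omega>_def emeasure_restrict_space space_restrict_space intro!: prob_spaceI)
  then interpret \<Omega>: prob_space \<Omega> .
  have setsO: "sets \<Omega> = sets (restrict_space borel {0<..<1::real})"
    by (simp add: \<Omega>_def sets_restrict_space)
  define X0 X1 where "X0 = M0.I" and "X1 = M1.I"
  have [measurable]: "X0 \<in> borel_measurable \<Omega>" "X1 \<in> borel_measurable \<Omega>"
    unfolding X0_def X1_def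
    using M0.measurable_CI M1.measurable_CI by (simp_all add: measurable_cong_sets[OF setsO refl])
  have d: "distr \<Omega> borel X0 = \<rho>0" "distr \<Omega> borel X1 = \<rho>1"
    unfolding X0_def X1_def \<Omega>_def by (rule M0.distr_I_eq_M M1.distr_I_eq_M)+
  have mono: "X0 u \<le> X0 v" "X1 u \<le> X1 v" if "u \<in> space \<Omega>" "v \<in> space \<Omega>" "u \<le> v" for u v
    using that M0.mono_I M1.mono_I unfolding X0_def X1_def mono_on_def sp by auto
  define X where "X = (\<lambda>u. (1 - t) * X0 u + t * X1 u)"
  have [measurable]: "X \<in> borel_measurable \<Omega>" unfolding X_def by measurable
  define \<rho> where "\<rho> = distr \<Omega> borel X"
  have SE_distr: "SE (distr \<Omega> borel Y) = (\<integral>\<^sup>+u. \<integral>\<^sup>+v. shifted_kernel V B (Y u) (Y v) \<partial>\<Omega> \<partial>\<Omega>)"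
    if [measurable]: "Y \<in> borel_measurable \<Omega>" for Y
  proof -
    have "prob_space (distr \<Omega> borel Y)" by (rule \<Omega>.prob_space_distr) measurable
    then interpret D: prob_space "distr \<Omega> borel Y" .
    have "SE (distr \<Omega> borel Y) = (\<integral>\<^sup>+u. \<integral>\<^sup>+y. shifted_kernel V B (Y u) y \<partial>distr \<Omega> borel Y \<partial>\<Omega>)"
      unfolding SE_def shifted_energy_def by (rule nn_integral_distr) measurable
    also have "\<dots> = (\<integral>\<^sup>+u. \<integral>\<^sup>+v. shifted_kernel V B (Y u) (Y v) \<partial>\<Omega> \<partial>\<Omega>)"
      by (intro nn_integral_cong nn_integral_distr) measurable
    finally show ?thesis .
  qed
  \<comment> \<open>The kernel is symmetric, so u <= v may be assumed.\<close>
  have pw: "shifted_kernel V B (X u) (X v) \<le> ennreal (1 - t) * shifted_kernel V B (X0 u) (X0 v) + ennreal t * shifted_kernel V B (X1 u) (X1 v)"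
    if "u \<in> space \<Omega>" "v \<in> space \<Omega>" for u v
  proof (cases "u \<le> v")
    case True
    show ?thesis unfolding X_def by (intro shifted_kernel_convex t mono that True)
  next
    case False
    then have "v \<le> u" by simp
    then have "shifted_kernel V B (X v) (X u) \<le> ennreal (1 - t) * shifted_kernel V B (X0 v) (X0 u) + ennreal t * shifted_kernel V B (X1 v) (X1 u)"
      unfolding X_def by (intro shifted_kernel_convex t mono that)
    then show ?thesis
      by (simp only: shifted_kernel_commute[of V B "X u"] shifted_kernel_commute[of V B "X0 u"] shifted_kernel_commute[of V B "X1 u"])
  qed
  have "SE \<rho> \<le> (\<integral>\<^sup>+u. \<integral>\<^sup>+v. ennreal (1 - t) * shifted_kernel V B (X0 u) (X0 v) + ennreal t * shifted_kernel V B (X1 u) (X1 v) \<partial>\<Omega> \<partial>\<Omega>)"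
    unfolding \<rho>_def by (subst SE_distr, measurable) (intro nn_integral_mono pw)
  also have "\<dots> = ennreal (1 - t) * SE \<rho>0 + ennreal t * SE \<rho>1"
    unfolding d[symmetric] by (simp add: SE_distr nn_integral_add nn_integral_cmult)
  finally have "SE \<rho> \<le> ennreal (1 - t) * SE \<rho>0 + ennreal t * SE \<rho>1" .
  moreover have "\<rho> \<in> prob_measures_on ((1 - t) * a + t * b)"
  proof -
    have "prob_space \<rho>" unfolding \<rho>_def by (rule \<Omega>.prob_space_distr) measurable
    then interpret R: prob_space \<rho> .
    have "AE x in distr \<Omega> borel X0. x \<in> {-a..a}" "AE x in distr \<Omega> borel X1. x \<in> {-b..b}"
      unfolding d using AE_prob_measures_on[OF \<rho>0] AE_prob_measures_on[OF \<rho>1] by auto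
    then have "AE u in \<Omega>. X0 u \<in> {-a..a}" "AE u in \<Omega>. X1 u \<in> {-b..b}"
      by (subst (asm) AE_distr_iff; simp)+
    then have "AE u in \<Omega>. X u \<in> {-((1 - t) * a + t * b)..(1 - t) * a + t * b}"
    proof eventually_elim
      case (elim u)
      then have "X0 u \<le> a" "- a \<le> X0 u" "X1 u \<le> b" "- b \<le> X1 u" by auto
      then have "(1 - t) * X0 u \<le> (1 - t) * a" "(1 - t) * (- a) \<le> (1 - t) * X0 u" "t * X1 u \<le> t * b" "t * (- b) \<le> t * X1 u"
        using t by (intro mult_left_mono; simp)+
      then show ?case unfolding X_def by (simp add: algebra_simps)
    qed
    then have "AE x in \<rho>. x \<in> {-((1 - t) * a + t * b)..(1 - t) * a + t * b}"
      unfolding \<rho>_def by (subst AE_distr_iff) auto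
    then have "emeasure \<rho> {-((1 - t) * a + t * b)..(1 - t) * a + t * b} = 1"
      by (intro R.emeasure_eq_1_AE) (auto simp: \<rho>_def)
    then show ?thesis using R.prob_space_axioms
      by (simp add: prob_measures_on_def prob_measures_R_def \<rho>_def)
  qed
  ultimately show ?thesis by blast
qed

text \<open>The integrand of \<open>E_diff\<close> is largest at the left end. For g R = 1 the
  factor (1 - g r)^2 tends to 0 as r tends to R, so the energy gap is o(R - r).\<close>

lemma E_diff_le:
  assumes "0 < r" "r \<le> R" "g R \<le> 1"
  shows "E r - E R \<le> (1 - g r)\<^sup>2 / (2 * r) * (R - r)"
proof -
  note h = E_diff[OF assms(1,2)]
  have "((\<lambda>s. (1 - g r)\<^sup>2 / r) has_integral (1 - g r)\<^sup>2 / r * (R - r)) {r..R}"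
    using has_integral_const_real[of "(1 - g r)\<^sup>2 / r" r R] assms by (simp add: mult.commute)
  with h have "2 * (E r - E R) \<le> (1 - g r)\<^sup>2 / r * (R - r)"
  proof (rule has_integral_le)
    fix s assume s: "s \<in> {r..R}"
    have "g r \<le> g s" "g s \<le> 1" using s assms g_mono[of r s] g_mono[of s R] by auto
    then have "(1 - g s)\<^sup>2 \<le> (1 - g r)\<^sup>2" by (intro power_mono) auto
    then show "(1 - g s)\<^sup>2 / s \<le> (1 - g r)\<^sup>2 / r" using s assms by (intro frac_le) auto
  qed
  moreover have "(1 - g r)\<^sup>2 / (2 * r) * (R - r) = ((1 - g r)\<^sup>2 / r * (R - r)) / 2" by simp
  moreover have "a \<le> x / 2" if "2 * a \<le> x" for a x :: real using that by simp
  ultimately show "E r - E R \<le> (1 - g r)\<^sup>2 / (2 * r) * (R - r)" by (simp only:)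
qed

text \<open>Interpolate between a near-minimiser on [-r, r], r < Rs, and the given measure so that
  the support lands in [-Rs, Rs], where the Chebyshev bound holds. Solving for the energy S divides
  the gap E r - E Rs by Rs - r, and the quotient vanishes as r tends to Rs by
  \<open>E_diff_le\<close>.\<close>

lemma SE_lower_bound_beyond:
  assumes Rs: "0 < Rs" "g Rs = 1" and R: "Rs < R" and \<rho>: "\<rho> \<in> prob_measures_on R"
  shows "ennreal (E Rs + B) \<le> SE \<rho>"
proof (cases "SE \<rho>")
  case (real S)
  have bound: "E Rs + B - S \<le> (R - Rs) * ((1 - g r)\<^sup>2 / (2 * r) + (Rs - r))" if r: "0 < r" "r < Rs" for r
  proof -
    \<comment> \<open>The tolerance must still tend to 0 after division by Rs - r.\<close>
    define e where "e = (Rs - r)\<^sup>2"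
    have e: "e > 0" using r by (simp add: e_def)
    have gr: "g r \<le> 1" using g_strict_mono[OF r] Rs by simp
    obtain \<rho>0 where \<rho>0: "\<rho>0 \<in> prob_measures_on r" "SE \<rho>0 \<le> ennreal (E r + e + B)"
      using near_minimiser[OF r(1) gr e] by blast
    have "1 \<le> ennreal (E r + e + B)"
    proof (rule order_trans[OF SE_ge_1 \<rho>0(2)])
      show "\<rho>0 \<in> prob_measures_R" using \<rho>0(1) by (simp add: prob_measures_on_def)
    qed
    then have pos: "0 \<le> E r + e + B" using ennreal_neg[of "E r + e + B"] by (cases "0 \<le> E r + e + B") auto
    \<comment> \<open>The weight for which the interpolated radius is exactly Rs.\<close>
    define t where "t = (Rs - r) / (R - r)"
    have t: "0 < t" "t < 1" using r R by (auto simp: t_def)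
    have Rt: "(1 - t) * r + t * R = Rs"
    proof -
      have "t * (R - r) = Rs - r" using r R by (simp add: t_def)
      then show ?thesis by (simp add: algebra_simps)
    qed
    obtain \<rho>' where \<rho>': "\<rho>' \<in> prob_measures_on Rs" "SE \<rho>' \<le> ennreal (1 - t) * SE \<rho>0 + ennreal t * SE \<rho>"
      using displacement_convexity[OF \<rho>0(1) \<rho> t] unfolding Rt by blast
    have "ennreal (E Rs + B) \<le> SE \<rho>'" by (rule shifted_energy_lower_bound[OF Rs(1) \<rho>'(1)])
    also note \<rho>'(2)
    also have "ennreal (1 - t) * SE \<rho>0 + ennreal t * SE \<rho> \<le> ennreal (1 - t) * ennreal (E r + e + B) + ennreal t * ennreal S"
      unfolding real(2) by (intro add_mono mult_left_mono \<rho>0 order_refl) auto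
    also have "\<dots> = ennreal ((1 - t) * (E r + e + B) + t * S)"
      using t pos real by (simp add: ennreal_mult'' ennreal_mult)
    finally have "E Rs + B \<le> (1 - t) * (E r + e + B) + t * S"
      using t pos real by (subst (asm) ennreal_le_iff) auto
    then have "(R - r) * (E Rs + B) \<le> (R - r) * ((1 - t) * (E r + e + B) + t * S)"
      using r R by (intro mult_left_mono) auto
    also have "\<dots> = ((R - r) - (R - r) * t) * (E r + e + B) + ((R - r) * t) * S" by (simp add: algebra_simps)
    also have "(R - r) * t = Rs - r" using r R by (simp add: t_def)
    finally have "(Rs - r) * (E Rs + B - S) \<le> (R - Rs) * ((E r - E Rs) + e)"
      by (simp add: algebra_simps)
    also have "\<dots> \<le> (R - Rs) * ((1 - g r)\<^sup>2 / (2 * r) * (Rs - r) + e)"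
      using R E_diff_le[of r Rs] r Rs by (intro mult_left_mono add_right_mono) auto
    also have "\<dots> = (Rs - r) * ((R - Rs) * ((1 - g r)\<^sup>2 / (2 * r) + (Rs - r)))"
      by (simp add: e_def power2_eq_square algebra_simps)
    finally show ?thesis using r by simp
  qed
  \<comment> \<open>Left continuity of g at Rs; since g Rs = 1 the limit is 0.\<close>
  have "((\<lambda>r. (R - Rs) * ((1 - g r)\<^sup>2 / (2 * r) + (Rs - r))) \<longlongrightarrow> (R - Rs) * ((1 - g Rs)\<^sup>2 / (2 * Rs) + (Rs - Rs))) (at_left Rs)"
    using DERIV_isCont[OF g_deriv, of Rs, unfolded isCont_def, THEN filterlim_mono, OF order_refl at_le[of "{..<Rs}" UNIV]] Rs
    by (intro tendsto_intros) auto
  moreover have "\<forall>\<^sub>F r in at_left Rs. E Rs + B - S \<le> (R - Rs) * ((1 - g r)\<^sup>2 / (2 * r) + (Rs - r))"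
    using eventually_at_left_real[OF Rs(1)] by eventually_elim (use bound in auto)
  ultimately have "E Rs + B - S \<le> (R - Rs) * ((1 - g Rs)\<^sup>2 / (2 * Rs) + (Rs - Rs))"
    by (rule tendsto_lowerbound) simp
  then show ?thesis using real Rs by (simp add: ennreal_leI)
qed simp

text \<open>Condition the measure on [-n, n], an event of probability p. The kernel is nonnegative,
  so the conditioned energy is at most \<open>SE \<rho>\<close> / p^2, and p tends to 1.\<close>

lemma SE_lower_bound_line:
  assumes Rs: "0 < Rs" "g Rs = 1" and \<rho>: "\<rho> \<in> prob_measures_R"
  shows "ennreal (E Rs + B) \<le> SE \<rho>"
proof -
  interpret prob_space \<rho> using \<rho> by (simp add: prob_measures_R_def)
  have sets\<rho> [measurable_cong, simp]: "sets \<rho> = sets borel" using \<rho> by (simp add: prob_measures_R_def)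
  have lim: "(\<lambda>n. emeasure \<rho> {- real n..real n}) \<longlonglongrightarrow> emeasure \<rho> (\<Union>n. {- real n..real n})"
    by (rule Lim_emeasure_incseq) (auto simp: incseq_def)
  have "(\<Union>n. {- real n..real n}) = UNIV"
  proof safe
    fix x :: real
    obtain n where "\<bar>x\<bar> \<le> real n" using real_arch_simple by blast
    then show "x \<in> (\<Union>n. {- real n..real n})" by (auto intro!: exI[of _ n])
  qed auto
  then have lim: "(\<lambda>n. emeasure \<rho> {- real n..real n}) \<longlonglongrightarrow> 1"
    using lim emeasure_space_1 sets_eq_imp_space_eq[OF sets\<rho>] by simp
  \<comment> \<open>Stated with products instead of quotients, so that p = 0 is trivial.\<close>
  have bound: "ennreal (E Rs + B) * emeasure \<rho> {- real n..real n} * emeasure \<rho> {- real n..real n} \<le> SE \<rho>"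
    if n: "Rs < real n" for n
  proof (cases "emeasure \<rho> {- real n..real n} = 0")
    case False
    define A where "A = {- real n..real n}"
    define p where "p = emeasure \<rho> A"
    have [measurable]: "A \<in> sets \<rho>" by (simp add: A_def)
    have p: "p \<noteq> 0" "p \<noteq> \<top>" using False by (auto simp: p_def A_def)
    define \<nu> where "\<nu> = uniform_measure \<rho> A"
    have "prob_space \<nu>" unfolding \<nu>_def using p by (intro prob_space_uniform_measure) (auto simp: p_def)
    then interpret N: prob_space \<nu> .
    have sets\<nu> [measurable_cong, simp]: "sets \<nu> = sets borel" by (simp add: \<nu>_def)
    have "emeasure \<nu> A = 1" unfolding \<nu>_def by (rule emeasure_uniform_measure_1) (use p in \<open>auto simp: p_def\<close>)
    then have "\<nu> \<in> prob_measures_on (real n)"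
      using N.prob_space_axioms by (simp add: prob_measures_on_def prob_measures_R_def A_def)
    from SE_lower_bound_beyond[OF Rs n this] have "ennreal (E Rs + B) \<le> SE \<nu>" .
    also have "SE \<nu> = (\<integral>\<^sup>+x. (\<integral>\<^sup>+y. shifted_kernel V B x y \<partial>\<nu>) * indicator A x \<partial>\<rho>) / p"
    proof -
      define J where "J = (\<lambda>x. \<integral>\<^sup>+y. shifted_kernel V B x y \<partial>\<nu>)"
      have [measurable]: "J \<in> borel_measurable \<rho>" unfolding J_def by measurable
      have "SE \<nu> = (\<integral>\<^sup>+x. J x \<partial>\<nu>)" by (simp add: SE_def shifted_energy_def J_def)
      also have "\<dots> = (\<integral>\<^sup>+x. J x * indicator A x \<partial>\<rho>) / p"
        unfolding \<nu>_def p_def by (rule nn_integral_uniform_measure) measurable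
      finally show ?thesis by (simp only: J_def)
    qed
    also have "\<dots> \<le> (\<integral>\<^sup>+x. (\<integral>\<^sup>+y. shifted_kernel V B x y \<partial>\<rho>) / p \<partial>\<rho>) / p"
    proof (intro divide_right_mono_ennreal nn_integral_mono)
      fix x
      have "(\<integral>\<^sup>+y. shifted_kernel V B x y \<partial>\<nu>) = (\<integral>\<^sup>+y. shifted_kernel V B x y * indicator A y \<partial>\<rho>) / p"
        unfolding \<nu>_def p_def by (rule nn_integral_uniform_measure) measurable
      also have "\<dots> \<le> (\<integral>\<^sup>+y. shifted_kernel V B x y \<partial>\<rho>) / p"
        by (intro divide_right_mono_ennreal nn_integral_mono) (auto simp: indicator_def)
      finally show "(\<integral>\<^sup>+y. shifted_kernel V B x y \<partial>\<nu>) * indicator A x \<le> (\<integral>\<^sup>+y. shifted_kernel V B x y \<partial>\<rho>) / p"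
        by (auto simp: indicator_def)
    qed
    also have "\<dots> = SE \<rho> / p / p"
      unfolding SE_def shifted_energy_def by (subst nn_integral_divide) measurable
    finally have "ennreal (E Rs + B) \<le> SE \<rho> / p / p" .
    then have "ennreal (E Rs + B) * p * p \<le> SE \<rho> / p / p * p * p" by (intro mult_right_mono) auto
    also have pp: "SE \<rho> / p / p * p * p = SE \<rho>"
    proof -
      have "x / p * p = x" for x
        using p by (simp add: ennreal_divide_times ennreal_divide_self less_top)
      then show ?thesis by (simp only:)
    qed
    finally show ?thesis by (simp add: p_def A_def)
  qed simp
  have "(\<lambda>n. ennreal (E Rs + B) * emeasure \<rho> {- real n..real n} * emeasure \<rho> {- real n..real n}) \<longlonglongrightarrow> ennreal (E Rs + B) * 1 * 1"
    by (intro tendsto_mult_ennreal tendsto_const lim) auto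
  moreover have "\<forall>\<^sub>F n in sequentially. ennreal (E Rs + B) * emeasure \<rho> {- real n..real n} * emeasure \<rho> {- real n..real n} \<le> SE \<rho>"
    using filterlim_real_sequentially[unfolded filterlim_at_top_dense, rule_format, of Rs]
    by eventually_elim (rule bound)
  ultimately have "ennreal (E Rs + B) * 1 * 1 \<le> SE \<rho>"
    by (intro tendsto_upperbound) auto
  then show ?thesis by simp
qed

text \<open>Serves the infima over the line and over [-R, R]. In the latter case r is R up to the
  critical radius and Rs beyond it.\<close>

lemma INF_energy_eqI:
  assumes low: "\<And>\<rho>. \<rho> \<in> A \<Longrightarrow> ennreal (E r + B) \<le> SE \<rho>" and A: "A \<subseteq> prob_measures_R"
    and r: "0 < r" "g r \<le> 1" "prob_measures_on r \<subseteq> A"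
  shows "(INF \<rho>\<in>A. energy V \<rho>) = ereal (E r)"
proof (rule antisym)
  show "ereal (E r) \<le> (INF \<rho>\<in>A. energy V \<rho>)"
    using low A by (intro INF_greatest) (auto simp: le_energy_iff)
  show "(INF \<rho>\<in>A. energy V \<rho>) \<le> ereal (E r)"
  proof (rule ereal_le_epsilon2)
    fix e :: real assume e: "0 < e"
    obtain \<rho> where \<rho>: "\<rho> \<in> prob_measures_on r" "SE \<rho> \<le> ennreal (E r + e + B)"
      using near_minimiser[OF r(1,2) e] by blast
    have \<rho>R: "\<rho> \<in> prob_measures_R" using \<rho> by (simp add: prob_measures_on_def)
    have "1 \<le> ennreal (E r + e + B)" using SE_ge_1[OF \<rho>R] \<rho>(2) by (rule order_trans)
    then have "0 \<le> E r + e + B" using ennreal_neg[of "E r + e + B"] by (cases "0 \<le> E r + e + B") auto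
    then have "energy V \<rho> \<le> ereal (E r + e)" by (rule energy_le[OF \<rho>R \<rho>(2)])
    moreover have "(INF \<rho>\<in>A. energy V \<rho>) \<le> energy V \<rho>" using \<rho> r(3) by (intro INF_lower) auto
    ultimately show "(INF \<rho>\<in>A. energy V \<rho>) \<le> ereal (E r) + ereal e" by simp
  qed
qed

lemma excess_free_energy_eq:
  assumes Rs: "0 < Rs" "g Rs = 1" and R: "0 < R"
  shows "excess_free_energy V R = ereal (E (min R Rs) - E Rs)"
proof -
  have sub: "prob_measures_on r \<subseteq> prob_measures_R" for r by (auto simp: prob_measures_on_def)
  have "(INF \<rho>\<in>prob_measures_R. energy V \<rho>) = ereal (E Rs)"
    by (rule INF_energy_eqI) (use Rs SE_lower_bound_line sub in auto)
  moreover have "(INF \<rho>\<in>prob_measures_on R. energy V \<rho>) = ereal (E (min R Rs))"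
  proof (cases "R \<le> Rs")
    case True
    have "(INF \<rho>\<in>prob_measures_on R. energy V \<rho>) = ereal (E R)"
      by (rule INF_energy_eqI) (use True Rs R g_mono[of R Rs] sub shifted_energy_lower_bound in auto)
    with True show ?thesis by (simp add: min_def)
  next
    case False
    have "(INF \<rho>\<in>prob_measures_on R. energy V \<rho>) = ereal (E Rs)"
      by (rule INF_energy_eqI)
         (use False Rs R sub SE_lower_bound_beyond[of Rs R] prob_measures_on_mono[of Rs R] in \<open>auto simp: subset_iff\<close>)
    with False show ?thesis by (simp add: min_def)
  qed
  ultimately show ?thesis by (simp add: excess_free_energy_def)
qed

end

section \<open>Regularity at the critical radius\<close>

text \<open>At a both one-sided derivatives are 0: the difference quotient of H is bounded in
  absolute value by that of \<phi>. Applied twice, to the excess energy and to its first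
  derivative.\<close>

lemma has_real_derivative_cut_off:
  fixes H \<phi> \<phi>' :: "real \<Rightarrow> real"
  assumes a: "0 < a" and \<phi>: "\<And>x. 0 < x \<Longrightarrow> (\<phi> has_real_derivative \<phi>' x) (at x)"
    and 0: "\<phi> a = 0" "\<phi>' a = 0" and H: "\<And>x. 0 < x \<Longrightarrow> H x = (if x < a then \<phi> x else 0)"
    and x: "0 < x"
  shows "(H has_real_derivative (if x < a then \<phi>' x else 0)) (at x)"
proof -
  consider "x < a" | "x = a" | "a < x" by linarith
  then show ?thesis
  proof cases
    case 1
    have "(H has_real_derivative \<phi>' x) (at x)"
      by (rule has_field_derivative_transform_within_open[OF \<phi>[OF x], of "{0<..<a}"]) (use 1 x H in auto)
    with 1 show ?thesis by simp
  next
    case 3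
    have "(H has_real_derivative 0) (at x)"
      by (rule has_field_derivative_transform_within_open[of "\<lambda>_. 0" _ _ "{a<..}"]) (use 3 a H in auto)
    with 3 show ?thesis by simp
  next
    case 2
    have "((\<lambda>y. (\<phi> y - \<phi> a) / (y - a)) \<longlongrightarrow> 0) (at a)"
      using \<phi>[OF a] 0 by (simp add: has_field_derivative_iff)
    then have "((\<lambda>y. norm ((\<phi> y - \<phi> a) / (y - a))) \<longlongrightarrow> 0) (at a)" by (rule tendsto_norm_zero)
    then have "((\<lambda>y. (H y - H a) / (y - a)) \<longlongrightarrow> 0) (at a)"
    proof (rule Lim_null_comparison[rotated])
      have "\<forall>\<^sub>F y in at a. y \<in> {0<..}" using a by (intro eventually_at_in_open') auto
      then show "\<forall>\<^sub>F y in at a. norm ((H y - H a) / (y - a)) \<le> norm ((\<phi> y - \<phi> a) / (y - a))"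
        by eventually_elim (use a H 0 in auto)
    qed
    with 2 show ?thesis by (simp add: has_field_derivative_iff)
  qed
qed

context even_convex_potential
begin

definition E1 :: "real \<Rightarrow> real" where "E1 R = - ((1 - g R)\<^sup>2 / (2 * R))"
definition E2 :: "real \<Rightarrow> real" where "E2 R = (1 - g R) * g' R / R + (1 - g R)\<^sup>2 / (2 * R\<^sup>2)"
definition E3 :: "real \<Rightarrow> real" where
  "E3 R = ((1 - g R) * g'' R - (g' R)\<^sup>2) / R - 2 * ((1 - g R) * g' R / R\<^sup>2) - (1 - g R)\<^sup>2 / R ^ 3"

lemma E_deriv: assumes "0 < R" shows "(E has_real_derivative E1 R) (at R)"
proof -
  have "((\<lambda>x. integral {0..x} (\<lambda>s. s * (w s)\<^sup>2)) has_real_derivative R * (w R)\<^sup>2) (at R within {0..R + 1})"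
    by (rule integral_has_real_derivative) (use assms in \<open>auto intro!: continuous_intros w_cont\<close>)
  moreover have "at R within {0..R + 1} = at R"
    using assms by (intro at_within_interior) (auto simp: interior_atLeastAtMost_real)
  ultimately have "((\<lambda>x. integral {0..x} (\<lambda>s. s * (w s)\<^sup>2)) has_real_derivative R * (w R)\<^sup>2) (at R)" by simp
  then have "((\<lambda>R. (ln 2 - ln R) / 2 + W R - integral {0..R} (\<lambda>s. s * (w s)\<^sup>2) / 2) has_real_derivative
      (0 - 1 / R) / 2 + w R - R * (w R)\<^sup>2 / 2) (at R)"
    using assms by (auto intro!: derivative_eq_intros W_deriv)
  then have "(E has_real_derivative (0 - 1 / R) / 2 + w R - R * (w R)\<^sup>2 / 2) (at R)"
    by (rule has_field_derivative_transform_within_open[of _ _ _ "{0<..}"])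
       (use assms in \<open>auto simp: E_def ln_div\<close>)
  also have "(0 - 1 / R) / 2 + w R - R * (w R)\<^sup>2 / 2 = E1 R"
    using assms by (simp add: E1_def g_def power2_eq_square field_simps)
  finally show ?thesis .
qed

lemma E1_deriv: assumes "0 < R" shows "(E1 has_real_derivative E2 R) (at R)"
  unfolding E1_def E2_def using assms
  by (auto intro!: derivative_eq_intros g_deriv simp: field_simps power2_eq_square)

lemma E2_deriv: assumes "0 < R" shows "(E2 has_real_derivative E3 R) (at R)"
  unfolding E2_def E3_def using assms
  by (auto intro!: derivative_eq_intros g_deriv g'_deriv simp: field_simps power2_eq_square power3_eq_cube)

lemma E3_isCont: assumes "0 < R" shows "isCont E3 R"
proof -
  have "isCont g R" "isCont g' R" "isCont g'' R"
    using g_cont[of UNIV] g'_cont[of UNIV] g''_cont[of UNIV] by (auto simp: continuous_on_eq_continuous_at)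
  then show ?thesis unfolding E3_def using assms by (intro continuous_intros) auto
qed

section \<open>The excess free energy near the critical radius\<close>

definition F :: "real \<Rightarrow> real" where "F R = real_of_ereal (excess_free_energy V R)"

context
  fixes Rs :: real
  assumes Rs: "0 < Rs" "g Rs = 1"
begin

lemma F_eq: "0 < R \<Longrightarrow> F R = (if R < Rs then E R - E Rs else 0)"
  using excess_free_energy_eq[OF Rs, of R] by (simp add: F_def min_def)

lemma F_deriv: assumes "0 < R" shows "(F has_real_derivative (if R < Rs then E1 R else 0)) (at R)"
  by (rule has_real_derivative_cut_off[where \<phi> = "\<lambda>R. E R - E Rs"])
     (use Rs assms F_eq in \<open>auto intro!: derivative_eq_intros E_deriv simp: E1_def\<close>)

lemma deriv_F: "0 < R \<Longrightarrow> deriv F R = (if R < Rs then E1 R else 0)"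
  by (rule DERIV_imp_deriv[OF F_deriv])

lemma deriv_F_deriv: assumes "0 < R" shows "(deriv F has_real_derivative (if R < Rs then E2 R else 0)) (at R)"
proof (rule has_real_derivative_cut_off[where \<phi> = E1])
  show "E1 Rs = 0" "E2 Rs = 0" using Rs by (simp_all add: E1_def E2_def)
qed (use Rs assms deriv_F E1_deriv in auto)

lemma deriv2_F: "0 < R \<Longrightarrow> deriv (deriv F) R = (if R < Rs then E2 R else 0)"
  by (rule DERIV_imp_deriv[OF deriv_F_deriv])

lemma deriv2_F_deriv: assumes "0 < R" "R < Rs" shows "(deriv (deriv F) has_real_derivative E3 R) (at R)"
  by (rule has_field_derivative_transform_within_open[OF E2_deriv, of _ "{0<..<Rs}"])
     (use assms deriv2_F in auto)

lemma eventually_left_interval: "\<forall>\<^sub>F R in at_left Rs. 0 < R \<and> R < Rs"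
  using eventually_at_left_real[OF Rs(1)] by eventually_elim auto

lemma deriv3_F_tendsto: "((deriv ^^ 3) F \<longlongrightarrow> - ((g' Rs)\<^sup>2 / Rs)) (at_left Rs)"
proof -
  have "(E3 \<longlongrightarrow> E3 Rs) (at_left Rs)"
    using E3_isCont[OF Rs(1)] by (simp add: isCont_def filterlim_at_split)
  \<comment> \<open>Every term of \<open>E3\<close> with a factor 1 - g vanishes at Rs.\<close>
  moreover have "E3 Rs = - ((g' Rs)\<^sup>2 / Rs)" using Rs by (simp add: E3_def)
  moreover have "\<forall>\<^sub>F R in at_left Rs. E3 R = (deriv ^^ 3) F R"
    using eventually_left_interval
  proof eventually_elim
    case (elim R)
    then have "deriv (deriv (deriv F)) R = E3 R" by (intro DERIV_imp_deriv deriv2_F_deriv) auto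
    then show ?case by (simp add: numeral_3_eq_3)
  qed
  ultimately show ?thesis using tendsto_cong by force
qed

text \<open>One application of l'Hopital's rule from the left: the quotient of derivatives is the
  squared difference quotient of g over 6 C R. Its limit is 1 for this C, which is -
  \<open>E3 Rs\<close> / 3!.\<close>

lemma F_asymp:
  defines "C \<equiv> (g' Rs)\<^sup>2 / (6 * Rs)"
  shows "F \<sim>[at Rs] (\<lambda>R. C * (Rs - R) ^ 3 * indicator {..Rs} R)"
proof -
  have C: "0 < C" using g'_pos[OF Rs(1)] Rs by (simp add: C_def)
  let ?G = "\<lambda>R. C * (Rs - R) ^ 3 * indicator {..Rs} R"
  let ?q = "\<lambda>R. if F R = 0 \<and> ?G R = 0 then 1 else F R / ?G R"
  have left: "(?q \<longlongrightarrow> 1) (at_left Rs)"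
  proof -
    have "((\<lambda>R. (E R - E Rs) / (C * (Rs - R) ^ 3)) \<longlongrightarrow> 1) (at_left Rs)"
    proof (rule lhopital_left[where f' = E1 and g' = "\<lambda>R. - (3 * C * (Rs - R)\<^sup>2)"])
      have "isCont (\<lambda>R. E R - E Rs) Rs" using DERIV_isCont[OF E_deriv[OF Rs(1)]] by (intro continuous_intros)
      then show "((\<lambda>R. E R - E Rs) \<longlongrightarrow> 0) (at_left Rs)" by (simp add: isCont_def filterlim_at_split)
      have "((\<lambda>R. C * (Rs - R) ^ 3) \<longlongrightarrow> C * (Rs - Rs) ^ 3) (at_left Rs)" by (intro tendsto_intros)
      then show "((\<lambda>R. C * (Rs - R) ^ 3) \<longlongrightarrow> 0) (at_left Rs)" by simp
      show "\<forall>\<^sub>F R in at_left Rs. C * (Rs - R) ^ 3 \<noteq> 0"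
        using eventually_left_interval by eventually_elim (use C in auto)
      show "\<forall>\<^sub>F R in at_left Rs. - (3 * C * (Rs - R)\<^sup>2) \<noteq> 0"
        using eventually_left_interval by eventually_elim (use C in auto)
      show "\<forall>\<^sub>F R in at_left Rs. ((\<lambda>R. E R - E Rs) has_real_derivative E1 R) (at R)"
        using eventually_left_interval by eventually_elim (auto intro!: derivative_eq_intros E_deriv)
      show "\<forall>\<^sub>F R in at_left Rs. ((\<lambda>R. C * (Rs - R) ^ 3) has_real_derivative - (3 * C * (Rs - R)\<^sup>2)) (at R)"
        by (intro always_eventually allI) (auto intro!: derivative_eq_intros)
      have "((\<lambda>R. (g R - g Rs) / (R - Rs)) \<longlongrightarrow> g' Rs) (at_left Rs)"
        using g_deriv[of Rs] by (simp add: has_field_derivative_iff filterlim_at_split)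
      then have "((\<lambda>R. ((g R - g Rs) / (R - Rs))\<^sup>2 / (6 * C * R)) \<longlongrightarrow> (g' Rs)\<^sup>2 / (6 * C * Rs)) (at_left Rs)"
        using C Rs by (intro tendsto_intros) auto
      also have "(g' Rs)\<^sup>2 / (6 * C * Rs) = 1" using g'_pos[OF Rs(1)] Rs by (simp add: C_def)
      finally show "((\<lambda>R. E1 R / - (3 * C * (Rs - R)\<^sup>2)) \<longlongrightarrow> 1) (at_left Rs)"
      proof (rule Lim_transform_eventually)
        show "\<forall>\<^sub>F R in at_left Rs. ((g R - g Rs) / (R - Rs))\<^sup>2 / (6 * C * R) = E1 R / - (3 * C * (Rs - R)\<^sup>2)"
          using eventually_left_interval
        proof eventually_elim
          case (elim R)
          have "((g R - g Rs) / (R - Rs))\<^sup>2 = (1 - g R)\<^sup>2 / (Rs - R)\<^sup>2"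
            unfolding power_divide Rs by (simp add: power2_commute)
          then show ?case using elim C unfolding E1_def by simp
        qed
      qed
    qed
    then show ?thesis
    proof (rule Lim_transform_eventually)
      show "\<forall>\<^sub>F R in at_left Rs. (E R - E Rs) / (C * (Rs - R) ^ 3) = ?q R"
        using eventually_left_interval by eventually_elim (use C in \<open>auto simp: F_eq\<close>)
    qed
  qed
  \<comment> \<open>To the right of Rs both functions are 0, where the quotient in the definition of
    asymptotic equivalence is set to 1.\<close>
  have right: "(?q \<longlongrightarrow> 1) (at_right Rs)"
  proof (rule tendsto_eventually)
    have "\<forall>\<^sub>F R in at_right Rs. Rs < R" by (simp add: eventually_at_filter)
    then show "\<forall>\<^sub>F R in at_right Rs. ?q R = 1"
      by eventually_elim (use Rs in \<open>auto simp: F_eq\<close>)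
  qed
  show ?thesis unfolding asymp_equiv_def using left right by (rule filterlim_split_at)
qed

lemma F_third_order:
  "\<exists>C>0. (F \<sim>[at Rs] (\<lambda>R. C * (Rs - R) ^ 3 * indicator {..Rs} R))
    \<and> F Rs = 0 \<and> F differentiable (at Rs) \<and> deriv F Rs = 0
    \<and> deriv F differentiable (at Rs) \<and> deriv (deriv F) Rs = 0
    \<and> (\<forall>\<^sub>F R in at_left Rs. deriv (deriv F) differentiable (at R))
    \<and> ((deriv ^^ 3) F \<longlongrightarrow> - 6 * C) (at_left Rs)"
proof (intro exI[of _ "(g' Rs)\<^sup>2 / (6 * Rs)"] conjI)
  show "0 < (g' Rs)\<^sup>2 / (6 * Rs)" using g'_pos[OF Rs(1)] Rs by simp
  show "F \<sim>[at Rs] (\<lambda>R. (g' Rs)\<^sup>2 / (6 * Rs) * (Rs - R) ^ 3 * indicator {..Rs} R)" by (rule F_asymp)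
  show "F Rs = 0" using F_eq[OF Rs(1)] by simp
  show "deriv F Rs = 0" using deriv_F[OF Rs(1)] by simp
  show "deriv (deriv F) Rs = 0" using deriv2_F[OF Rs(1)] by simp
  show "F differentiable (at Rs)" "deriv F differentiable (at Rs)"
    using F_deriv[OF Rs(1)] deriv_F_deriv[OF Rs(1)] real_differentiable_def by blast+
  show "\<forall>\<^sub>F R in at_left Rs. deriv (deriv F) differentiable (at R)"
    using eventually_left_interval
    by eventually_elim (use deriv2_F_deriv real_differentiable_def in blast)
  show "((deriv ^^ 3) F \<longlongrightarrow> - 6 * ((g' Rs)\<^sup>2 / (6 * Rs))) (at_left Rs)"
    using deriv3_F_tendsto by simp
qed

lemma excess_free_energy_integral:
  assumes R: "0 < R"
  shows "(\<lambda>r. (P_fun V r r)\<^sup>2 / r) integrable_on {min R Rs..Rs}"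
    and "excess_free_energy V R = ereal (1/2 * integral {min R Rs..Rs} (\<lambda>r. (P_fun V r r)\<^sup>2 / r))"
proof -
  have "((\<lambda>s. (1 - g s)\<^sup>2 / s) has_integral 2 * (E (min R Rs) - E Rs)) {min R Rs..Rs}"
    using R Rs by (intro E_diff) auto
  then have "((\<lambda>r. (P_fun V r r)\<^sup>2 / r) has_integral 2 * (E (min R Rs) - E Rs)) {min R Rs..Rs}"
    by (rule has_integral_eq[rotated]) (use R Rs in \<open>auto simp: P_fun_diag\<close>)
  then show "(\<lambda>r. (P_fun V r r)\<^sup>2 / r) integrable_on {min R Rs..Rs}"
    and "excess_free_energy V R = ereal (1/2 * integral {min R Rs..Rs} (\<lambda>r. (P_fun V r r)\<^sup>2 / r))"
    using excess_free_energy_eq[OF Rs R] by (auto simp: integral_unique)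
qed

text \<open>Strict monotonicity of g gives g < 1 below Rs, so \<open>E1\<close> is negative
  there.\<close>

lemma excess_free_energy_pos:
  assumes R: "0 < R" "R < Rs"
  shows "0 < excess_free_energy V R"
proof -
  have "E Rs < E R"
  proof (rule DERIV_neg_imp_decreasing_open[OF R(2)])
    fix x assume x: "R < x" "x < Rs"
    show "\<exists>y. (E has_real_derivative y) (at x) \<and> y < 0"
      using E_deriv[of x] g_strict_mono[of x Rs] x R Rs by (intro exI[of _ "E1 x"]) (auto simp: E1_def)
  next
    show "continuous_on {R..Rs} E"
      using R by (intro continuous_at_imp_continuous_on ballI DERIV_isCont[OF E_deriv]) auto
  qed
  then show ?thesis using excess_free_energy_eq[OF Rs R(1)] R by simp
qed

end

end

theorem theorem2:
  fixes V :: "real \<Rightarrow> real" and Rs :: real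
  assumes C3_diff: "\<forall>k<3. \<forall>x. ((deriv ^^ k) V) differentiable (at x)"
      and C3_cont: "continuous_on UNIV ((deriv ^^ 3) V)"
      and symm: "\<forall>x. V (- x) = V x"
      and conv: "strictly_convex V"
      and growth: "Liminf at_infinity (\<lambda>x. ereal (V x / ln \<bar>x\<bar>)) > 1"
      and Rs_pos: "Rs > 0"
      and Rs_sol: "(\<lambda>n. real (Suc n) * cheb_c V (Suc n) Rs) sums 1"
      and Rs_min: "\<forall>R. 0 < R \<and> R < Rs \<longrightarrow> \<not> ((\<lambda>n. real (Suc n) * cheb_c V (Suc n) R) sums 1)"
  shows "(\<forall>R>0. (\<lambda>r. (P_fun V r r)\<^sup>2 / r) integrable_on {min R Rs..Rs} \<and>
            excess_free_energy V R =
              ereal (1/2 * integral {min R Rs..Rs} (\<lambda>r. (P_fun V r r)\<^sup>2 / r)))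
       \<and> (\<forall>R. 0 < R \<and> R < Rs \<longrightarrow> excess_free_energy V R > 0)
       \<and> (\<forall>R. R \<ge> Rs \<longrightarrow> excess_free_energy V R = 0)
       \<and> (\<exists>C>0. let F = (\<lambda>R. real_of_ereal (excess_free_energy V R)) in
            (F \<sim>[at Rs] (\<lambda>R. C * (Rs - R) ^ 3 * indicator {..Rs} R))
          \<and> F Rs = 0
          \<and> F differentiable (at Rs) \<and> deriv F Rs = 0
          \<and> deriv F differentiable (at Rs) \<and> deriv (deriv F) Rs = 0
          \<and> (\<forall>\<^sub>F R in at_left Rs. deriv (deriv F) differentiable (at R))
          \<and> (((deriv ^^ 3) F) \<longlongrightarrow> - 6 * C) (at_left Rs))"
proof -
  define V1 V2 V3 where "V1 = deriv V" and "V2 = deriv V1" and "V3 = deriv V2"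
  have d3: "(deriv ^^ 3) V = V3" "(deriv ^^ 2) V = V2" "(deriv ^^ 1) V = V1" "(deriv ^^ 0) V = V"
    by (simp_all add: V1_def V2_def V3_def numeral_3_eq_3 numeral_2_eq_2)
  have deriv: "(f has_real_derivative deriv f x) (at x)" if "f differentiable (at x)" for f :: "real \<Rightarrow> real" and x
    using that by (metis DERIV_imp_deriv real_differentiable_def)
  have diff: "((deriv ^^ k) V) differentiable (at x)" if "k < 3" for k x
    using C3_diff that by blast
  interpret even_convex_potential V V1 V2 V3
  proof
    show "(V has_real_derivative V1 x) (at x)" for x
      using deriv[OF diff[of 0 x]] by (simp add: V1_def)
    show "(V1 has_real_derivative V2 x) (at x)" for x
      using deriv[OF diff[of 1 x]] by (simp add: V1_def V2_def)
    show "(V2 has_real_derivative V3 x) (at x)" for x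
      using deriv[OF diff[of 2 x]] by (simp only: d3 V3_def)
    show "continuous_on UNIV V3" using C3_cont by (simp only: d3)
  qed (use symm conv in auto)
  \<comment> \<open>The equation defining Rs becomes g Rs = 1, the only form in which the
    development uses it.\<close>
  have g: "g Rs = 1" using sums_unique2[OF sums_n_cheb_c Rs_sol] .
  have F: "F = (\<lambda>R. real_of_ereal (excess_free_energy V R))"
    by (rule ext) (rule F_def)
  show ?thesis
  proof (intro conjI allI impI)
    fix R :: real assume R: "0 < R"
    show "(\<lambda>r. (P_fun V r r)\<^sup>2 / r) integrable_on {min R Rs..Rs}"
      and "excess_free_energy V R = ereal (1/2 * integral {min R Rs..Rs} (\<lambda>r. (P_fun V r r)\<^sup>2 / r))"
      by (rule excess_free_energy_integral[OF Rs_pos g R])+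
  next
    fix R :: real assume "0 < R \<and> R < Rs"
    then show "0 < excess_free_energy V R" by (intro excess_free_energy_pos[OF Rs_pos g]) auto
  next
    fix R :: real assume "Rs \<le> R"
    then show "excess_free_energy V R = 0"
      using excess_free_energy_eq[OF Rs_pos g, of R] Rs_pos by (simp add: min_def zero_ereal_def)
  next
    show "\<exists>C>0. let F = (\<lambda>R. real_of_ereal (excess_free_energy V R)) in
            (F \<sim>[at Rs] (\<lambda>R. C * (Rs - R) ^ 3 * indicator {..Rs} R))
          \<and> F Rs = 0
          \<and> F differentiable (at Rs) \<and> deriv F Rs = 0
          \<and> deriv F differentiable (at Rs) \<and> deriv (deriv F) Rs = 0
          \<and> (\<forall>\<^sub>F R in at_left Rs. deriv (deriv F) differentiable (at R))
          \<and> (((deriv ^^ 3) F) \<longlongrightarrow> - 6 * C) (at_left Rs)"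
      unfolding Let_def by (rule F_third_order[OF Rs_pos g, unfolded F])
  qed
qed

end
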